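(* Let $m\ge 1$ and $c\ge 2$, let $F$ be the free $m$-generated, $c$-nilpotent group, and let $H$ be a nontrivial normal subgroup of $F$. Then $H$ is undistorted in $F$ if and only if $[F:H]<\infty$.
   Context: The descending central series of a group $G$ is $\gamma_1(G)=G$, $\gamma_i(G)=[G,\gamma_{i-1}(G)]$. The free $m$-generated, $c$-nilpotent group is $R/\gamma_{c+1}(R)$, where $R$ is the (absolutely) free group of rank $m$. Distortion: let $G$ be a group generated by a finite set $T$ and $H\le G$ a subgroup generated by a finite set $S$. The distortion function of $H$ in $G$ is $\Delta^G_H:\mathbb N\to\mathbb N$, $\Delta^G_H(n)=\max\{|w|_S : w\in H,\ |w|_T\le n\}$, where $|w|_S$, $|w|_T$ denote word lengths with respect to $S$ and $T$. For functions $f,g$ on $\mathbb N$ write $f\preceq g$ if there is $C>0$ with $f(n)\le C\,g(Cn+C)$ for all $n\ge 0$, and $f\approx g$ if $f\preceq g$ and $g\preceq f$. Up to $\approx$, $\Delta_H^G$ does not depend on the choice of $S,T$. The subgroup $H$ is undistorted in $G$ if $\Delta^G_H(n)\approx n$. (Every subgroup of a finitely generated nilpotent group is finitely generated, so this applies to all $H\le F$.) *)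

theory Defs
  imports "HOL-Algebra.Algebra"
begin

section \<open>Free groups\<close>

text \<open>
  Words over \<open>Y\<close> are lists of letters \<open>(x, b)\<close>: \<open>(x, True)\<close> stands for \<open>x\<close> and \<open>(x, False)\<close>
  for its formal inverse. The free group on \<open>Y\<close> consists of the classes of words modulo
  insertion and deletion of subwords \<open>x x\<^sup>-\<^sup>1\<close> and \<open>x\<^sup>-\<^sup>1 x\<close>.
\<close>

definition words :: "'a set \<Rightarrow> ('a \<times> bool) list set"
  where "words Y = lists (Y \<times> UNIV)"

inductive_set free_equiv :: "'a set \<Rightarrow> (('a \<times> bool) list \<times> ('a \<times> bool) list) set"
  for Y :: "'a set"
  where
    refl: "u \<in> words Y \<Longrightarrow> (u, u) \<in> free_equiv Y"
  | cancel: "u \<in> words Y \<Longrightarrow> v \<in> words Y \<Longrightarrow> x \<in> Y \<Longrightarrow>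
      (u @ [(x, b), (x, \<not> b)] @ v, u @ v) \<in> free_equiv Y"
  | sym: "(u, v) \<in> free_equiv Y \<Longrightarrow> (v, u) \<in> free_equiv Y"
  | trans: "(u, v) \<in> free_equiv Y \<Longrightarrow> (v, w) \<in> free_equiv Y \<Longrightarrow> (u, w) \<in> free_equiv Y"

definition free_group :: "'a set \<Rightarrow> ('a \<times> bool) list set monoid"
  where "free_group Y =
    \<lparr>carrier = words Y // free_equiv Y,
     monoid.mult = (\<lambda>A B. \<Union>u\<in>A. \<Union>v\<in>B. free_equiv Y `` {u @ v}),
     one = free_equiv Y `` {[]}\<rparr>"

lemma words_simps [simp]:
  "[] \<in> words Y"
  "l # u \<in> words Y \<longleftrightarrow> fst l \<in> Y \<and> u \<in> words Y"
  "u @ v \<in> words Y \<longleftrightarrow> u \<in> words Y \<and> v \<in> words Y"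
  by (cases l; auto simp: words_def)+

lemma free_equiv_words:
  "(u, v) \<in> free_equiv Y \<Longrightarrow> u \<in> words Y \<and> v \<in> words Y"
  by (induction rule: free_equiv.induct) auto

lemma equiv_free_equiv: "equiv (words Y) (free_equiv Y)"
proof (rule equivI)
  show "free_equiv Y \<subseteq> words Y \<times> words Y"
    using free_equiv_words by fastforce
  show "refl_on (words Y) (free_equiv Y)"
    by (auto intro!: refl_onI free_equiv.refl)
  show "Relation.sym (free_equiv Y)"
    by (auto intro!: symI free_equiv.sym)
  show "Relation.trans (free_equiv Y)"
    by (auto intro!: transI elim: free_equiv.trans)
qed

lemma free_equiv_append_left:
  assumes "(u, v) \<in> free_equiv Y" "w \<in> words Y"
  shows "(w @ u, w @ v) \<in> free_equiv Y"
  using assms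
proof (induction rule: free_equiv.induct)
  case (cancel u v x b)
  then show ?case
    using free_equiv.cancel[of "w @ u" Y v x b] by simp
qed (auto intro: free_equiv.intros)

lemma free_equiv_append_right:
  assumes "(u, v) \<in> free_equiv Y" "w \<in> words Y"
  shows "(u @ w, v @ w) \<in> free_equiv Y"
  using assms
proof (induction rule: free_equiv.induct)
  case (cancel u v x b)
  then show ?case
    using free_equiv.cancel[of u Y "v @ w" x b] by simp
qed (auto intro: free_equiv.intros)

lemma free_group_mult_class:
  assumes "u \<in> words Y" "v \<in> words Y"
  shows "free_equiv Y `` {u} \<otimes>\<^bsub>free_group Y\<^esub> free_equiv Y `` {v} = free_equiv Y `` {u @ v}"
proof -
  have "congruent2 (free_equiv Y) (free_equiv Y) (\<lambda>u v. free_equiv Y `` {u @ v})"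
    by (rule congruent2I[OF equiv_free_equiv equiv_free_equiv])
      (auto intro!: equiv_class_eq[OF equiv_free_equiv]
        free_equiv_append_left free_equiv_append_right)
  from UN_equiv_class2[OF equiv_free_equiv equiv_free_equiv this assms]
  show ?thesis by (simp add: free_group_def)
qed

lemma free_group_carrierE:
  assumes "A \<in> carrier (free_group Y)"
  obtains u where "u \<in> words Y" "A = free_equiv Y `` {u}"
  using assms by (auto simp: free_group_def elim: quotientE)

lemma free_group_carrierI:
  "u \<in> words Y \<Longrightarrow> free_equiv Y `` {u} \<in> carrier (free_group Y)"
  by (auto simp: free_group_def intro: quotientI)

lemma free_group_one: "\<one>\<^bsub>free_group Y\<^esub> = free_equiv Y `` {[]}"
  by (simp add: free_group_def)

lemma free_equiv_inverse:
  "u \<in> words Y \<Longrightarrow> \<exists>v \<in> words Y. (v @ u, []) \<in> free_equiv Y"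
proof (induction u)
  case Nil
  then show ?case by (intro bexI[of _ "[]"]) (auto intro: free_equiv.refl)
next
  case (Cons l u)
  obtain x b where l: "l = (x, b)" by (cases l)
  from Cons l obtain v where v: "v \<in> words Y" "(v @ u, []) \<in> free_equiv Y"
    and x: "x \<in> Y" "u \<in> words Y" by auto
  have "(v @ [(x, \<not> b), (x, b)] @ u, v @ u) \<in> free_equiv Y"
    using free_equiv.cancel[of v Y u x "\<not> b"] v x by simp
  with v have "((v @ [(x, \<not> b)]) @ l # u, []) \<in> free_equiv Y"
    by (auto simp: l intro: free_equiv.trans)
  with v x show ?case by (intro bexI[of _ "v @ [(x, \<not> b)]"]) auto
qed

lemma group_free_group: "group (free_group Y)"
proof (rule groupI)
  fix A assume "A \<in> carrier (free_group Y)"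
  then obtain u where u: "u \<in> words Y" "A = free_equiv Y `` {u}"
    by (rule free_group_carrierE)
  then obtain v where v: "v \<in> words Y" "(v @ u, []) \<in> free_equiv Y"
    using free_equiv_inverse by blast
  have "free_equiv Y `` {v} \<otimes>\<^bsub>free_group Y\<^esub> A = \<one>\<^bsub>free_group Y\<^esub>"
    using u v by (simp add: free_group_mult_class free_group_one
      equiv_class_eq[OF equiv_free_equiv])
  with v show "\<exists>B\<in>carrier (free_group Y). B \<otimes>\<^bsub>free_group Y\<^esub> A = \<one>\<^bsub>free_group Y\<^esub>"
    by (blast intro: free_group_carrierI)
qed (auto elim!: free_group_carrierE
    simp: free_group_mult_class free_group_carrierI free_group_one)


section \<open>Lower central series and free nilpotent groups\<close>

definition commutator_subgroup :: "('a, 'b) monoid_scheme \<Rightarrow> 'a set \<Rightarrow> 'a set \<Rightarrow> 'a set"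
  where "commutator_subgroup G A B =
    generate G {a \<otimes>\<^bsub>G\<^esub> b \<otimes>\<^bsub>G\<^esub> inv\<^bsub>G\<^esub> a \<otimes>\<^bsub>G\<^esub> inv\<^bsub>G\<^esub> b | a b. a \<in> A \<and> b \<in> B}"

text \<open>The series is indexed from 1; the value at 0 is a dummy.\<close>

fun lower_central :: "('a, 'b) monoid_scheme \<Rightarrow> nat \<Rightarrow> 'a set"
  where
    "lower_central G 0 = carrier G"
  | "lower_central G (Suc 0) = carrier G"
  | "lower_central G (Suc (Suc i)) =
      commutator_subgroup G (carrier G) (lower_central G (Suc i))"

definition free_nilpotent_group :: "nat \<Rightarrow> nat \<Rightarrow> (nat \<times> bool) list set set monoid"
  where "free_nilpotent_group m c =
    free_group {..<m} Mod lower_central (free_group {..<m}) (c + 1)"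

lemma (in group) normal_commutator_subgroup:
  assumes "N \<lhd> G"
  shows "commutator_subgroup G (carrier G) N \<lhd> G"
  unfolding commutator_subgroup_def
proof (rule normal_generateI)
  interpret N: normal N G by fact
  show "{a \<otimes> b \<otimes> inv a \<otimes> inv b | a b. a \<in> carrier G \<and> b \<in> N} \<subseteq> carrier G"
    using N.subset by auto
  fix h g assume "h \<in> {a \<otimes> b \<otimes> inv a \<otimes> inv b | a b. a \<in> carrier G \<and> b \<in> N}"
    and g: "g \<in> carrier G"
  then obtain a b where ab: "a \<in> carrier G" "b \<in> N" "h = a \<otimes> b \<otimes> inv a \<otimes> inv b"
    by blast
  have b: "b \<in> carrier G" using ab N.subset by auto
  have cancel: "x \<otimes> inv g \<otimes> (g \<otimes> y) = x \<otimes> y" if "x \<in> carrier G" "y \<in> carrier G" for x y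
    using that g by (metis inv_closed inv_solve_left m_assoc m_closed)
  have i: "inv (g \<otimes> x \<otimes> inv g) = g \<otimes> inv x \<otimes> inv g" if "x \<in> carrier G" for x
    using that g by (simp add: inv_mult_group m_assoc)
  have c: "(g \<otimes> x \<otimes> inv g) \<otimes> (g \<otimes> y \<otimes> inv g) = g \<otimes> (x \<otimes> y) \<otimes> inv g"
    if "x \<in> carrier G" "y \<in> carrier G" for x y
    using that g cancel[of "g \<otimes> x" "y \<otimes> inv g"] by (simp add: m_assoc)
  have "g \<otimes> h \<otimes> inv g = (g \<otimes> a \<otimes> inv g) \<otimes> (g \<otimes> b \<otimes> inv g)
      \<otimes> inv (g \<otimes> a \<otimes> inv g) \<otimes> inv (g \<otimes> b \<otimes> inv g)"
    using ab b g by (simp add: i c)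
  moreover have "g \<otimes> b \<otimes> inv g \<in> N"
    using ab g by (simp add: N.inv_op_closed2)
  moreover have "g \<otimes> a \<otimes> inv g \<in> carrier G" using ab g by simp
  ultimately show "g \<otimes> h \<otimes> inv g \<in> {a \<otimes> b \<otimes> inv a \<otimes> inv b | a b. a \<in> carrier G \<and> b \<in> N}"
    by blast
qed

lemma (in group) normal_lower_central: "lower_central G i \<lhd> G"
proof (induction i)
  case 0
  show ?case by (auto intro: normal_invI subgroup_self)
next
  case (Suc i)
  show ?case
  proof (cases i)
    case 0
    then show ?thesis by (auto intro: normal_invI subgroup_self)
  next
    case (Suc j)
    with \<open>lower_central G i \<lhd> G\<close> show ?thesis
      by (simp add: normal_commutator_subgroup)
  qed
qed

lemma group_free_nilpotent_group: "group (free_nilpotent_group m c)"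
  unfolding free_nilpotent_group_def
  by (intro normal.factorgroup_is_group group.normal_lower_central group_free_group)


section \<open>Distortion\<close>

definition word_length :: "('a, 'b) monoid_scheme \<Rightarrow> 'a set \<Rightarrow> 'a \<Rightarrow> nat"
  where "word_length G S g =
    (LEAST n. \<exists>ws. length ws = n \<and> set ws \<subseteq> S \<union> m_inv G ` S \<and>
      foldr (\<otimes>\<^bsub>G\<^esub>) ws \<one>\<^bsub>G\<^esub> = g)"

definition distortion :: "('a, 'b) monoid_scheme \<Rightarrow> 'a set \<Rightarrow> 'a set \<Rightarrow> 'a set \<Rightarrow> nat \<Rightarrow> nat"
  where "distortion G T H S n = Max {word_length G S w | w. w \<in> H \<and> word_length G T w \<le> n}"

definition asymp_le :: "(nat \<Rightarrow> nat) \<Rightarrow> (nat \<Rightarrow> nat) \<Rightarrow> bool"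
  where "asymp_le f g \<longleftrightarrow> (\<exists>C>0. \<forall>n. f n \<le> C * g (C * n + C))"

definition asymp_equiv :: "(nat \<Rightarrow> nat) \<Rightarrow> (nat \<Rightarrow> nat) \<Rightarrow> bool"
  where "asymp_equiv f g \<longleftrightarrow> asymp_le f g \<and> asymp_le g f"

definition fin_generates :: "('a, 'b) monoid_scheme \<Rightarrow> 'a set \<Rightarrow> 'a set \<Rightarrow> bool"
  where "fin_generates G S H \<longleftrightarrow> finite S \<and> S \<subseteq> carrier G \<and> generate G S = H"

text \<open>
  The choice of the finite generating sets \<open>T\<close> and \<open>S\<close> is immaterial: see
  \<open>undistorted_iff\<close> below.
\<close>

definition undistorted :: "('a, 'b) monoid_scheme \<Rightarrow> 'a set \<Rightarrow> bool"
  where "undistorted G H \<longleftrightarrow>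
    (\<exists>T S. fin_generates G T (carrier G) \<and> fin_generates G S H \<and>
      asymp_equiv (distortion G T H S) (\<lambda>n. n))"

context group
begin

lemma foldr_mult_closed:
  "set ws \<subseteq> carrier G \<Longrightarrow> foldr (\<otimes>) ws \<one> \<in> carrier G"
  by (induction ws) auto

lemma foldr_mult_append:
  "set us \<subseteq> carrier G \<Longrightarrow> set vs \<subseteq> carrier G \<Longrightarrow>
    foldr (\<otimes>) (us @ vs) \<one> = foldr (\<otimes>) us \<one> \<otimes> foldr (\<otimes>) vs \<one>"
  by (induction us) (auto simp: foldr_mult_closed m_assoc simp del: foldr_append)

lemma letters_carrier: "S \<subseteq> carrier G \<Longrightarrow> S \<union> m_inv G ` S \<subseteq> carrier G"
  by auto

lemma generate_word:
  assumes "S \<subseteq> carrier G" "g \<in> generate G S"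
  shows "\<exists>ws. set ws \<subseteq> S \<union> m_inv G ` S \<and> foldr (\<otimes>) ws \<one> = g"
  using assms(2)
proof (induction rule: generate.induct)
  case one
  show ?case by (intro exI[of _ "[]"]) auto
next
  case (incl h)
  then show ?case using assms(1) by (intro exI[of _ "[h]"]) auto
next
  case (inv h)
  then show ?case using assms(1) by (intro exI[of _ "[inv h]"]) auto
next
  case (eng h1 h2)
  then obtain us vs where
    "set us \<subseteq> S \<union> m_inv G ` S" "foldr (\<otimes>) us \<one> = h1"
    "set vs \<subseteq> S \<union> m_inv G ` S" "foldr (\<otimes>) vs \<one> = h2" by blast
  then show ?case using letters_carrier[OF assms(1)]
    by (intro exI[of _ "us @ vs"]) (simp add: foldr_mult_append subset_trans del: foldr_append)
qed

lemma word_generate: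
  assumes "S \<subseteq> carrier G" "set ws \<subseteq> S \<union> m_inv G ` S"
  shows "foldr (\<otimes>) ws \<one> \<in> generate G S"
  using assms(2)
  by (induction ws) (auto intro: generate.intros)

lemma word_length_obtain:
  assumes "S \<subseteq> carrier G" "g \<in> generate G S"
  obtains ws where "length ws = word_length G S g" "set ws \<subseteq> S \<union> m_inv G ` S"
    "foldr (\<otimes>) ws \<one> = g"
proof -
  have "\<exists>n ws. length ws = n \<and> set ws \<subseteq> S \<union> m_inv G ` S \<and> foldr (\<otimes>) ws \<one> = g"
    using generate_word[OF assms] by blast
  from LeastI_ex[OF this] show ?thesis
    unfolding word_length_def[symmetric] using that by blast
qed

lemma word_length_le:
  assumes "set ws \<subseteq> S \<union> m_inv G ` S" "foldr (\<otimes>) ws \<one> = g"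
  shows "word_length G S g \<le> length ws"
  unfolding word_length_def using assms by (intro Least_le) blast

lemma word_length_one [simp]: "word_length G S \<one> = 0"
  using word_length_le[of "[]" S \<one>] by simp

lemma word_length_mult:
  assumes "S \<subseteq> carrier G" "g \<in> generate G S" "h \<in> generate G S"
  shows "word_length G S (g \<otimes> h) \<le> word_length G S g + word_length G S h"
proof -
  obtain us where us: "length us = word_length G S g" "set us \<subseteq> S \<union> m_inv G ` S"
    "foldr (\<otimes>) us \<one> = g" using assms word_length_obtain by blast
  obtain vs where vs: "length vs = word_length G S h" "set vs \<subseteq> S \<union> m_inv G ` S"
    "foldr (\<otimes>) vs \<one> = h" using assms word_length_obtain by blast
  have "foldr (\<otimes>) (us @ vs) \<one> = g \<otimes> h"
    using us vs letters_carrier[OF assms(1)]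
    by (simp add: foldr_mult_append subset_trans del: foldr_append)
  with us vs word_length_le[of "us @ vs" S "g \<otimes> h"] show ?thesis by simp
qed

lemma word_length_change:
  assumes "fin_generates G S H" "fin_generates G S' H"
  shows "\<exists>K>0. \<forall>g\<in>H. word_length G S g \<le> K * word_length G S' g"
proof -
  from assms have S: "S \<subseteq> carrier G" "generate G S = H"
    and S': "finite S'" "S' \<subseteq> carrier G" "generate G S' = H"
    by (auto simp: fin_generates_def)
  define A where "A = S' \<union> m_inv G ` S'"
  have A: "finite A" "A \<subseteq> H"
    using S' by (auto simp: A_def intro: generate.intros)
  define K where "K = Suc (Max (insert 0 (word_length G S ` A)))"
  have K: "word_length G S a \<le> K" if "a \<in> A" for a
    unfolding K_def using that A(1) by (intro le_SucI Max_ge) auto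
  have *: "word_length G S (foldr (\<otimes>) ws \<one>) \<le> K * length ws" if "set ws \<subseteq> A" for ws
    using that
  proof (induction ws)
    case (Cons a ws)
    then have "foldr (\<otimes>) ws \<one> \<in> generate G S"
      using word_generate[OF S'(2), of ws] S S' by (simp add: A_def)
    moreover have "a \<in> generate G S" using Cons A S by auto
    ultimately have "word_length G S (a \<otimes> foldr (\<otimes>) ws \<one>)
        \<le> word_length G S a + word_length G S (foldr (\<otimes>) ws \<one>)"
      using S by (intro word_length_mult)
    also have "\<dots> \<le> K + K * length ws" using Cons K by (intro add_mono) auto
    finally show ?case by simp
  qed simp
  have "word_length G S g \<le> K * word_length G S' g" if "g \<in> H" for g
    using word_length_obtain[OF S'(2), of g] * that S' unfolding A_def by metis
  then show ?thesis by (intro exI[of _ K]) (auto simp: K_def)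
qed

lemma finite_ball:
  assumes "fin_generates G T (carrier G)" "H \<subseteq> carrier G"
  shows "finite {w \<in> H. word_length G T w \<le> n}"
proof (rule finite_subset)
  from assms(1) have T: "finite T" "T \<subseteq> carrier G" "generate G T = carrier G"
    by (auto simp: fin_generates_def)
  let ?L = "{ws. set ws \<subseteq> T \<union> m_inv G ` T \<and> length ws \<le> n}"
  show "finite ((\<lambda>ws. foldr (\<otimes>) ws \<one>) ` ?L)"
    using T by (intro finite_imageI finite_lists_length_le) auto
  show "{w \<in> H. word_length G T w \<le> n} \<subseteq> (\<lambda>ws. foldr (\<otimes>) ws \<one>) ` ?L"
  proof
    fix w assume w: "w \<in> {w \<in> H. word_length G T w \<le> n}"
    then have "w \<in> generate G T" using assms T by auto
    then obtain ws where "length ws = word_length G T w" "set ws \<subseteq> T \<union> m_inv G ` T"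
      "foldr (\<otimes>) ws \<one> = w" using word_length_obtain[OF T(2)] by blast
    with w show "w \<in> (\<lambda>ws. foldr (\<otimes>) ws \<one>) ` ?L" by (intro image_eqI[of _ _ ws]) auto
  qed
qed

lemma fin_generates_subgroup: "fin_generates G S H \<Longrightarrow> subgroup H G"
  unfolding fin_generates_def using generate_is_subgroup by blast

lemma distortion_ge:
  assumes "fin_generates G T (carrier G)" "H \<subseteq> carrier G" "w \<in> H" "word_length G T w \<le> n"
  shows "word_length G S w \<le> distortion G T H S n"
  unfolding distortion_def
  using assms finite_imageI[OF finite_ball[OF assms(1,2), of n], of "word_length G S"]
  by (intro Max_ge) (auto simp: image_def elim!: rev_finite_subset)

lemma distortion_le:
  assumes "fin_generates G T (carrier G)" "subgroup H G"
    "\<And>w. w \<in> H \<Longrightarrow> word_length G T w \<le> n \<Longrightarrow> word_length G S w \<le> k"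
  shows "distortion G T H S n \<le> k"
proof -
  interpret H: subgroup H G by fact
  have "finite {word_length G S w | w. w \<in> H \<and> word_length G T w \<le> n}"
    using finite_imageI[OF finite_ball[OF assms(1) H.subset, of n], of "word_length G S"]
    by (auto simp: image_def elim!: rev_finite_subset)
  moreover have "\<exists>w. w \<in> H \<and> word_length G T w \<le> n"
    by (intro exI[of _ \<one>]) auto
  ultimately show ?thesis
    unfolding distortion_def using assms(3) by (subst Max_le_iff) auto
qed

lemma mono_distortion:
  assumes "fin_generates G T (carrier G)" "subgroup H G"
  shows "mono (distortion G T H S)"
  using assms subgroup.subset[OF assms(2)]
  by (intro monoI distortion_le[OF assms] distortion_ge) auto

lemma distortion_change:
  assumes "fin_generates G T (carrier G)" "fin_generates G T' (carrier G)"
    "fin_generates G S H" "fin_generates G S' H"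
  shows "asymp_le (distortion G T H S) (distortion G T' H S')"
proof -
  have H: "subgroup H G" using assms(3) by (rule fin_generates_subgroup)
  obtain K where K: "\<And>g. g \<in> H \<Longrightarrow> word_length G S g \<le> K * word_length G S' g" "K > 0"
    using word_length_change[OF assms(3,4)] by blast
  obtain L where L: "\<And>g. g \<in> carrier G \<Longrightarrow> word_length G T' g \<le> L * word_length G T g" "L > 0"
    using word_length_change[OF assms(2,1)] by blast
  have "distortion G T H S n \<le> (K + L) * distortion G T' H S' ((K + L) * n + (K + L))" for n
  proof (rule distortion_le[OF assms(1) H])
    fix w assume w: "w \<in> H" "word_length G T w \<le> n"
    have "word_length G T' w \<le> L * word_length G T w"
      using L w subgroup.subset[OF H] by blast
    also have "\<dots> \<le> L * n" using w by simp
    also have "\<dots> \<le> (K + L) * n + (K + L)" by (simp add: algebra_simps)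
    finally have "word_length G S' w \<le> distortion G T' H S' ((K + L) * n + (K + L))"
      using w by (intro distortion_ge[OF assms(2) subgroup.subset[OF H]])
    then show "word_length G S w \<le> (K + L) * distortion G T' H S' ((K + L) * n + (K + L))"
      using K(1)[OF w(1)] by (meson le_add1 le_trans mult_le_mono)
  qed
  with K(2) show ?thesis unfolding asymp_le_def by (intro exI[of _ "K + L"]) auto
qed

end

lemma asymp_le_trans:
  assumes "asymp_le f g" "asymp_le g h" "mono h"
  shows "asymp_le f h"
proof -
  from assms obtain C D where C: "C > 0" "\<And>n. f n \<le> C * g (C * n + C)"
    and D: "D > 0" "\<And>n. g n \<le> D * h (D * n + D)" unfolding asymp_le_def by blast
  define E where "E = C * D + D"
  have "f n \<le> E * h (E * n + E)" for n
  proof -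
    have "f n \<le> C * (D * h (D * (C * n + C) + D))"
      using C(2)[of n] D(2)[of "C * n + C"] by (meson le_trans mult_le_mono2)
    also have "\<dots> = (C * D) * h (D * (C * n + C) + D)" by simp
    also have "\<dots> \<le> E * h (E * n + E)"
      by (intro mult_le_mono monoD[OF assms(3)]) (auto simp: E_def algebra_simps)
    finally show ?thesis .
  qed
  with D(1) show ?thesis unfolding asymp_le_def by (intro exI[of _ E]) (auto simp: E_def)
qed

lemma (in group) undistorted_iff:
  assumes "fin_generates G T (carrier G)" "fin_generates G S H"
  shows "undistorted G H \<longleftrightarrow> asymp_equiv (distortion G T H S) (\<lambda>n. n)"
proof
  assume "undistorted G H"
  then obtain T' S' where *: "fin_generates G T' (carrier G)" "fin_generates G S' H"
    "asymp_equiv (distortion G T' H S') (\<lambda>n. n)" unfolding undistorted_def by blast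
  have "mono (distortion G T H S)"
    by (intro mono_distortion assms fin_generates_subgroup[OF assms(2)])
  moreover have "mono (\<lambda>n::nat. n)" by (simp add: mono_def)
  ultimately show "asymp_equiv (distortion G T H S) (\<lambda>n. n)"
    using *(3) distortion_change[OF assms(1) *(1) assms(2) *(2)]
      distortion_change[OF *(1) assms(1) *(2) assms(2)]
    unfolding asymp_equiv_def by (meson asymp_le_trans)
qed (use assms in \<open>auto simp: undistorted_def\<close>)

end

theory Submission
  imports Defs
begin

text \<open>
  The free group \<open>R\<close> maps to the units of the noncommutative power series ring by
  \<open>x\<^sub>i \<mapsto> 1 + X\<^sub>i\<close> (Magnus), and an element of \<open>\<gamma>\<^sub>k(R)\<close> has no terms in degrees
  \<open>1, \<dots>, k - 1\<close>. The Dynkin operator shows that \<open>g \<in> \<gamma>\<^sub>k(R)\<close> with vanishing degree \<open>k\<close>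
  part satisfies \<open>g\<^sup>k \<in> \<gamma>\<^sub>k\<^sub>+\<^sub>1(R)\<close>; hence the Magnus representation of \<open>F = R/\<gamma>\<^sub>c\<^sub>+\<^sub>1(R)\<close>
  truncated above degree \<open>c\<close> has finite kernel. This replaces the torsion-freeness of \<open>F\<close>.

  If the image of \<open>H\<close> in \<open>\<int>\<^sup>m\<close> has finite index, then so has \<open>H\<close> in the nilpotent group \<open>F\<close>.
  Otherwise some nonzero linear form \<open>a\<close> vanishes on that image. Taking commutators of an element
  of the normal subgroup \<open>H\<close> with a generator \<open>x\<^sub>p\<close>, \<open>a(x\<^sub>p) \<noteq> 0\<close>, one reaches
  \<open>z \<in> H \<inter> \<gamma>\<^sub>c(F)\<close> whose degree \<open>c\<close> part is not killed by contracting its first slot with \<open>a\<close>.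
  This contracted coefficient grows at most like \<open>n\<^sup>c\<^sup>-\<^sup>1\<close> on products of \<open>n\<close> generators of \<open>H\<close>,
  while it is proportional to \<open>n\<^sup>c\<close> on \<open>z\<close> raised to the power \<open>n\<^sup>c\<close>, an element of length
  \<open>O(n)\<close> in \<open>F\<close>. So \<open>H\<close> is distorted.
\<close>

section \<open>Noncommutative power series\<close>

text \<open>The exponent c - 1 arises as follows. In a product of generators of \<open>H\<close>,
  some factor supplies the letter contracted with \<open>a\<close>. If it supplied no other letter,
  its contribution would be its degree 1 part contracted with \<open>a\<close>, which is 0. So the
  first factor involved supplies at least two letters, and a word of length c meets at most c - 1
  factors. The obstacle is torsion: with no basis of the free Lie ring at hand, Magnus coefficients
  are shown to detect the lower central series only up to powers. The statements are therefore
  arranged to tolerate powers and finite exceptional sets. The finite kernel matters when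
  \<open>H\<close> has zero image in the abelianization: an undistorted subgroup is infinite, hence
  has an element with a nonzero coefficient in some degree from 1 to c. Every linear form then
  vanishes on the image, so the form can be adapted at the end to the element that was reached. For
  finite index, Schreier rewriting bounds lengths in \<open>H\<close> from above, and the degree 1
  coefficient of powers of a generator bounds them from below.\<close>

typedef ncseries = "UNIV :: (nat list \<Rightarrow> int) set"
  morphisms coef Series ..

lemma coef_Series [simp]: "coef (Series f) = f"
  by (simp add: Series_inverse)

lemma ncseries_eqI: "(\<And>w. coef f w = coef g w) \<Longrightarrow> f = g"
  by (metis coef_inject ext)

definition left_shift :: "nat \<Rightarrow> ncseries \<Rightarrow> ncseries"
  where "left_shift i f = Series (\<lambda>w. coef f (i # w))"

definition right_shift :: "nat \<Rightarrow> ncseries \<Rightarrow> ncseries"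
  where "right_shift i f = Series (\<lambda>w. coef f (w @ [i]))"

lemma coef_left_shift [simp]: "coef (left_shift i f) w = coef f (i # w)"
  by (simp add: left_shift_def)

lemma coef_right_shift [simp]: "coef (right_shift i f) w = coef f (w @ [i])"
  by (simp add: right_shift_def)

instantiation ncseries :: ring_1
begin

definition "0 = Series (\<lambda>_. 0)"
definition "1 = Series (\<lambda>w. if w = [] then 1 else 0)"
definition "f + g = Series (\<lambda>w. coef f w + coef g w)"
definition "- f = Series (\<lambda>w. - coef f w)"
definition "f - g = Series (\<lambda>w. coef f w - coef g w)"
definition "f * g = Series (\<lambda>w. \<Sum>i\<le>length w. coef f (take i w) * coef g (drop i w))"

lemma coef_simps [simp]:
  "coef 0 w = 0"
  "coef 1 w = (if w = [] then 1 else 0)"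
  "coef (f + g) w = coef f w + coef g w"
  "coef (- f) w = - coef f w"
  "coef (f - g) w = coef f w - coef g w"
  by (simp_all add: zero_ncseries_def one_ncseries_def plus_ncseries_def
      uminus_ncseries_def minus_ncseries_def)

lemma coef_mult:
  "coef (f * g) w = (\<Sum>i\<le>length w. coef f (take i w) * coef g (drop i w))"
  by (simp add: times_ncseries_def)

lemma coef_mult_Nil [simp]: "coef (f * g) [] = coef f [] * coef g []"
  by (simp add: coef_mult)

text \<open>A product rule for stripping the first letter. It allows identities to be proved by
  induction on the word instead of by manipulating double sums.\<close>

lemma coef_mult_Cons:
  "coef (f * g) (i # w) = coef f [] * coef g (i # w) + coef (left_shift i f * g) w"
  by (simp add: coef_mult sum.atMost_Suc_shift del: sum.atMost_Suc)

instance
proof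
  have distr: "(f + g) * h = f * h + g * h" for f g h :: ncseries
    by (rule ncseries_eqI) (simp add: coef_mult sum.distrib distrib_right)
  have distl: "f * (g + h) = f * g + f * h" for f g h :: ncseries
    by (rule ncseries_eqI) (simp add: coef_mult sum.distrib distrib_left)
  \<comment> \<open>Stripping a letter from \<open>f * g\<close> leaves a term with
    \<open>left_shift i f\<close> in place of \<open>f\<close>, so the induction on the word needs
    \<open>f\<close> arbitrary.\<close>
  have assoc: "coef (f * g * h) w = coef (f * (g * h)) w" for f g h :: ncseries and w
  proof (induction w arbitrary: f)
    case (Cons i w)
    have "left_shift i (f * g) = Series (\<lambda>v. coef f [] * coef (left_shift i g) v) + left_shift i f * g"
      by (rule ncseries_eqI) (simp add: coef_mult_Cons)
    moreover have "coef (Series (\<lambda>v. coef f [] * coef (left_shift i g) v) * h) w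
        = coef f [] * coef (left_shift i g * h) w"
      by (simp add: coef_mult sum_distrib_left mult.assoc)
    ultimately have "coef (left_shift i (f * g) * h) w
        = coef f [] * coef (left_shift i g * h) w + coef (left_shift i f * g * h) w"
      by (simp add: distr)
    then show ?case
      by (simp add: coef_mult_Cons Cons.IH algebra_simps)
  qed simp
  fix f g h :: ncseries
  show "f * g * h = f * (g * h)" by (rule ncseries_eqI) (rule assoc)
  show "1 * f = f"
  proof (rule ncseries_eqI)
    fix w show "coef (1 * f) w = coef f w"
    proof (cases w)
      case (Cons i v)
      have "left_shift i 1 = 0" by (rule ncseries_eqI) simp
      then show ?thesis using Cons by (simp add: coef_mult_Cons) (simp add: coef_mult)
    qed simp
  qed
  have *: "coef (f * 1) w = coef f w" for f w
    by (induction w arbitrary: f) (simp_all add: coef_mult_Cons)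
  show "f * 1 = f" by (rule ncseries_eqI) (rule *)
  show "(f + g) * h = f * h + g * h" by (rule distr)
  show "f * (g + h) = f * g + f * h" by (rule distl)
  show "(0 :: ncseries) \<noteq> 1" by (metis coef_simps(1,2) zero_neq_one)
qed (auto intro!: ncseries_eqI)

end

lemma coef_mult_snoc:
  "coef (f * g) (w @ [i]) = coef (f * right_shift i g) w + coef f (w @ [i]) * coef g []"
  by (simp add: coef_mult)

definition vanish :: "nat \<Rightarrow> ncseries \<Rightarrow> bool"
  where "vanish k f \<longleftrightarrow> (\<forall>w. length w < k \<longrightarrow> coef f w = 0)"

lemma vanish_0 [simp]: "vanish 0 f"
  by (simp add: vanish_def)

lemma vanish_diff: "vanish k f \<Longrightarrow> vanish k g \<Longrightarrow> vanish k (f - g)"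
  by (simp add: vanish_def)

lemma vanish_add: "vanish k f \<Longrightarrow> vanish k g \<Longrightarrow> vanish k (f + g)"
  by (simp add: vanish_def)

lemma vanish_mono: "vanish k f \<Longrightarrow> j \<le> k \<Longrightarrow> vanish j f"
  by (simp add: vanish_def)

lemma vanish_mult:
  assumes "vanish j f" "vanish k g"
  shows "vanish (j + k) (f * g)"
  unfolding vanish_def coef_mult
proof (intro allI impI sum.neutral ballI)
  fix w :: "nat list" and i
  assume "length w < j + k" "i \<in> {..length w}"
  then have "length (take i w) < j \<or> length (drop i w) < k" by auto
  then show "coef f (take i w) * coef g (drop i w) = 0"
    using assms unfolding vanish_def by (metis mult_zero_left mult_zero_right)
qed

text \<open>Only the cut after \<open>j\<close> letters survives: any other cut leaves one of the
  factors with a word that is too short.\<close>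

lemma coef_mult_vanish:
  assumes "vanish j f" "vanish k g" "length w = j + k"
  shows "coef (f * g) w = coef f (take j w) * coef g (drop j w)"
proof -
  have "coef (f * g) w = (\<Sum>i\<le>length w. if i = j then coef f (take j w) * coef g (drop j w) else 0)"
    unfolding coef_mult
  proof (rule sum.cong[OF HOL.refl])
    fix i assume i: "i \<in> {..length w}"
    show "coef f (take i w) * coef g (drop i w)
      = (if i = j then coef f (take j w) * coef g (drop j w) else 0)"
    proof (cases "i = j")
      case False
      then have "length (take i w) < j \<or> length (drop i w) < k" using i assms(3) by auto
      then show ?thesis using False assms(1,2) unfolding vanish_def
        by (metis mult_zero_left mult_zero_right)
    qed simp
  qed
  also have "\<dots> = coef f (take j w) * coef g (drop j w)" using assms(3) by simp
  finally show ?thesis .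
qed

section \<open>Commutator calculus modulo the lower central series\<close>

definition gcomm :: "('a, 'b) monoid_scheme \<Rightarrow> 'a \<Rightarrow> 'a \<Rightarrow> 'a"
  where "gcomm G a b = a \<otimes>\<^bsub>G\<^esub> b \<otimes>\<^bsub>G\<^esub> inv\<^bsub>G\<^esub> a \<otimes>\<^bsub>G\<^esub> inv\<^bsub>G\<^esub> b"

declare lower_central.simps(3) [simp del]

context group
begin

abbreviation "comm \<equiv> gcomm G"
abbreviation "\<Gamma> \<equiv> lower_central G"

text \<open>Congruence modulo \<open>\<Gamma> n\<close> as equality of cosets: computations in the
  associated graded Lie ring become chains of equations between elements of
  \<open>G\<close>.\<close>

abbreviation cls :: "nat \<Rightarrow> 'a \<Rightarrow> 'a set"
  where "cls n a \<equiv> \<Gamma> n #> a"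

lemma mult_cancel [simp]:
  "a \<in> carrier G \<Longrightarrow> b \<in> carrier G \<Longrightarrow> inv a \<otimes> (a \<otimes> b) = b"
  "a \<in> carrier G \<Longrightarrow> b \<in> carrier G \<Longrightarrow> a \<otimes> (inv a \<otimes> b) = b"
  by (simp_all flip: m_assoc)

lemma comm_closed [simp]: "a \<in> carrier G \<Longrightarrow> b \<in> carrier G \<Longrightarrow> comm a b \<in> carrier G"
  by (simp add: gcomm_def)

lemma comm_one [simp]: "a \<in> carrier G \<Longrightarrow> comm a \<one> = \<one>" "a \<in> carrier G \<Longrightarrow> comm \<one> a = \<one>"
  by (simp_all add: gcomm_def)

lemma comm_mult_swap:
  "a \<in> carrier G \<Longrightarrow> b \<in> carrier G \<Longrightarrow> comm a b \<otimes> (b \<otimes> a) = a \<otimes> b"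
  by (simp add: gcomm_def m_assoc)

lemma conj_eq_comm:
  "a \<in> carrier G \<Longrightarrow> b \<in> carrier G \<Longrightarrow> a \<otimes> b \<otimes> inv a = comm a b \<otimes> b"
  by (simp add: gcomm_def m_assoc)

lemma conj_comm:
  "x \<in> carrier G \<Longrightarrow> a \<in> carrier G \<Longrightarrow> b \<in> carrier G \<Longrightarrow>
    x \<otimes> comm a b \<otimes> inv x = comm (x \<otimes> a \<otimes> inv x) (x \<otimes> b \<otimes> inv x)"
  by (simp add: gcomm_def m_assoc inv_mult_group)

lemma inv_comm: "a \<in> carrier G \<Longrightarrow> b \<in> carrier G \<Longrightarrow> inv (comm a b) = comm b a"
  by (simp add: gcomm_def m_assoc inv_mult_group)

lemma comm_mult_left:
  "a \<in> carrier G \<Longrightarrow> b \<in> carrier G \<Longrightarrow> w \<in> carrier G \<Longrightarrow>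
    comm (a \<otimes> b) w = (a \<otimes> comm b w \<otimes> inv a) \<otimes> comm a w"
  by (simp add: gcomm_def m_assoc inv_mult_group)

lemma comm_mult_right:
  "a \<in> carrier G \<Longrightarrow> b \<in> carrier G \<Longrightarrow> w \<in> carrier G \<Longrightarrow>
    comm w (a \<otimes> b) = comm w a \<otimes> (a \<otimes> comm w b \<otimes> inv a)"
  by (simp add: gcomm_def m_assoc inv_mult_group)

lemma lc_subgroup: "subgroup (\<Gamma> n) G"
  using normal_lower_central normal_imp_subgroup by blast

lemma lc_closed: "a \<in> \<Gamma> n \<Longrightarrow> a \<in> carrier G"
  using lc_subgroup subgroup.mem_carrier by metis

lemmas lc_simps [simp, intro] =
  subgroup.one_closed[OF lc_subgroup]
  subgroup.m_closed[OF lc_subgroup]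
  subgroup.m_inv_closed[OF lc_subgroup]

lemma lc_int_pow [simp, intro]: "a \<in> \<Gamma> n \<Longrightarrow> a [^] (s :: int) \<in> \<Gamma> n"
  using lc_subgroup subgroup_int_pow_closed by blast

lemma lc_nat_pow [simp, intro]: "a \<in> \<Gamma> n \<Longrightarrow> a [^] (s :: nat) \<in> \<Gamma> n"
  using lc_int_pow[of a n "int s"] by (simp add: int_pow_int)

lemma lc_Suc: "0 < k \<Longrightarrow> \<Gamma> (Suc k) = generate G {comm a b | a b. a \<in> carrier G \<and> b \<in> \<Gamma> k}"
  by (cases k) (simp_all add: lower_central.simps(3) commutator_subgroup_def gcomm_def)

lemma comm_lc_Suc: "0 < k \<Longrightarrow> a \<in> carrier G \<Longrightarrow> b \<in> \<Gamma> k \<Longrightarrow> comm a b \<in> \<Gamma> (Suc k)"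
  unfolding lc_Suc by (rule generate.incl) blast

lemma lc_Suc_subset: "\<Gamma> (Suc k) \<subseteq> \<Gamma> k"
proof (cases "0 < k")
  case True
  have "comm a b \<in> \<Gamma> k" if "a \<in> carrier G" "b \<in> \<Gamma> k" for a b
    using that normal_lower_central[of k]
    by (simp add: gcomm_def normal.inv_op_closed2)
  then show ?thesis unfolding lc_Suc[OF True]
    by (intro generate_subgroup_incl lc_subgroup) auto
qed (simp add: normal_imp_subgroup)

lemma lc_antimono: "j \<le> k \<Longrightarrow> \<Gamma> k \<subseteq> \<Gamma> j"
  by (rule lift_Suc_antimono_le) (rule lc_Suc_subset)

lemma lc_mono_mem: "a \<in> \<Gamma> k \<Longrightarrow> j \<le> k \<Longrightarrow> a \<in> \<Gamma> j"
  using lc_antimono by blast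

lemma cls_eq_iff:
  assumes "a \<in> carrier G" "b \<in> carrier G"
  shows "cls n a = cls n b \<longleftrightarrow> a \<otimes> inv b \<in> \<Gamma> n"
proof -
  have "a \<otimes> inv b \<in> \<Gamma> n \<longleftrightarrow> a \<in> cls n b"
    using subgroup.rcos_module[OF lc_subgroup is_group assms(2,1)] by simp
  also have "\<dots> \<longleftrightarrow> cls n a = cls n b"
    using repr_independence[of a "\<Gamma> n" b] rcos_self[of a "\<Gamma> n"] assms lc_subgroup by auto
  finally show ?thesis ..
qed

lemma cls_eq_iff': "a \<in> carrier G \<Longrightarrow> a \<in> \<Gamma> n \<longleftrightarrow> cls n a = cls n \<one>"
  by (simp add: cls_eq_iff)

lemma cls_eqE:
  assumes "cls n a = cls n b" "a \<in> carrier G" "b \<in> carrier G"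
  obtains t where "t \<in> \<Gamma> n" "a = t \<otimes> b"
  using assms by (intro that[of "a \<otimes> inv b"]) (auto simp: cls_eq_iff m_assoc)

lemma cls_mult_cong:
  assumes "cls n a = cls n a'" "cls n b = cls n b'"
    "a \<in> carrier G" "a' \<in> carrier G" "b \<in> carrier G" "b' \<in> carrier G"
  shows "cls n (a \<otimes> b) = cls n (a' \<otimes> b')"
  using assms by (simp flip: normal.rcos_sum[OF normal_lower_central[of n]])

lemma cls_inv_cong:
  assumes "cls n a = cls n a'" "a \<in> carrier G" "a' \<in> carrier G"
  shows "cls n (inv a) = cls n (inv a')"
  using assms by (simp flip: normal.rcos_inv[OF normal_lower_central[of n]])

lemma cls_pow_cong:
  assumes "cls n a = cls n a'" "a \<in> carrier G" "a' \<in> carrier G"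
  shows "cls n (a [^] (s :: nat)) = cls n (a' [^] s)"
proof (induction s)
  case (Suc s)
  then show ?case using assms cls_mult_cong[of n "a [^] s" "a' [^] s" a a'] by simp
qed simp

lemma cls_int_pow_cong:
  assumes "cls n a = cls n a'" "a \<in> carrier G" "a' \<in> carrier G"
  shows "cls n (a [^] (s :: int)) = cls n (a' [^] s)"
proof -
  have "cls n (a [^] t) = cls n (a' [^] t)" for t :: nat
    using assms by (rule cls_pow_cong)
  then have "cls n (inv (a [^] t)) = cls n (inv (a' [^] t))" for t :: nat
    using assms by (intro cls_inv_cong) auto
  then show ?thesis unfolding int_pow_def2 using cls_pow_cong[OF assms] by presburger
qed

lemma cls_mono: 
  assumes "cls n a = cls n b" "k \<le> n" "a \<in> carrier G" "b \<in> carrier G"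
  shows "cls k a = cls k b"
  using assms lc_mono_mem[of "a \<otimes> inv b" n k] by (simp add: cls_eq_iff)

lemma cls_absorb_left:
  assumes "t \<in> \<Gamma> n" "a \<in> carrier G"
  shows "cls n (t \<otimes> a) = cls n a"
  using assms lc_closed[OF assms(1)] by (simp add: cls_eq_iff m_assoc)

lemma cls_absorb_right: 
  assumes "t \<in> \<Gamma> n" "a \<in> carrier G" 
  shows "cls n (a \<otimes> t) = cls n a"
  using cls_mult_cong[of n a a t \<one>] assms cls_eq_iff'[of t n] lc_closed[of t n] by simp

lemma cls_cancel_right:
  assumes "a \<in> carrier G" "b \<in> carrier G" "c \<in> carrier G"
  shows "cls n (a \<otimes> c) = cls n (b \<otimes> c) \<longleftrightarrow> cls n a = cls n b"
  using assms by (simp add: cls_eq_iff inv_mult_group m_assoc)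

lemma cls_conj:
  assumes "comm a z \<in> \<Gamma> n" "a \<in> carrier G" "z \<in> carrier G"
  shows "cls n (a \<otimes> z \<otimes> inv a) = cls n z"
  using assms by (simp add: conj_eq_comm cls_absorb_left)

lemma cls_commute':
  assumes "comm a z \<in> \<Gamma> n" "a \<in> carrier G" "z \<in> carrier G"
  shows "cls n (a \<otimes> z) = cls n (z \<otimes> a)"
proof -
  have "a \<otimes> z = comm a z \<otimes> (z \<otimes> a)" using assms by (simp add: comm_mult_swap)
  then show ?thesis using assms by (simp add: cls_absorb_left)
qed

lemma cls_commute:
  assumes "0 < k" "a \<in> carrier G" "z \<in> \<Gamma> k"
  shows "cls (Suc k) (a \<otimes> z) = cls (Suc k) (z \<otimes> a)"
  using assms by (intro cls_commute' comm_lc_Suc lc_closed[of z k])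

lemma lc_Suc_induct [consumes 2, case_names comm one mult inv]:
  assumes "0 < k" "g \<in> \<Gamma> (Suc k)"
    and comm: "\<And>a b. a \<in> carrier G \<Longrightarrow> b \<in> \<Gamma> k \<Longrightarrow> P (comm a b)"
    and one: "P \<one>"
    and mult: "\<And>a b. a \<in> \<Gamma> (Suc k) \<Longrightarrow> b \<in> \<Gamma> (Suc k) \<Longrightarrow> P a \<Longrightarrow> P b \<Longrightarrow> P (a \<otimes> b)"
    and inv: "\<And>a. a \<in> \<Gamma> (Suc k) \<Longrightarrow> P a \<Longrightarrow> P (inv a)"
  shows "P g"
proof -
  let ?S = "{comm a b | a b. a \<in> carrier G \<and> b \<in> \<Gamma> k}"
  have S: "h \<in> \<Gamma> (Suc k)" "P h" if "h \<in> ?S" for h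
    using that comm comm_lc_Suc[OF assms(1)] by auto
  have "g \<in> generate G ?S" using assms(2) lc_Suc[OF assms(1)] by simp
  then have "g \<in> \<Gamma> (Suc k) \<and> P g"
    by (induction rule: generate.induct) (simp_all add: one mult inv S)
  then show ?thesis ..
qed

text \<open>In the manner of the three subgroups lemma: conjugating \<open>comm y z\<close> by
  \<open>x\<close> changes nothing modulo \<open>\<Gamma> (Suc (j + k))\<close>, while expanding the
  conjugates of both entries produces an extra factor \<open>comm (comm x y) z\<close>, which must
  therefore be trivial. The expansion uses the induction hypothesis for \<open>Suc k\<close> as
  well, so \<open>k\<close> is arbitrary.\<close>

lemma comm_lc:
  assumes "0 < j" "0 < k" "a \<in> \<Gamma> j" "b \<in> \<Gamma> k"
  shows "comm a b \<in> \<Gamma> (j + k)"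
  using assms
proof (induction j arbitrary: a b k)
  case (Suc j)
  show ?case
  proof (cases "0 < j")
    case False
    then show ?thesis using Suc.prems comm_lc_Suc[of k a b] by simp
  next
    case True
    have "\<forall>b \<in> \<Gamma> k. comm a b \<in> \<Gamma> (Suc j + k)"
      using True Suc.prems(3)
    proof (induction rule: lc_Suc_induct)
      case (comm x y)
      show ?case
      proof
        fix z assume z: "z \<in> \<Gamma> k"
        let ?n = "Suc (j + k)" and ?t = "comm x y" and ?y = "comm x y \<otimes> y"
        have c: "x \<in> carrier G" "y \<in> carrier G" "z \<in> carrier G"
          using comm z lc_closed by auto
        then have "?t \<in> carrier G" "?y \<in> carrier G" by auto
        note c = c this
        have xz: "comm x z \<in> \<Gamma> (Suc k)" using comm_lc_Suc c z Suc.prems by blast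
        have t: "?t \<in> \<Gamma> j" "?y \<in> \<Gamma> j"
          using comm_lc_Suc[of j x y] lc_Suc_subset True comm by auto
        have yz: "comm y z \<in> \<Gamma> (j + k)" using Suc.IH True Suc.prems(2) comm z by blast
        then have "comm x (comm y z) \<in> \<Gamma> ?n" using True c by (intro comm_lc_Suc) auto
        then have "cls ?n (comm y z) = cls ?n (x \<otimes> comm y z \<otimes> inv x)"
          using c by (simp add: cls_conj)
        also have "\<dots> = cls ?n (comm ?y (comm x z \<otimes> z))"
          using c by (simp add: conj_comm) (simp add: conj_eq_comm)
        also have "\<dots> = cls ?n (comm ?y (comm x z) \<otimes> (comm x z \<otimes> comm ?y z \<otimes> inv (comm x z)))"
          using c by (simp add: comm_mult_right)
        also have "\<dots> = cls ?n (comm x z \<otimes> comm ?y z \<otimes> inv (comm x z))"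
          using Suc.IH[OF True zero_less_Suc t(2) xz] c by (intro cls_absorb_left) auto
        also have "\<dots> = cls ?n (comm ?y z)"
        proof (intro cls_conj comm_lc_Suc)
          show "comm ?y z \<in> \<Gamma> (j + k)" using Suc.IH[OF True Suc.prems(2) t(2) z] .
        qed (use True c in auto)
        also have "\<dots> = cls ?n ((?t \<otimes> comm y z \<otimes> inv ?t) \<otimes> comm ?t z)"
          using c by (simp add: comm_mult_left)
        also have "\<dots> = cls ?n (comm y z \<otimes> comm ?t z)"
          using yz c True by (intro cls_mult_cong cls_conj comm_lc_Suc) auto
        also have "\<dots> = cls ?n (comm ?t z \<otimes> comm y z)"
          using cls_commute[of "j + k" "comm ?t z" "comm y z"] yz c True by simp
        finally have "cls ?n (\<one> \<otimes> comm y z) = cls ?n (comm ?t z \<otimes> comm y z)" using c by simp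
        then have "cls ?n (comm ?t z) = cls ?n \<one>"
          using cls_cancel_right[of "\<one>" "comm ?t z" "comm y z" ?n] c by simp
        then show "comm ?t z \<in> \<Gamma> (Suc j + k)" using c by (simp add: cls_eq_iff')
      qed
    next
      case one
      show ?case using lc_closed by auto
    next
      case (mult a b)
      show ?case
      proof
        fix z assume z: "z \<in> \<Gamma> k"
        have c: "a \<in> carrier G" "b \<in> carrier G" "z \<in> carrier G" using mult z lc_closed by auto
        have "a \<otimes> comm b z \<otimes> inv a \<in> \<Gamma> (Suc j + k)"
          using mult z c by (intro normal.inv_op_closed2 normal_lower_central) auto
        then show "comm (a \<otimes> b) z \<in> \<Gamma> (Suc j + k)"
          using mult z by (simp add: comm_mult_left[OF c])
      qed
    next
      case (inv a)
      show ?case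
      proof
        fix z assume z: "z \<in> \<Gamma> k"
        have c: "a \<in> carrier G" "z \<in> carrier G" using inv z lc_closed by auto
        then have "comm (inv a) z = inv a \<otimes> inv (comm a z) \<otimes> a"
          by (simp add: gcomm_def m_assoc inv_mult_group)
        moreover have "inv a \<otimes> inv (comm a z) \<otimes> a \<in> \<Gamma> (Suc j + k)"
          using inv z c by (intro normal.inv_op_closed1 normal_lower_central) auto
        ultimately show "comm (inv a) z \<in> \<Gamma> (Suc j + k)" by simp
      qed
    qed
    then show ?thesis using Suc.prems by blast
  qed
qed simp

section \<open>Bilinearity of the commutator on the graded pieces\<close>

context
  fixes j k n
  assumes jk: "0 < j" "0 < k" and n: "n = Suc (j + k)"
begin

text \<open>The exact identity \<open>comm_mult_left\<close> contains a conjugate of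
  \<open>comm a' b\<close>. Commutators with elements of \<open>\<Gamma> (j + k)\<close> lie in
  \<open>\<Gamma> n\<close>, so both the conjugation and the order of the factors disappear. Keeping
  \<open>n\<close> as a variable with an equation lets callers use forms such as
  \<open>Suc (Suc k)\<close>.\<close>

lemma comm_bilin_left:
  assumes "a \<in> \<Gamma> j" "a' \<in> \<Gamma> j" "b \<in> \<Gamma> k"
  shows "cls n (comm (a \<otimes> a') b) = cls n (comm a b \<otimes> comm a' b)"
proof -
  have c: "a \<in> carrier G" "a' \<in> carrier G" "b \<in> carrier G" using assms lc_closed by auto
  have z: "comm a' b \<in> \<Gamma> (j + k)" using comm_lc jk assms by blast
  have "cls n (comm (a \<otimes> a') b) = cls n ((a \<otimes> comm a' b \<otimes> inv a) \<otimes> comm a b)"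
    using c by (simp add: comm_mult_left)
  also have "\<dots> = cls n (comm a' b \<otimes> comm a b)"
    using z c jk unfolding n by (intro cls_mult_cong cls_conj comm_lc_Suc) auto
  also have "\<dots> = cls n (comm a b \<otimes> comm a' b)"
    using cls_commute[of "j + k" "comm a b" "comm a' b"] z c jk unfolding n by simp
  finally show ?thesis .
qed

lemma comm_bilin_right:
  assumes "a \<in> \<Gamma> j" "b \<in> \<Gamma> k" "b' \<in> \<Gamma> k"
  shows "cls n (comm a (b \<otimes> b')) = cls n (comm a b \<otimes> comm a b')"
proof -
  have c: "a \<in> carrier G" "b' \<in> carrier G" "b \<in> carrier G" using assms lc_closed by auto
  have z: "comm a b' \<in> \<Gamma> (j + k)" using comm_lc jk assms by blast
  have "cls n (comm a (b \<otimes> b')) = cls n (comm a b \<otimes> (b \<otimes> comm a b' \<otimes> inv b))"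
    using c by (simp add: comm_mult_right)
  also have "\<dots> = cls n (comm a b \<otimes> comm a b')"
    using z c jk unfolding n by (intro cls_mult_cong cls_conj comm_lc_Suc) auto
  finally show ?thesis .
qed

text \<open>An error \<open>t\<close> one step deeper contributes \<open>comm t b\<close>, which
  already lies in \<open>\<Gamma> n\<close>.\<close>

lemma comm_cong_left:
  assumes "a \<in> \<Gamma> j" "a' \<in> \<Gamma> j" "b \<in> \<Gamma> k" "cls (Suc j) a = cls (Suc j) a'"
  shows "cls n (comm a b) = cls n (comm a' b)"
proof -
  have c: "a \<in> carrier G" "a' \<in> carrier G" "b \<in> carrier G" using assms lc_closed by auto
  obtain t where t: "t \<in> \<Gamma> (Suc j)" "a = t \<otimes> a'" using cls_eqE[OF assms(4) c(1,2)] .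
  have "comm t b \<in> \<Gamma> n" using comm_lc[of "Suc j" k t b] jk t assms unfolding n by simp
  moreover have "t \<in> \<Gamma> j" using t lc_Suc_subset by blast
  ultimately show ?thesis
    using comm_bilin_left[of t a' b] assms(2,3) c t cls_absorb_left[of "comm t b" n] by simp
qed

lemma comm_cong_right:
  assumes "a \<in> \<Gamma> j" "b \<in> \<Gamma> k" "b' \<in> \<Gamma> k" "cls (Suc k) b = cls (Suc k) b'"
  shows "cls n (comm a b) = cls n (comm a b')"
proof -
  have c: "a \<in> carrier G" "b' \<in> carrier G" "b \<in> carrier G" using assms lc_closed by auto
  obtain t where t: "t \<in> \<Gamma> (Suc k)" "b = t \<otimes> b'" using cls_eqE[OF assms(4) c(3,2)] .
  have "comm a t \<in> \<Gamma> n" using comm_lc[of j "Suc k" a t] jk t assms unfolding n by simp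
  moreover have "t \<in> \<Gamma> k" using t lc_Suc_subset by blast
  ultimately show ?thesis
    using comm_bilin_right[of a t b'] assms(1,3) c t cls_absorb_left[of "comm a t" n] by simp
qed

lemma comm_inv_left:
  assumes "a \<in> \<Gamma> j" "b \<in> \<Gamma> k"
  shows "cls n (comm (inv a) b) = cls n (inv (comm a b))"
proof -
  have c: "a \<in> carrier G" "b \<in> carrier G" using assms lc_closed by auto
  have "cls n (comm a b \<otimes> comm (inv a) b) = cls n \<one>"
    using comm_bilin_left[of a "inv a" b] assms c by simp
  then have "cls n (inv (comm a b) \<otimes> (comm a b \<otimes> comm (inv a) b)) = cls n (inv (comm a b) \<otimes> \<one>)"
    using c by (intro cls_mult_cong) auto
  then show ?thesis using c by simp
qed

lemma comm_inv_right:
  assumes "a \<in> \<Gamma> j" "b \<in> \<Gamma> k"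
  shows "cls n (comm a (inv b)) = cls n (inv (comm a b))"
proof -
  have c: "a \<in> carrier G" "b \<in> carrier G" using assms lc_closed by auto
  have "cls n (comm a b \<otimes> comm a (inv b)) = cls n \<one>"
    using comm_bilin_right[of a b "inv b"] assms c by simp
  then have "cls n (inv (comm a b) \<otimes> (comm a b \<otimes> comm a (inv b))) = cls n (inv (comm a b) \<otimes> \<one>)"
    using c by (intro cls_mult_cong) auto
  then show ?thesis using c by simp
qed

lemma comm_pow_left:
  assumes "a \<in> \<Gamma> j" "b \<in> \<Gamma> k"
  shows "cls n (comm (a [^] (s :: nat)) b) = cls n (comm a b [^] s)"
proof (induction s)
  case (Suc s)
  have c: "a \<in> carrier G" "b \<in> carrier G" using assms lc_closed by auto
  have "cls n (comm (a [^] s \<otimes> a) b) = cls n (comm (a [^] s) b \<otimes> comm a b)"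
    using assms by (intro comm_bilin_left) auto
  also have "\<dots> = cls n (comm a b [^] s \<otimes> comm a b)"
    using Suc c by (intro cls_mult_cong) auto
  finally show ?case by simp
qed (use assms lc_closed in simp)

lemma comm_pow_right:
  assumes "a \<in> \<Gamma> j" "b \<in> \<Gamma> k"
  shows "cls n (comm a (b [^] (s :: nat))) = cls n (comm a b [^] s)"
proof (induction s)
  case (Suc s)
  have c: "a \<in> carrier G" "b \<in> carrier G" using assms lc_closed by auto
  have "cls n (comm a (b [^] s \<otimes> b)) = cls n (comm a (b [^] s) \<otimes> comm a b)"
    using assms by (intro comm_bilin_right) auto
  also have "\<dots> = cls n (comm a b [^] s \<otimes> comm a b)"
    using Suc c by (intro cls_mult_cong) auto
  finally show ?case by simp
qed (use assms lc_closed in simp)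

lemma comm_int_pow_right:
  assumes "a \<in> \<Gamma> j" "b \<in> \<Gamma> k"
  shows "cls n (comm a (b [^] (s :: int))) = cls n (comm a b [^] s)"
proof -
  have c: "a \<in> carrier G" "b \<in> carrier G" using assms lc_closed by auto
  have "cls n (comm a (inv (b [^] t))) = cls n (inv (comm a b [^] t))" for t :: nat
  proof -
    have "cls n (comm a (inv (b [^] t))) = cls n (inv (comm a (b [^] t)))"
      using assms by (intro comm_inv_right) auto
    also have "\<dots> = cls n (inv (comm a b [^] t))"
      using comm_pow_right[OF assms] c by (intro cls_inv_cong) auto
    finally show ?thesis .
  qed
  then show ?thesis using comm_pow_right[OF assms]
    by (cases "s < 0") (simp_all only: int_pow_def2 if_True if_False)
qed

end

text \<open>Conjugation by \<open>x\<close> is an automorphism; expanding \<open>x [a, b] x\<^sup>-\<^sup>1\<close> with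
  \<open>x a x\<^sup>-\<^sup>1 = [x, a] a\<close> gives the Jacobi identity.\<close>

lemma comm_jacobi:
  assumes jk: "0 < j" "0 < k" and x: "x \<in> carrier G" and ab: "a \<in> \<Gamma> j" "b \<in> \<Gamma> k"
  shows "cls (j + k + 2) (comm x (comm a b)) =
    cls (j + k + 2) (comm (comm x a) b \<otimes> comm a (comm x b))"
proof -
  let ?n = "j + k + 2" and ?a = "comm x a" and ?b = "comm x b" and ?z = "comm a b"
  have a: "?a \<in> \<Gamma> (Suc j)" and b: "?b \<in> \<Gamma> (Suc k)" using assms comm_lc_Suc by auto
  have c: "a \<in> carrier G" "b \<in> carrier G" "?a \<in> carrier G" "?b \<in> carrier G"
    using ab x lc_closed by auto
  have z: "?z \<in> \<Gamma> (j + k)" using comm_lc jk ab by blast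
  have bb: "?b \<otimes> b \<in> \<Gamma> k" using b ab lc_Suc_subset by blast
  have abb: "comm a (?b \<otimes> b) \<in> \<Gamma> (j + k)" using comm_lc jk ab bb by blast
  have ab': "comm ?a b \<in> \<Gamma> (Suc (j + k))" using comm_lc[of "Suc j" k ?a b] jk a ab by simp
  have ab'': "comm ?a ?b \<in> \<Gamma> ?n" using comm_lc[of "Suc j" "Suc k" ?a ?b] a b by simp
  have 1: "cls ?n (?a \<otimes> comm a (?b \<otimes> b) \<otimes> inv ?a) = cls ?n (comm a ?b \<otimes> ?z)"
  proof -
    have "comm ?a (comm a (?b \<otimes> b)) \<in> \<Gamma> ?n"
      using lc_mono_mem[OF comm_lc[of "Suc j" "j + k", OF _ _ a abb]] jk by simp
    then have "cls ?n (?a \<otimes> comm a (?b \<otimes> b) \<otimes> inv ?a) = cls ?n (comm a (?b \<otimes> b))"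
      using c by (intro cls_conj) auto
    also have "\<dots> = cls ?n (comm a ?b \<otimes> (?b \<otimes> ?z \<otimes> inv ?b))"
      using c by (simp add: comm_mult_right)
    also have "\<dots> = cls ?n (comm a ?b \<otimes> ?z)"
      using lc_mono_mem[OF comm_lc[of "Suc k" "j + k", OF _ _ b z], of ?n] jk c
      by (intro cls_mult_cong cls_conj) auto
    finally show ?thesis .
  qed
  have 2: "cls ?n (comm ?a (?b \<otimes> b)) = cls ?n (comm ?a b)"
  proof -
    have "cls ?n (comm ?a (?b \<otimes> b)) = cls ?n (comm ?a ?b \<otimes> (?b \<otimes> comm ?a b \<otimes> inv ?b))"
      using c by (simp add: comm_mult_right)
    also have "\<dots> = cls ?n (?b \<otimes> comm ?a b \<otimes> inv ?b)"
      using ab'' c by (intro cls_absorb_left) auto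
    also have "\<dots> = cls ?n (comm ?a b)"
      using comm_lc_Suc[OF _ c(4) ab'] c by (intro cls_conj) auto
    finally show ?thesis .
  qed
  have "comm x ?z \<otimes> ?z = comm (?a \<otimes> a) (?b \<otimes> b)"
    using x c by (simp add: conj_comm flip: conj_eq_comm)
  then have 3: "comm x ?z \<otimes> ?z = (?a \<otimes> comm a (?b \<otimes> b) \<otimes> inv ?a) \<otimes> comm ?a (?b \<otimes> b)"
    using c by (simp add: comm_mult_left)
  have "cls ?n (comm x ?z \<otimes> ?z) = cls ?n ((comm a ?b \<otimes> ?z) \<otimes> comm ?a b)"
    using c x unfolding 3 by (intro cls_mult_cong[OF 1 2]) auto
  also have "\<dots> = cls ?n (comm ?a b \<otimes> (comm a ?b \<otimes> ?z))"
    using comm_lc_Suc[of "Suc (j + k)" "comm a ?b \<otimes> ?z" "comm ?a b"] ab' c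
    by (intro cls_commute') auto
  also have "\<dots> = cls ?n ((comm ?a b \<otimes> comm a ?b) \<otimes> ?z)"
    using c by (simp add: m_assoc)
  finally show ?thesis
    using c x by (subst (asm) cls_cancel_right) auto
qed

end

section \<open>Magnus representations\<close>

definition letter :: "nat \<Rightarrow> ncseries"
  where "letter i = Series (\<lambda>w. if w = [i] then 1 else 0)"

lemma coef_letter [simp]: "coef (letter i) w = (if w = [i] then 1 else 0)"
  by (simp add: letter_def)

definition words_of_length :: "nat \<Rightarrow> nat \<Rightarrow> nat list set"
  where "words_of_length m k = {w. length w = k \<and> set w \<subseteq> {..<m}}"

lemma words_of_length_Cons [simp]:
  "i # w \<in> words_of_length m (Suc k) \<longleftrightarrow> i < m \<and> w \<in> words_of_length m k"
  by (auto simp: words_of_length_def)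

lemma words_of_length_snoc [simp]:
  "w @ [i] \<in> words_of_length m (Suc k) \<longleftrightarrow> i < m \<and> w \<in> words_of_length m k"
  by (auto simp: words_of_length_def)

lemma words_of_length_0 [simp]: "w \<in> words_of_length m 0 \<longleftrightarrow> w = []"
  by (auto simp: words_of_length_def)

text \<open>The interface to the free group: generators, and a multiplicative map sending them to
  \<open>1 + letter i\<close>. Freeness enters only through the existence of
  \<open>M\<close>.\<close>

locale magnus_rep = group G for G :: "('a, 'b) monoid_scheme" (structure) +
  fixes m :: nat and x :: "nat \<Rightarrow> 'a" and M :: "'a \<Rightarrow> ncseries"
  assumes x_closed [simp]: "i < m \<Longrightarrow> x i \<in> carrier G"
    and x_gen: "generate G (x ` {..<m}) = carrier G"
    and M_one [simp]: "M \<one> = 1"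
    and M_mult: "a \<in> carrier G \<Longrightarrow> b \<in> carrier G \<Longrightarrow> M (a \<otimes> b) = M a * M b"
    and M_x: "i < m \<Longrightarrow> M (x i) = 1 + letter i"
begin

abbreviation "W \<equiv> words_of_length m"

fun ad :: "nat list \<Rightarrow> 'a \<Rightarrow> 'a"
  where "ad [] z = z" | "ad (i # w) z = comm (x i) (ad w z)"

text \<open>The right-normed commutator of the generators named by a word; \<open>ad w z\<close> has
  \<open>z\<close> in the innermost place instead. The value at \<open>[]\<close> is a
  dummy.\<close>

fun y :: "nat list \<Rightarrow> 'a"
  where "y [] = \<one>" | "y [i] = x i" | "y (i # j # w) = comm (x i) (y (j # w))"

lemma y_Cons: "w \<noteq> [] \<Longrightarrow> y (i # w) = comm (x i) (y w)"
  by (cases w) auto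

lemma ad_snoc: "ad (w @ [i]) z = ad w (comm (x i) z)"
  by (induction w) auto

lemma y_snoc: "y (w @ [i]) = ad w (x i)"
  by (induction w) (auto simp: y_Cons)

lemma gen_induct [consumes 1, case_names one x inv mult]:
  assumes "g \<in> carrier G" and "P \<one>"
    and "\<And>i. i < m \<Longrightarrow> P (x i)" "\<And>i. i < m \<Longrightarrow> P (inv (x i))"
    and mult: "\<And>a b. a \<in> carrier G \<Longrightarrow> b \<in> carrier G \<Longrightarrow> P a \<Longrightarrow> P b \<Longrightarrow> P (a \<otimes> b)"
  shows "P g"
proof -
  have "g \<in> generate G (x ` {..<m})" using assms(1) x_gen by simp
  then have "g \<in> carrier G \<and> P g"
    by (induction rule: generate.induct) (use assms in auto)
  then show ?thesis ..
qed

lemma lc_one: "\<Gamma> 1 = carrier G"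
  by simp

text \<open>Right-normed commutators of length \<open>k\<close> generate \<open>\<Gamma> k\<close>
  modulo \<open>\<Gamma> (Suc k)\<close>, by bilinearity of the commutator in both entries. Stated
  as an induction rule, this never mentions the quotient.\<close>

lemma lc_word_induct [consumes 2, case_names word lc mult inv]:
  assumes "0 < k" "g \<in> \<Gamma> k"
    and "\<And>w. w \<in> W k \<Longrightarrow> P (y w)"
    and "\<And>t. t \<in> \<Gamma> (Suc k) \<Longrightarrow> P t"
    and "\<And>a b. a \<in> \<Gamma> k \<Longrightarrow> b \<in> \<Gamma> k \<Longrightarrow> P a \<Longrightarrow> P b \<Longrightarrow> P (a \<otimes> b)"
    and "\<And>a. a \<in> \<Gamma> k \<Longrightarrow> P a \<Longrightarrow> P (inv a)"
  shows "P g"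
  using assms
proof (induction k arbitrary: g P rule: nat_induct_non_zero)
  case 1
  have "g \<in> carrier G" using 1 by simp
  then show ?case
  proof (induction rule: gen_induct)
    case one
    then show ?case by (intro 1(3)) simp
  next
    case (x i)
    then show ?case using 1(2)[of "[i]"] by (simp add: words_of_length_def)
  next
    case (inv i)
    then show ?case using 1(2)[of "[i]"] 1(5)[of "x i"] by (simp add: words_of_length_def)
  next
    case (mult a b)
    then show ?case by (intro 1(4)) auto
  qed
next
  case (Suc k)
  note word = Suc.prems(2) and lc = Suc.prems(3) and mult = Suc.prems(4) and inv = Suc.prems(5)
  have one: "P \<one>" by (intro lc) simp
  \<comment> \<open>Congruent elements differ by a factor in the next term, so the cases
    \<open>lc\<close> and \<open>mult\<close> make \<open>P\<close> invariant under
    congruence.\<close>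
  have P_cong: "P a" if "cls (Suc (Suc k)) a = cls (Suc (Suc k)) b" "a \<in> \<Gamma> (Suc k)" "b \<in> \<Gamma> (Suc k)" "P b" for a b
  proof -
    note * = that
    obtain t where t: "t \<in> \<Gamma> (Suc (Suc k))" "a = t \<otimes> b"
      using cls_eqE[OF *(1) lc_closed[OF *(2)] lc_closed[OF *(3)]] .
    then show "P a" using * mult[of t b] lc lc_Suc_subset by auto
  qed
  have comm_mem: "comm a b \<in> \<Gamma> (Suc k)" if "a \<in> carrier G" "b \<in> \<Gamma> k" for a b
    using that comm_lc_Suc Suc.hyps by blast
  \<comment> \<open>The induction hypothesis covers every predicate, so it applies to the pullback
    of \<open>P\<close> along the commutator with \<open>x i\<close>.\<close>
  have gen: "P (comm (x i) b)" if "i < m" "b \<in> \<Gamma> k" for i b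
  proof (rule Suc.IH[where P = "\<lambda>b. P (comm (x i) b)", OF that(2)])
    fix w assume "w \<in> W k"
    then show "P (comm (x i) (y w))"
      using word[of "i # w"] that(1) Suc.hyps y_Cons[of w i]
      by (cases w) (auto simp: words_of_length_def)
  next
    fix t assume "t \<in> \<Gamma> (Suc k)"
    then show "P (comm (x i) t)"
      using comm_lc_Suc[of "Suc k" "x i" t] that(1) by (intro lc) auto
  next
    fix a b assume prem: "a \<in> \<Gamma> k" "b \<in> \<Gamma> k" "P (comm (x i) a)" "P (comm (x i) b)"
    show "P (comm (x i) (a \<otimes> b))"
      by (rule P_cong[OF _ _ _ mult[of "comm (x i) a" "comm (x i) b"]])
        (use prem comm_bilin_right[of 1 k "Suc (Suc k)" "x i" a b] that(1) Suc.hyps comm_mem in auto)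
  next
    fix a assume prem: "a \<in> \<Gamma> k" "P (comm (x i) a)"
    show "P (comm (x i) (inv a))"
      by (rule P_cong[OF _ _ _ inv[of "comm (x i) a"]])
        (use prem comm_inv_right[of 1 k "Suc (Suc k)" "x i" a] that(1) Suc.hyps comm_mem in auto)
  qed
  have c: "\<forall>b \<in> \<Gamma> k. P (comm a b)" if "a \<in> carrier G" for a
    using that
  proof (induction rule: gen_induct)
    case one
    then show ?case using lc_closed \<open>P \<one>\<close> by simp
  next
    case (x i)
    then show ?case using gen by blast
  next
    case (inv i)
    show ?case
    proof
      fix b assume b: "b \<in> \<Gamma> k"
      show "P (comm (inv (x i)) b)"
        by (rule P_cong[OF _ _ _ Suc.prems(5)[of "comm (x i) b"]])
          (use comm_inv_left[of 1 k "Suc (Suc k)" "x i" b] b inv Suc.hyps comm_mem gen[of i b] in auto)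
    qed
  next
    case (mult a a')
    show ?case
    proof
      fix b assume b: "b \<in> \<Gamma> k"
      show "P (comm (a \<otimes> a') b)"
        by (rule P_cong[OF _ _ _ Suc.prems(4)[of "comm a b" "comm a' b"]])
          (use comm_bilin_left[of 1 k "Suc (Suc k)" a a' b] b mult Suc.hyps comm_mem in auto)
    qed
  qed
  show ?case using \<open>0 < k\<close> Suc.prems(1)
    by (induction rule: lc_Suc_induct) (use c one Suc.prems(4,5) in auto)
qed

section \<open>Leading coefficients of Magnus series\<close>

lemma M_inv:
  assumes "g \<in> carrier G"
  shows "M g * M (inv g) = 1" "M (inv g) * M g = 1"
  using assms by (simp_all flip: M_mult)

lemma M_Nil [simp]: "g \<in> carrier G \<Longrightarrow> coef (M g) [] = 1"
proof (induction rule: gen_induct)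
  case (inv i)
  then have "coef (M (inv (x i)) * M (x i)) [] = 1" by (simp add: M_inv)
  then show ?case using inv by (simp add: M_x)
qed (simp_all add: M_x M_mult)

definition low :: "nat \<Rightarrow> 'a \<Rightarrow> bool"
  where "low k g \<longleftrightarrow> vanish k (M g - 1)"

lemma low_iff:
  "g \<in> carrier G \<Longrightarrow> low k g \<longleftrightarrow> (\<forall>w. 0 < length w \<and> length w < k \<longrightarrow> coef (M g) w = 0)"
  unfolding low_def vanish_def by (metis M_Nil coef_simps(2,5) diff_0_right diff_self length_greater_0_conv)

lemma low_1 [simp]: "g \<in> carrier G \<Longrightarrow> low (Suc 0) g"
  by (simp add: low_iff)

lemma low_one [simp]: "low k \<one>"
  by (simp add: low_def vanish_def)

lemma M_mult_minus_one:
  assumes "g \<in> carrier G" "h \<in> carrier G"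
  shows "M (g \<otimes> h) - 1 = (M g - 1) + (M h - 1) + (M g - 1) * (M h - 1)"
  using assms by (simp add: M_mult algebra_simps)

lemma low_mult:
  assumes "g \<in> carrier G" "h \<in> carrier G" "low k g" "low k h"
  shows "low k (g \<otimes> h)"
proof -
  have "vanish (k + k) ((M g - 1) * (M h - 1))" using assms vanish_mult unfolding low_def by blast
  then have "vanish k ((M g - 1) * (M h - 1))" by (rule vanish_mono) simp
  then show ?thesis
    using assms unfolding low_def by (simp add: M_mult_minus_one vanish_add)
qed

text \<open>The cross term \<open>(M g - 1) * (M h - 1)\<close> starts in degree
  \<open>k + k\<close>, beyond \<open>k\<close>. A degree \<open>k\<close> coefficient is thus a
  homomorphism to the integers on the elements satisfying \<open>low k\<close>.\<close>

lemma lead_mult: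
  assumes "g \<in> carrier G" "h \<in> carrier G" "low k g" "low k h" "length w = k" "0 < k"
  shows "coef (M (g \<otimes> h)) w = coef (M g) w + coef (M h) w"
proof -
  have "vanish (k + k) ((M g - 1) * (M h - 1))" using assms vanish_mult unfolding low_def by blast
  then have "coef ((M g - 1) * (M h - 1)) w = 0" using assms by (simp add: vanish_def)
  moreover have "coef (M (g \<otimes> h) - 1) w = coef ((M g - 1) + (M h - 1) + (M g - 1) * (M h - 1)) w"
    using assms by (simp add: M_mult_minus_one)
  moreover have "w \<noteq> []" using assms by auto
  ultimately show ?thesis by simp
qed

lemma low_inv:
  assumes "g \<in> carrier G" "low k g"
  shows "low k (inv g)"
proof -
  have "M (inv g) - 1 = - (M (inv g) * (M g - 1))" using assms by (simp add: algebra_simps M_inv)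
  moreover have "vanish (0 + k) (M (inv g) * (M g - 1))"
    using assms unfolding low_def by (intro vanish_mult) auto
  ultimately show ?thesis unfolding low_def vanish_def by simp
qed

lemma lead_inv:
  assumes "g \<in> carrier G" "low k g" "length w = k" "0 < k"
  shows "coef (M (inv g)) w = - coef (M g) w"
  using lead_mult[of g "inv g" k w] assms low_inv by auto

lemma low_pow: "g \<in> carrier G \<Longrightarrow> low k g \<Longrightarrow> low k (g [^] (n :: nat))"
  by (induction n) (auto simp: low_mult)

lemma lead_pow:
  assumes "g \<in> carrier G" "low k g" "length w = k" "0 < k"
  shows "coef (M (g [^] (n :: nat))) w = int n * coef (M g) w"
proof (induction n)
  case (Suc n)
  then show ?case
    using assms lead_mult[of "g [^] n" g k w] by (simp add: low_pow algebra_simps)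
qed (use assms in auto)

lemma low_int_pow: "g \<in> carrier G \<Longrightarrow> low k g \<Longrightarrow> low k (g [^] (n :: int))"
  unfolding int_pow_def2 by (cases "n < 0") (simp_all only: if_True if_False low_pow low_inv nat_pow_closed)

lemma lead_int_pow:
  assumes "g \<in> carrier G" "low k g" "length w = k" "0 < k"
  shows "coef (M (g [^] (n :: int))) w = n * coef (M g) w"
proof (cases n rule: int_cases2)
  case (nonneg t)
  then show ?thesis using lead_pow[OF assms, of t] by (simp add: int_pow_int)
next
  case (nonpos t)
  have "coef (M (inv (g [^] t))) w = - (int t * coef (M g) w)"
    using lead_inv[OF nat_pow_closed[OF assms(1)] low_pow[OF assms(1,2)] assms(3,4), of t]
      lead_pow[OF assms, of t] by simp
  moreover have "g [^] n = inv (g [^] t)"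
    using nonpos assms(1) by (simp add: int_pow_neg int_pow_int)
  ultimately show ?thesis using nonpos by simp
qed

text \<open>Multiplying \<open>M (comm g h) - 1\<close> by \<open>M (h \<otimes> g)\<close> gives
  \<open>r\<close>, the ring commutator of \<open>M g - 1\<close> and \<open>M h - 1\<close>.
  Undoing this multiplication costs a factor \<open>q\<close> with constant coefficient 1, which
  does not affect the lowest degree: there one sees the Lie bracket of the degree 1 part of
  \<open>g\<close> with the degree \<open>k\<close> part of \<open>h\<close>.\<close>

lemma
  assumes g: "g \<in> carrier G" and h: "h \<in> carrier G" and low: "low k h" and k: "0 < k"
  shows low_comm: "low (Suc k) (comm g h)"
    and lead_comm: "\<And>w. length w = Suc k \<Longrightarrow> coef (M (comm g h)) w =
      coef (M g) [hd w] * coef (M h) (tl w) - coef (M h) (butlast w) * coef (M g) [last w]"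
proof -
  define r where "r = (M g - 1) * (M h - 1) - (M h - 1) * (M g - 1)"
  define q where "q = M (inv (h \<otimes> g))"
  have v: "vanish 1 (M g - 1)" using g by (simp add: vanish_def)
  have v': "vanish k (M h - 1)" using low by (simp add: low_def)
  have r: "vanish (Suc k) r"
    unfolding r_def using vanish_mult[OF v v'] vanish_mult[OF v' v] by (simp add: vanish_diff)
  have "M (comm g h) * M (h \<otimes> g) = M g * M h"
    using M_mult[of "comm g h" "h \<otimes> g"] M_mult[of g h] g h by (simp add: comm_mult_swap)
  then have "(M (comm g h) - 1) * M (h \<otimes> g) = r"
    using g h by (simp add: r_def M_mult algebra_simps)
  then have "(M (comm g h) - 1) * (M (h \<otimes> g) * q) = r * q" by (simp flip: mult.assoc)
  then have eq: "M (comm g h) - 1 = r * q" using g h by (simp add: q_def M_inv)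
  show "low (Suc k) (comm g h)"
    unfolding low_def eq using vanish_mult[OF r vanish_0, of q] by simp
  fix w :: "nat list" assume w: "length w = Suc k"
  have "coef (M (comm g h)) w = coef (M (comm g h) - 1) w" using w by auto
  also have "\<dots> = coef r w"
    unfolding eq using coef_mult_vanish[OF r vanish_0, of w q] w g h by (simp add: q_def)
  also have "\<dots> = coef (M g - 1) (take 1 w) * coef (M h - 1) (drop 1 w)
      - coef (M h - 1) (take k w) * coef (M g - 1) (drop k w)"
    unfolding r_def using coef_mult_vanish[OF v v', of w] coef_mult_vanish[OF v' v, of w] w by simp
  also have "\<dots> = coef (M g) [hd w] * coef (M h) (tl w) - coef (M h) (butlast w) * coef (M g) [last w]"
  proof -
    obtain u i where u: "w = u @ [i]" "length u = k" using w by (cases w rule: rev_cases) auto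
    obtain v j where v: "w = j # v" "length v = k" using w by (cases w) auto
    have "take 1 w = [hd w]" "drop 1 w = tl w" "tl w \<noteq> []" using v k by auto
    moreover have "take k w = butlast w" "drop k w = [last w]" "butlast w \<noteq> []" using u k by auto
    ultimately show ?thesis by simp
  qed
  finally show "coef (M (comm g h)) w =
      coef (M g) [hd w] * coef (M h) (tl w) - coef (M h) (butlast w) * coef (M g) [last w]" .
qed

lemma lc_low: "0 < k \<Longrightarrow> g \<in> \<Gamma> k \<Longrightarrow> low k g"
proof (induction k arbitrary: g rule: nat_induct_non_zero)
  case (Suc k)
  from \<open>0 < k\<close> Suc.prems show ?case
    by (induction rule: lc_Suc_induct)
      (use Suc.IH Suc.hyps lc_closed in \<open>auto intro!: low_comm low_mult low_inv\<close>)
qed simp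

text \<open>The two elements differ by a factor in \<open>\<Gamma> (Suc k)\<close>, whose degree
  \<open>k\<close> part vanishes by \<open>lc_low\<close>; so the degree \<open>k\<close> part is a
  function on the graded piece.\<close>

lemma lead_cong:
  assumes "0 < k" "a \<in> \<Gamma> k" "b \<in> \<Gamma> k" "cls (Suc k) a = cls (Suc k) b" "length w = k"
  shows "coef (M a) w = coef (M b) w"
proof -
  have c: "a \<in> carrier G" "b \<in> carrier G" using assms lc_closed by auto
  obtain t where t: "t \<in> \<Gamma> (Suc k)" "a = t \<otimes> b" using cls_eqE[OF assms(4) c] .
  have tl: "low (Suc k) t" "t \<in> \<Gamma> k" "t \<in> carrier G"
    using t lc_low lc_Suc_subset lc_closed[OF t(1)] by auto
  then have "coef (M t) w = 0" using assms by (auto simp: low_iff)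
  then show ?thesis using lead_mult[of t b k w] tl c assms lc_low t by simp
qed

end

section \<open>The Dynkin--Specht--Wever identity\<close>

text \<open>Elements of the free associative ring as formal sums. They are kept as lists so that
  such a sum can also be evaluated in a noncommutative group, as an ordered product;
  \<open>cf\<close> recovers the coefficient of a word.\<close>

type_synonym signed_words = "(int \<times> nat list) list"

definition cf :: "signed_words \<Rightarrow> nat list \<Rightarrow> int"
  where "cf ls v = (\<Sum>(s, w)\<leftarrow>ls. if w = v then s else 0)"

lemma cf_simps [simp]:
  "cf [] v = 0" "cf ((s, w) # ls) v = (if w = v then s else 0) + cf ls v"
  "cf (ls @ ls') v = cf ls v + cf ls' v"
  by (simp_all add: cf_def)

definition scale :: "int \<Rightarrow> signed_words \<Rightarrow> signed_words"
  where "scale e ls = map (\<lambda>(s, w). (e * s, w)) ls"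

definition map_words :: "(nat list \<Rightarrow> nat list) \<Rightarrow> signed_words \<Rightarrow> signed_words"
  where "map_words h ls = map (\<lambda>(s, w). (s, h w)) ls"

lemma scale_simps [simp]: "scale e [] = []" "scale e ((s, w) # ls) = (e * s, w) # scale e ls"
  by (simp_all add: scale_def)

lemma map_words_simps [simp]:
  "map_words h [] = []" "map_words h ((s, w) # ls) = (s, h w) # map_words h ls"
  by (simp_all add: map_words_def)

lemma snd_scale [simp]: "snd ` set (scale e ls) = snd ` set ls"
  by (force simp: scale_def)

lemma snd_map_words [simp]: "snd ` set (map_words h ls) = h ` snd ` set ls"
  by (force simp: map_words_def)

lemma cf_scale [simp]: "cf (scale e ls) v = e * cf ls v"
  by (induction ls) (auto simp: algebra_simps)

lemma cf_map_Cons: "v \<noteq> [] \<Longrightarrow> cf (map_words ((#) i) ls) v = (if hd v = i then cf ls (tl v) else 0)"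
  by (induction ls) (auto simp: neq_Nil_conv)

lemma cf_map_snoc:
  "v \<noteq> [] \<Longrightarrow> cf (map_words (\<lambda>w. w @ [i]) ls) v = (if last v = i then cf ls (butlast v) else 0)"
  by (induction ls) (auto simp: snoc_eq_iff_butlast)

text \<open>The expansion of the right-normed Lie bracket of the word \<open>w\<close> in the free
  associative ring.\<close>

fun bracket :: "nat list \<Rightarrow> signed_words"
  where
    "bracket [] = []"
  | "bracket [i] = [(1, [i])]"
  | "bracket (i # j # w) = map_words ((#) i) (bracket (j # w)) @
      scale (- 1) (map_words (\<lambda>u. u @ [i]) (bracket (j # w)))"

lemma bracket_Cons:
  "w \<noteq> [] \<Longrightarrow> bracket (i # w) = map_words ((#) i) (bracket w) @
      scale (- 1) (map_words (\<lambda>u. u @ [i]) (bracket w))"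
  by (cases w) auto

lemma bracket_words: "w \<in> words_of_length m k \<Longrightarrow> snd ` set (bracket w) \<subseteq> words_of_length m k"
proof (induction w arbitrary: k rule: bracket.induct)
  case (3 i j w)
  then obtain k' where k: "k = Suc k'" by (auto simp: words_of_length_def)
  with 3 have "snd ` set (bracket (j # w)) \<subseteq> words_of_length m k'" "i < m" by auto
  then show ?case unfolding k by (auto simp: image_Un)
qed auto

section \<open>Evaluating integer combinations of words in the group\<close>

context group
begin

primrec lp :: "(nat list \<Rightarrow> 'a) \<Rightarrow> signed_words \<Rightarrow> 'a"
  where
    "lp f [] = \<one>"
  | "lp f (p # ls) = f (snd p) [^] fst p \<otimes> lp f ls"

lemma cls_pow_mult:
  assumes "0 < k" "a \<in> carrier G" "b \<in> \<Gamma> k"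
  shows "cls (Suc k) ((a \<otimes> b) [^] (n :: nat)) = cls (Suc k) (a [^] n \<otimes> b [^] n)"
proof (induction n)
  case (Suc n)
  have b: "b \<in> carrier G" using assms lc_closed by auto
  note c = b assms(2)
  have "cls (Suc k) ((a \<otimes> b) [^] n \<otimes> (a \<otimes> b)) = cls (Suc k) (a [^] n \<otimes> b [^] n \<otimes> (a \<otimes> b))"
    by (rule cls_mult_cong) (use Suc c in auto)
  also have "\<dots> = cls (Suc k) (a [^] n \<otimes> ((b [^] n \<otimes> a) \<otimes> b))" using c by (simp add: m_assoc)
  also have "\<dots> = cls (Suc k) (a [^] n \<otimes> ((a \<otimes> b [^] n) \<otimes> b))"
  proof (rule cls_mult_cong[OF HOL.refl], rule cls_mult_cong[OF _ HOL.refl])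
    show "cls (Suc k) (b [^] n \<otimes> a) = cls (Suc k) (a \<otimes> b [^] n)"
      using cls_commute[OF assms(1,2) lc_nat_pow[OF assms(3)]] by simp
  qed (use c in auto)
  also have "\<dots> = cls (Suc k) (a [^] Suc n \<otimes> b [^] Suc n)" using c by (simp add: m_assoc)
  finally show ?case by simp
qed (use assms in simp)

lemma cls_int_pow_mult:
  assumes "0 < k" "a \<in> carrier G" "b \<in> \<Gamma> k"
  shows "cls (Suc k) ((a \<otimes> b) [^] (s :: int)) = cls (Suc k) (a [^] s \<otimes> b [^] s)"
proof (cases s rule: int_cases2)
  case (nonneg n)
  then show ?thesis using cls_pow_mult[OF assms] by (simp add: int_pow_int)
next
  case (nonpos n)
  have b: "b \<in> carrier G" using assms lc_closed by auto
  note c = b assms(2)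
  have "cls (Suc k) (inv ((a \<otimes> b) [^] n)) = cls (Suc k) (inv (a [^] n \<otimes> b [^] n))"
    by (rule cls_inv_cong[OF cls_pow_mult[OF assms]]) (use c in auto)
  also have "\<dots> = cls (Suc k) (inv (b [^] n) \<otimes> inv (a [^] n))"
    using c by (simp add: inv_mult_group)
  also have "\<dots> = cls (Suc k) (inv (a [^] n) \<otimes> inv (b [^] n))"
    using cls_commute[of k "inv (a [^] n)" "inv (b [^] n)"] assms by simp
  finally show ?thesis using c nonpos by (simp add: int_pow_neg int_pow_int)
qed

lemma lp_append:
  "(\<And>w. w \<in> snd ` set (ls @ ls') \<Longrightarrow> f w \<in> carrier G) \<Longrightarrow> lp f (ls @ ls') = lp f ls \<otimes> lp f ls'"
  "(\<And>w. w \<in> snd ` set ls \<Longrightarrow> f w \<in> carrier G) \<Longrightarrow> lp f ls \<in> carrier G"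
proof -
  show closed: "lp f ls \<in> carrier G" if "\<And>w. w \<in> snd ` set ls \<Longrightarrow> f w \<in> carrier G" for ls
    using that by (induction ls) auto
  show "lp f (ls @ ls') = lp f ls \<otimes> lp f ls'"
    if "\<And>w. w \<in> snd ` set (ls @ ls') \<Longrightarrow> f w \<in> carrier G"
    using that
  proof (induction ls)
    case (Cons p ls)
    have "lp f ls \<in> carrier G" "lp f ls' \<in> carrier G" "f (snd p) \<in> carrier G"
      using Cons.prems closed by auto
    then show ?case using Cons by (auto simp: m_assoc)
  qed (use closed[of ls'] in auto)
qed

lemma lp_lc: "(\<And>w. w \<in> snd ` set ls \<Longrightarrow> f w \<in> \<Gamma> k) \<Longrightarrow> lp f ls \<in> \<Gamma> k"
  by (induction ls) auto

lemma lp_scale_lc: "(\<And>w. w \<in> snd ` set ls \<Longrightarrow> f w \<in> \<Gamma> k) \<Longrightarrow> lp f (scale e ls) \<in> \<Gamma> k"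
  by (rule lp_lc) (simp only: snd_scale)

lemma lp_comm_lc:
  assumes "0 < k" "a \<in> carrier G" "\<And>w. w \<in> snd ` set ls \<Longrightarrow> f w \<in> \<Gamma> k"
  shows "lp (\<lambda>w. comm a (f w)) ls \<in> \<Gamma> (Suc k)"
  by (rule lp_lc, rule comm_lc_Suc) (use assms in auto)

lemma lp_map_words: "lp f (map_words h ls) = lp (\<lambda>w. f (h w)) ls"
  by (induction ls) auto

lemma lp_cong: "(\<And>w. w \<in> snd ` set ls \<Longrightarrow> f w = g w) \<Longrightarrow> lp f ls = lp g ls"
  by (induction ls) auto

lemma lp_scale:
  assumes "0 < k" "\<And>w. w \<in> snd ` set ls \<Longrightarrow> f w \<in> \<Gamma> k"
  shows "cls (Suc k) (lp f (scale e ls)) = cls (Suc k) (lp f ls [^] e)"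
  using assms(2)
proof (induction ls)
  case (Cons p ls)
  obtain s w where p: "p = (s, w)" by force
  have w: "f w \<in> \<Gamma> k" "lp f ls \<in> \<Gamma> k" "lp f (scale e ls) \<in> \<Gamma> k"
    using Cons.prems p by (auto intro!: lp_lc lp_scale_lc)
  then have c: "f w \<in> carrier G" "lp f ls \<in> carrier G" "lp f (scale e ls) \<in> carrier G"
    using lc_closed by blast+
  have "lp f (scale e (p # ls)) = f w [^] (e * s) \<otimes> lp f (scale e ls)" by (simp add: p)
  also have "f w [^] (e * s) = (f w [^] s) [^] e"
    using c by (simp add: int_pow_pow mult.commute)
  finally have 1: "lp f (scale e (p # ls)) = (f w [^] s) [^] e \<otimes> lp f (scale e ls)" .
  have "cls (Suc k) (lp f (scale e (p # ls))) = cls (Suc k) ((f w [^] s) [^] e \<otimes> lp f ls [^] e)"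
    unfolding 1 by (rule cls_mult_cong) (use Cons c in auto)
  also have "\<dots> = cls (Suc k) ((f w [^] s \<otimes> lp f ls) [^] e)"
    using cls_int_pow_mult[of k "f w [^] s" "lp f ls" e] w c assms(1) by simp
  finally show ?case by (simp add: p)
qed simp

lemma lp_comm:
  assumes "0 < k" "a \<in> carrier G" "\<And>w. w \<in> snd ` set ls \<Longrightarrow> f w \<in> \<Gamma> k"
  shows "cls (Suc (Suc k)) (lp (\<lambda>w. comm a (f w)) ls) = cls (Suc (Suc k)) (comm a (lp f ls))"
  using assms(3)
proof (induction ls)
  case (Cons p ls)
  obtain s w where p: "p = (s, w)" by force
  have w: "f w \<in> \<Gamma> k" "lp f ls \<in> \<Gamma> k" using Cons.prems p by (auto intro!: lp_lc)
  then have c: "f w \<in> carrier G" "lp f ls \<in> carrier G" using lc_closed by blast+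
  have cl: "lp (\<lambda>w. comm a (f w)) ls \<in> carrier G"
    using lp_comm_lc[of k a ls f] Cons.prems lc_closed assms(1,2) by auto
  have "cls (Suc (Suc k)) (comm a (f w) [^] s \<otimes> lp (\<lambda>w. comm a (f w)) ls)
      = cls (Suc (Suc k)) (comm a (f w [^] s) \<otimes> comm a (lp f ls))"
    by (rule cls_mult_cong)
      (use comm_int_pow_right[of 1 k "Suc (Suc k)" a "f w" s] w Cons c cl assms(1,2) in auto)
  also have "\<dots> = cls (Suc (Suc k)) (comm a (f w [^] s \<otimes> lp f ls))"
    using comm_bilin_right[of 1 k "Suc (Suc k)" a "f w [^] s" "lp f ls"] w assms(1,2) by auto
  finally show ?case by (simp add: p)
qed (use assms in simp)

lemma lp_map_update:
  assumes "0 < k" "distinct vs" "w \<in> set vs" "\<And>v. v \<in> set vs \<Longrightarrow> f v \<in> \<Gamma> k"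
  shows "cls (Suc k) (lp f (map (\<lambda>v. ((if w = v then s else 0) + c v, v)) vs)) =
    cls (Suc k) (f w [^] s \<otimes> lp f (map (\<lambda>v. (c v, v)) vs))"
  using assms(2-4)
proof (induction vs)
  case (Cons u vs)
  let ?l = "\<lambda>c. lp f (map (\<lambda>v. (c v, v)) vs)"
  have L: "?l c \<in> \<Gamma> k" for c using Cons.prems by (intro lp_lc) auto
  then have Lc: "?l c \<in> carrier G" for c using lc_closed by blast
  have u: "f u \<in> \<Gamma> k" "f w \<in> \<Gamma> k" using Cons.prems by auto
  then have c: "f u \<in> carrier G" "f w \<in> carrier G" using lc_closed by blast+
  show ?case
  proof (cases "w = u")
    case True
    have "map (\<lambda>v. ((if u = v then s else 0) + c v, v)) vs = map (\<lambda>v. (c v, v)) vs"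
      using Cons.prems by auto
    then show ?thesis using True c Lc by (simp add: int_pow_mult m_assoc del: map_eq_conv)
  next
    case False
    let ?c = "\<lambda>v. (if w = v then s else 0) + c v"
    have "cls (Suc k) (f u [^] c u \<otimes> ?l ?c) = cls (Suc k) (f u [^] c u \<otimes> (f w [^] s \<otimes> ?l c))"
      by (rule cls_mult_cong) (use Cons False c Lc in auto)
    also have "\<dots> = cls (Suc k) ((f u [^] c u \<otimes> f w [^] s) \<otimes> ?l c)" using c Lc by (simp add: m_assoc)
    also have "\<dots> = cls (Suc k) ((f w [^] s \<otimes> f u [^] c u) \<otimes> ?l c)"
      by (rule cls_mult_cong) (use cls_commute[OF assms(1), of "f u [^] c u" "f w [^] s"] c u Lc in auto)
    also have "\<dots> = cls (Suc k) (f w [^] s \<otimes> (f u [^] c u \<otimes> ?l c))" using c Lc by (simp add: m_assoc)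
    finally show ?thesis using False by simp
  qed
qed simp

text \<open>Elements of \<open>\<Gamma> k\<close> commute modulo \<open>\<Gamma> (Suc k)\<close>, so
  powers belonging to equal words can be collected. Hence the class of the product depends on the
  coefficients only, and evaluation becomes a linear map on polynomials.\<close>

lemma lp_cf:
  assumes "0 < k" "distinct vs" "\<And>v. v \<in> set vs \<Longrightarrow> f v \<in> \<Gamma> k" "snd ` set ls \<subseteq> set vs"
  shows "cls (Suc k) (lp f ls) = cls (Suc k) (lp f (map (\<lambda>v. (cf ls v, v)) vs))"
  using assms(4)
proof (induction ls)
  case Nil
  have "lp f (map (\<lambda>v. (0, v)) vs) = \<one>" using assms(3) by (induction vs) (auto simp: lc_closed)
  then show ?case by simp
next
  case (Cons p ls)
  obtain s w where p: "p = (s, w)" by force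
  have "snd ` set (map (\<lambda>v. (cf ls v, v)) vs) = set vs" by force
  then have L: "lp f ls \<in> \<Gamma> k" "lp f (map (\<lambda>v. (cf ls v, v)) vs) \<in> \<Gamma> k" "f w \<in> \<Gamma> k"
    using Cons.prems assms(3) p by (auto intro!: lp_lc)
  then have c: "lp f ls \<in> carrier G" "lp f (map (\<lambda>v. (cf ls v, v)) vs) \<in> carrier G" "f w \<in> carrier G"
    using lc_closed by blast+
  have "cls (Suc k) (f w [^] s \<otimes> lp f ls) = cls (Suc k) (f w [^] s \<otimes> lp f (map (\<lambda>v. (cf ls v, v)) vs))"
    by (rule cls_mult_cong) (use Cons c in auto)
  also have "\<dots> = cls (Suc k) (lp f (map (\<lambda>v. (cf (p # ls) v, v)) vs))"
    using lp_map_update[OF assms(1,2), of w f s "cf ls"] Cons.prems p assms(3) by simp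
  finally show ?case by (simp add: p)
qed

end

context magnus_rep
begin

lemma ad_lc: "0 < l \<Longrightarrow> w \<in> W k \<Longrightarrow> z \<in> \<Gamma> l \<Longrightarrow> ad w z \<in> \<Gamma> (k + l)"
proof (induction w arbitrary: k)
  case (Cons i w)
  then obtain k' where k: "k = Suc k'" by (auto simp: words_of_length_def)
  then show ?case using Cons comm_lc_Suc[of "k' + l" "x i" "ad w z"] by auto
qed (auto simp: words_of_length_def)

lemma y_lc: "0 < k \<Longrightarrow> w \<in> W k \<Longrightarrow> y w \<in> \<Gamma> k"
proof (cases w rule: rev_cases)
  case (snoc v i)
  assume "0 < k" "w \<in> W k"
  with snoc obtain k' where k: "k = Suc k'" by (cases k) auto
  then show ?thesis using ad_lc[of 1 v k' "x i"] snoc \<open>w \<in> W k\<close> by (simp add: y_snoc)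
qed (auto simp: words_of_length_def)

text \<open>In the associated graded Lie ring, the element of the free associative ring given by
  \<open>bracket w\<close> acts by the adjoint action of \<open>y w\<close>.\<close>

lemma lp_ad_bracket:
  "0 < k \<Longrightarrow> 0 < l \<Longrightarrow> w \<in> W k \<Longrightarrow> z \<in> \<Gamma> l \<Longrightarrow>
    cls (Suc (k + l)) (lp (\<lambda>u. ad u z) (bracket w)) = cls (Suc (k + l)) (comm (y w) z)"
proof (induction w arbitrary: k l z)
  case (Cons i w)
  have z: "z \<in> carrier G" using Cons.prems lc_closed by blast
  show ?case
  proof (cases "w = []")
    case True
    then show ?thesis using Cons.prems z by (cases k) auto
  next
    case False
    obtain k' where k: "k = Suc k'" using Cons.prems by (cases k) auto
    have k': "0 < k'" "w \<in> W k'" "i < m" using Cons.prems False k by (cases k'; auto)+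
    let ?B = "bracket w" and ?n = "Suc (k + l)" and ?z = "comm (x i) z"
    have B: "snd ` set ?B \<subseteq> W k'" using bracket_words k' by blast
    have xz: "?z \<in> \<Gamma> (Suc l)" using comm_lc_Suc k' Cons.prems by auto
    have yw: "y w \<in> \<Gamma> k'" using y_lc k' by blast
    have a: "ad u z \<in> \<Gamma> (k' + l)" "ad u ?z \<in> \<Gamma> (k' + Suc l)" if "u \<in> snd ` set ?B" for u
      using that B ad_lc[OF Cons.prems(2) _ Cons.prems(4)] ad_lc[OF zero_less_Suc _ xz] by blast+
    have L: "lp (\<lambda>u. ad u z) ?B \<in> \<Gamma> (k' + l)" "lp (\<lambda>u. ad u ?z) ?B \<in> \<Gamma> (k' + Suc l)"
      "lp (\<lambda>u. ad u ?z) (scale (-1) ?B) \<in> \<Gamma> (k' + Suc l)"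
      using a by (blast intro: lp_lc lp_scale_lc)+
    have c: "y w \<in> carrier G" "?z \<in> carrier G" "lp (\<lambda>u. ad u z) ?B \<in> carrier G"
      "lp (\<lambda>u. ad u ?z) ?B \<in> carrier G" "lp (\<lambda>u. ad u ?z) (scale (-1) ?B) \<in> carrier G"
      "lp (\<lambda>u. comm (x i) (ad u z)) ?B \<in> carrier G"
      using yw xz L lc_closed lp_comm_lc[of "k' + l" "x i" ?B "\<lambda>u. ad u z"] a k' by auto
    have "cls ?n (lp (\<lambda>u. comm (x i) (ad u z)) ?B) = cls ?n (comm (x i) (lp (\<lambda>u. ad u z) ?B))"
      using lp_comm[of "k' + l" "x i" ?B "\<lambda>u. ad u z"] a k' k by simp
    also have "\<dots> = cls ?n (comm (x i) (comm (y w) z))"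
    proof (rule comm_cong_right[of 1 "k' + l"])
      show "comm (y w) z \<in> \<Gamma> (k' + l)" using comm_lc yw Cons.prems k' by blast
      show "cls (Suc (k' + l)) (lp (\<lambda>u. ad u z) (bracket w)) = cls (Suc (k' + l)) (comm (y w) z)"
        using Cons.IH[of k' l z] k' Cons.prems by simp
    qed (use L k' k in auto)
    \<comment> \<open>The Jacobi identity leaves a surplus \<open>comm (y w) ?z\<close>; the words
      of the bracket that end in \<open>i\<close> supply its inverse, in fact
      \<open>2\<close>.\<close>
    also have "\<dots> = cls ?n (comm (comm (x i) (y w)) z \<otimes> comm (y w) ?z)"
      using comm_jacobi[of k' l "x i" "y w" z] k' k yw Cons.prems by simp
    finally have 1: "cls ?n (lp (\<lambda>u. comm (x i) (ad u z)) ?B)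
        = cls ?n (comm (comm (x i) (y w)) z \<otimes> comm (y w) ?z)" .
    have "cls ?n (lp (\<lambda>u. ad u ?z) (scale (-1) ?B)) = cls ?n (lp (\<lambda>u. ad u ?z) ?B [^] (- 1 :: int))"
      using lp_scale[of "k' + Suc l" ?B "\<lambda>u. ad u ?z" "-1"] a k by simp
    also have "\<dots> = cls ?n (comm (y w) ?z [^] (- 1 :: int))"
      using Cons.IH[of k' "Suc l" ?z] k' xz k c by (intro cls_int_pow_cong) auto
    finally have 2: "cls ?n (lp (\<lambda>u. ad u ?z) (scale (-1) ?B)) = cls ?n (inv (comm (y w) ?z))"
      using c by (simp add: int_pow_neg)
    have ac: "ad u z \<in> carrier G" "ad u ?z \<in> carrier G" if "(s, u) \<in> set ?B" for s u
      using a[of u] that lc_closed by force+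
    have 3: "lp (\<lambda>u. ad u z) (bracket (i # w))
        = lp (\<lambda>u. comm (x i) (ad u z)) ?B \<otimes> lp (\<lambda>u. ad u ?z) (scale (-1) ?B)"
    proof -
      have sm: "scale (- 1) (map_words (\<lambda>u. u @ [i]) ?B) = map_words (\<lambda>u. u @ [i]) (scale (- 1) ?B)"
        by (simp add: scale_def map_words_def comp_def case_prod_beta)
      show ?thesis
        unfolding bracket_Cons[OF False] sm using ac k'
        by (subst lp_append(1)) (auto simp: lp_map_words ad_snoc image_Un image_image)
    qed
    have "cls ?n (lp (\<lambda>u. ad u z) (bracket (i # w)))
        = cls ?n (comm (comm (x i) (y w)) z \<otimes> comm (y w) ?z \<otimes> inv (comm (y w) ?z))"
      unfolding 3 by (rule cls_mult_cong[OF 1 2]) (use c k' z in auto)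
    also have "\<dots> = cls ?n (comm (y (i # w)) z)"
      using c k' z False by (simp add: m_assoc y_Cons)
    finally show ?thesis .
  qed
qed (auto simp: words_of_length_def)

text \<open>The factor \<open>k\<close> accumulates along the recursion of
  \<open>bracket (i # w)\<close>. Words starting with \<open>i\<close> evaluate to the commutator of
  \<open>x i\<close> with the value for \<open>w\<close>, which by induction is \<open>k - 1\<close>
  copies of \<open>y (i # w)\<close>. Words ending in \<open>i\<close> give, with a minus sign, the
  adjoint action on \<open>x i\<close>, that is the inverse of \<open>comm (y w) (x i)\<close>: one
  more copy.\<close>

lemma lp_y_bracket:
  "0 < k \<Longrightarrow> w \<in> W k \<Longrightarrow> cls (Suc k) (lp y (bracket w)) = cls (Suc k) (y w [^] k)"
proof (induction w arbitrary: k)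
  case (Cons i w)
  show ?case
  proof (cases "w = []")
    case True
    then have "k = 1" using Cons.prems by (auto simp: words_of_length_def)
    then show ?thesis using Cons.prems True by simp
  next
    case False
    obtain k' where k: "k = Suc k'" using Cons.prems by (cases k) auto
    have k': "0 < k'" "w \<in> W k'" "i < m" using Cons.prems False k by (cases k'; auto)+
    let ?B = "bracket w" and ?n = "Suc k"
    have B: "snd ` set ?B \<subseteq> W k'" using bracket_words k' by blast
    have yw: "y w \<in> \<Gamma> k'" "y (i # w) \<in> \<Gamma> k" using y_lc k' Cons.prems by blast+
    have ne: "u \<noteq> []" if "u \<in> snd ` set ?B" for u using that B k' by (auto simp: words_of_length_def)
    have a: "y u \<in> \<Gamma> k'" "ad u (x i) \<in> \<Gamma> (Suc k')" if "u \<in> snd ` set ?B" for u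
      using that B y_lc[OF k'(1)] ad_lc[of 1 u k' "x i"] k' by auto
    have L: "lp y ?B \<in> \<Gamma> k'" "lp (\<lambda>u. ad u (x i)) ?B \<in> \<Gamma> (Suc k')"
      "lp (\<lambda>u. ad u (x i)) (scale (-1) ?B) \<in> \<Gamma> (Suc k')"
      using a by (blast intro: lp_lc lp_scale_lc)+
    have c: "y w \<in> carrier G" "y (i # w) \<in> carrier G" "lp y ?B \<in> carrier G"
      "lp (\<lambda>u. ad u (x i)) ?B \<in> carrier G" "lp (\<lambda>u. ad u (x i)) (scale (-1) ?B) \<in> carrier G"
      "lp (\<lambda>u. comm (x i) (y u)) ?B \<in> carrier G"
      using yw L lc_closed lp_comm_lc[of k' "x i" ?B y] a k' by auto
    have "cls ?n (lp (\<lambda>u. comm (x i) (y u)) ?B) = cls ?n (comm (x i) (lp y ?B))"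
      using lp_comm[of k' "x i" ?B y] a k' k by simp
    also have "\<dots> = cls ?n (comm (x i) (y w [^] k'))"
      by (rule comm_cong_right[of 1 k']) (use Cons.IH[of k'] L yw k' k in auto)
    also have "\<dots> = cls ?n (comm (x i) (y w) [^] k')"
      by (rule comm_pow_right[of 1 k']) (use yw k' k in auto)
    finally have 1: "cls ?n (lp (\<lambda>u. comm (x i) (y u)) ?B) = cls ?n (y (i # w) [^] k')"
      using False by (simp add: y_Cons)
    have "cls ?n (lp (\<lambda>u. ad u (x i)) (scale (-1) ?B)) = cls ?n (lp (\<lambda>u. ad u (x i)) ?B [^] (- 1 :: int))"
      using lp_scale[of "Suc k'" ?B "\<lambda>u. ad u (x i)" "-1"] a k by simp
    also have "\<dots> = cls ?n (comm (y w) (x i) [^] (- 1 :: int))"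
      using lp_ad_bracket[of k' 1 w "x i"] k' k c by (intro cls_int_pow_cong) auto
    finally have 2: "cls ?n (lp (\<lambda>u. ad u (x i)) (scale (-1) ?B)) = cls ?n (y (i # w))"
      using c k' False by (simp add: int_pow_neg inv_comm y_Cons)
    have ac: "y (i # u) \<in> carrier G" "ad u (x i) \<in> carrier G" if "(s, u) \<in> set ?B" for s u
      using a[of u] ne[of u] that lc_closed k' y_Cons[of u i] by force+
    have 3: "lp y (bracket (i # w))
        = lp (\<lambda>u. comm (x i) (y u)) ?B \<otimes> lp (\<lambda>u. ad u (x i)) (scale (-1) ?B)"
    proof -
      have sm: "scale (- 1) (map_words (\<lambda>u. u @ [i]) ?B) = map_words (\<lambda>u. u @ [i]) (scale (- 1) ?B)"
        by (simp add: scale_def map_words_def comp_def case_prod_beta)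
      have "lp (\<lambda>u. y (i # u)) ?B = lp (\<lambda>u. comm (x i) (y u)) ?B"
        using ne by (intro lp_cong y_Cons)
      moreover have "y u \<in> carrier G" if "u \<in> snd ` set (map_words ((#) i) ?B @ map_words (\<lambda>u. u @ [i]) (scale (- 1) ?B))" for u
        using that ac by (auto simp: image_Un image_image y_snoc)
      ultimately show ?thesis
        unfolding bracket_Cons[OF False] sm
        by (subst lp_append(1)) (auto simp: lp_map_words y_snoc)
    qed
    have "cls ?n (lp y (bracket (i # w))) = cls ?n (y (i # w) [^] k' \<otimes> y (i # w))"
      unfolding 3 by (rule cls_mult_cong[OF 1 2]) (use c in auto)
    then show ?thesis by (simp add: k)
  qed
qed (auto simp: words_of_length_def)

end

section \<open>Torsion of the Magnus kernel\<close>

text \<open>Reads \<open>ls\<close> as a combination of Lie monomials and rewrites it as a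
  noncommutative polynomial, which is what \<open>M\<close> sees in the leading degree.\<close>

definition expand :: "signed_words \<Rightarrow> signed_words"
  where "expand ls = concat (map (\<lambda>(s, w). scale s (bracket w)) ls)"

lemma expand_simps [simp]:
  "expand [] = []" "expand ((s, w) # ls) = scale s (bracket w) @ expand ls"
  by (simp_all add: expand_def)

lemma expand_words:
  "snd ` set ls \<subseteq> words_of_length m k \<Longrightarrow> snd ` set (expand ls) \<subseteq> words_of_length m k"
proof (induction ls)
  case (Cons p ls)
  obtain s w where p: "p = (s, w)" by force
  then show ?case using Cons bracket_words[of w m k] by (simp add: image_Un)
qed simp

lemma cf_map_distinct:
  "distinct vs \<Longrightarrow> cf (map (\<lambda>v. (p v, v)) vs) u = (if u \<in> set vs then p u else 0)"
  by (induction vs) auto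

definition word_list :: "nat \<Rightarrow> nat \<Rightarrow> nat list list"
  where "word_list m k = List.n_lists k [0..<m]"

lemma set_word_list [simp]: "set (word_list m k) = words_of_length m k"
  by (auto simp: word_list_def set_n_lists words_of_length_def)

lemma distinct_word_list [simp]: "distinct (word_list m k)"
  by (simp add: word_list_def distinct_n_lists)

lemma finite_words_of_length [simp]: "finite (words_of_length m k)"
  by (metis set_word_list finite_set)

context magnus_rep
begin

lemma y_closed: "0 < k \<Longrightarrow> w \<in> W k \<Longrightarrow> y w \<in> carrier G"
  using y_lc lc_closed by blast

lemma lp_y_lc: "0 < k \<Longrightarrow> snd ` set ls \<subseteq> W k \<Longrightarrow> lp y ls \<in> \<Gamma> k"
  using y_lc by (intro lp_lc) auto

text \<open>All naturals are letters of \<open>ncseries\<close>, while \<open>W k\<close> holds only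
  words in the first \<open>m\<close> letters; this reconciles the two. For an inverse, coefficients
  are compared in \<open>M (inv (x i)) * M (x i) = 1\<close>, by induction on the length.\<close>

lemma M_support: "g \<in> carrier G \<Longrightarrow> \<not> set w \<subseteq> {..<m} \<Longrightarrow> coef (M g) w = 0"
proof (induction arbitrary: w rule: gen_induct)
  case (inv i)
  from inv(2) show ?case
  proof (induction w rule: length_induct)
    case (1 w)
    have "0 = coef (M (inv (x i)) * M (x i)) w"
      using 1(2) inv(1) by (auto simp: M_inv)
    also have "\<dots> = (\<Sum>j\<le>length w. if j = length w then coef (M (inv (x i))) w else 0)"
      unfolding coef_mult
    proof (rule sum.cong[OF HOL.refl])
      fix j assume j: "j \<in> {..length w}"
      show "coef (M (inv (x i))) (take j w) * coef (M (x i)) (drop j w)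
          = (if j = length w then coef (M (inv (x i))) w else 0)"
      proof (cases "j = length w")
        case False
        have "set w = set (take j w) \<union> set (drop j w)" by (metis append_take_drop_id set_append)
        then consider "\<not> set (take j w) \<subseteq> {..<m}" | "\<not> set (drop j w) \<subseteq> {..<m}" using 1(2) by auto
        then show ?thesis
        proof cases
          case 1
          then have "coef (M (inv (x i))) (take j w) = 0" using \<open>\<forall>_. _\<close> j False by auto
          then show ?thesis using False by simp
        next
          case 2
          then have "coef (M (x i)) (drop j w) = 0" using inv(1) by (auto simp: M_x)
          then show ?thesis using False by simp
        qed
      qed (use inv(1) in simp)
    qed
    also have "\<dots> = coef (M (inv (x i))) w" by simp
    finally show ?case by simp
  qed
next
  case (mult a b)
  show ?case
    unfolding M_mult[OF mult(1,2)] coef_mult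
  proof (intro sum.neutral ballI)
    fix j
    have "set w = set (take j w) \<union> set (drop j w)" by (metis append_take_drop_id set_append)
    then have "\<not> set (take j w) \<subseteq> {..<m} \<or> \<not> set (drop j w) \<subseteq> {..<m}" using mult.prems by auto
    then show "coef (M a) (take j w) * coef (M b) (drop j w) = 0" using mult.IH by auto
  qed
qed (auto simp: M_x)

lemma low_iff_words:
  assumes "g \<in> carrier G"
  shows "low k g \<longleftrightarrow> (\<forall>j v. 0 < j \<and> j < k \<and> v \<in> W j \<longrightarrow> coef (M g) v = 0)"
  using M_support[OF assms] unfolding low_iff[OF assms] words_of_length_def by blast

lemma lead_y:
  "0 < k \<Longrightarrow> w \<in> W k \<Longrightarrow> length v = k \<Longrightarrow> coef (M (y w)) v = cf (bracket w) v"
proof (induction w arbitrary: k v)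
  case (Cons i w)
  show ?case
  proof (cases "w = []")
    case True
    then show ?thesis using Cons.prems by (cases k) (auto simp: M_x)
  next
    case False
    obtain k' where k: "k = Suc k'" using Cons.prems by (cases k) auto
    have k': "0 < k'" "w \<in> W k'" "i < m" using Cons.prems False k by (cases k'; auto)+
    have v: "v \<noteq> []" "length (tl v) = k'" "length (butlast v) = k'" using Cons.prems k by auto
    have "coef (M (y (i # w))) v
        = coef (M (x i)) [hd v] * coef (M (y w)) (tl v) - coef (M (y w)) (butlast v) * coef (M (x i)) [last v]"
      unfolding y_Cons[OF False]
      using y_lc[OF k'(1,2)] k' k Cons.prems by (intro lead_comm[of _ _ k'] lc_low) (auto simp: lc_closed)
    also have "\<dots> = cf (bracket (i # w)) v"
      using Cons.IH[OF k'(1,2)] v k' by (simp add: bracket_Cons[OF False] M_x cf_map_Cons cf_map_snoc)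
    finally show ?thesis .
  qed
qed (auto simp: words_of_length_def)

lemma lead_lp_y:
  assumes "0 < k" "snd ` set ls \<subseteq> W k" "length v = k"
  shows "coef (M (lp y ls)) v = cf (expand ls) v"
  using assms(2)
proof (induction ls)
  case (Cons p ls)
  obtain s w where p: "p = (s, w)" by force
  have w: "w \<in> W k" "snd ` set ls \<subseteq> W k" using Cons.prems p by auto
  have mem: "y w \<in> \<Gamma> k" "lp y ls \<in> \<Gamma> k" using w y_lc lp_y_lc assms(1) by auto
  then have c: "y w \<in> carrier G" "lp y ls \<in> carrier G" using lc_closed by blast+
  have "coef (M (y w [^] s \<otimes> lp y ls)) v = coef (M (y w [^] s)) v + coef (M (lp y ls)) v"
    using mem c assms by (intro lead_mult[of _ _ k] low_int_pow lc_low) auto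
  also have "coef (M (y w [^] s)) v = s * coef (M (y w)) v"
    using mem c assms by (intro lead_int_pow[of _ k] lc_low) auto
  finally show ?case using Cons.IH w lead_y[of k w v] assms by (simp add: p)
qed (use assms in auto)

lemma lc_rep:
  assumes "0 < k" "g \<in> \<Gamma> k"
  shows "\<exists>ls. snd ` set ls \<subseteq> W k \<and> cls (Suc k) g = cls (Suc k) (lp y ls)"
  using assms
proof (induction rule: lc_word_induct)
  case (word w)
  then show ?case using y_closed[OF assms(1)] by (intro exI[of _ "[(1, w)]"]) auto
next
  case (lc t)
  then show ?case using lc_closed by (intro exI[of _ "[]"]) (auto simp flip: cls_eq_iff')
next
  case (mult a b)
  then obtain la lb where l: "snd ` set la \<subseteq> W k" "cls (Suc k) a = cls (Suc k) (lp y la)"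
    "snd ` set lb \<subseteq> W k" "cls (Suc k) b = cls (Suc k) (lp y lb)" by blast
  have c: "lp y la \<in> carrier G" "lp y lb \<in> carrier G" "a \<in> carrier G" "b \<in> carrier G"
    using lc_closed[OF lp_y_lc[OF assms(1) l(1)]] lc_closed[OF lp_y_lc[OF assms(1) l(3)]]
      lc_closed[OF mult(1)] lc_closed[OF mult(2)] .
  have ab: "lp y (la @ lb) = lp y la \<otimes> lp y lb"
    using l y_closed[OF assms(1)] by (intro lp_append(1)) auto
  have "cls (Suc k) (a \<otimes> b) = cls (Suc k) (lp y (la @ lb))"
    unfolding ab by (rule cls_mult_cong[OF l(2,4)]) (use c in auto)
  moreover have "snd ` set (la @ lb) \<subseteq> W k" using l by (simp add: image_Un)
  ultimately show ?case by blast
next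
  case (inv a)
  then obtain la where l: "snd ` set la \<subseteq> W k" "cls (Suc k) a = cls (Suc k) (lp y la)" by blast
  have c: "lp y la \<in> carrier G" "a \<in> carrier G"
    using lc_closed[OF lp_y_lc[OF assms(1) l(1)]] lc_closed[OF inv(1)] .
  have "cls (Suc k) (lp y (scale (-1) la)) = cls (Suc k) (lp y la [^] (-1 :: int))"
    using l y_lc[OF assms(1)] by (intro lp_scale assms(1)) auto
  also have "\<dots> = cls (Suc k) (inv (lp y la))" using c by (simp add: int_pow_neg)
  also have "\<dots> = cls (Suc k) (inv a)" using cls_inv_cong[OF l(2)] c by simp
  finally have "cls (Suc k) (inv a) = cls (Suc k) (lp y (scale (-1) la))" ..
  moreover have "snd ` set (scale (-1) la) \<subseteq> W k" using l by simp
  ultimately show ?case by blast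
qed

lemma lp_y_expand:
  assumes "0 < k" "snd ` set ls \<subseteq> W k"
  shows "cls (Suc k) (lp y (expand ls)) = cls (Suc k) (lp y ls [^] k)"
  using assms(2)
proof (induction ls)
  case (Cons p ls)
  obtain s w where p: "p = (s, w)" by force
  have w: "w \<in> W k" "snd ` set ls \<subseteq> W k" using Cons.prems p by auto
  have wb: "snd ` set (bracket w) \<subseteq> W k" "snd ` set (scale s (bracket w)) \<subseteq> W k" 
    "snd ` set (expand ls) \<subseteq> W k" using w bracket_words expand_words by simp_all
  have mem: "y w \<in> \<Gamma> k" "lp y ls \<in> \<Gamma> k" "lp y (bracket w) \<in> \<Gamma> k"
      "lp y (scale s (bracket w)) \<in> \<Gamma> k" "lp y (expand ls) \<in> \<Gamma> k" 
    using w y_lc lp_y_lc assms(1) wb by blast+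
  then have c: "y w \<in> carrier G" "lp y ls \<in> carrier G" "lp y (bracket w) \<in> carrier G"
      "lp y (scale s (bracket w)) \<in> carrier G" "lp y (expand ls) \<in> carrier G"
    using lc_closed by blast+
  have 1: "cls (Suc k) (lp y (scale s (bracket w))) = cls (Suc k) ((y w [^] s) [^] k)"
  proof -
    have "cls (Suc k) (lp y (scale s (bracket w))) = cls (Suc k) (lp y (bracket w) [^] s)"
      using wb y_lc[OF assms(1)] by (intro lp_scale assms(1)) auto
    also have "\<dots> = cls (Suc k) ((y w [^] k) [^] s)"
      using lp_y_bracket[OF assms(1) w(1)] c by (intro cls_int_pow_cong) auto
    moreover have "(y w [^] k) [^] s = (y w [^] s) [^] k"
      using c int_pow_pow[of "y w" "int k" s] int_pow_pow[of "y w" s "int k"]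
      by (simp add: int_pow_int mult.commute)
    ultimately show ?thesis by simp
  qed
  have 2: "lp y (expand (p # ls)) = lp y (scale s (bracket w)) \<otimes> lp y (expand ls)"
    unfolding p expand_simps
  proof (rule lp_append(1))
    fix v assume "v \<in> snd ` set (scale s (bracket w) @ expand ls)"
    then have "v \<in> W k" using wb by (auto simp: image_Un)
    then show "y v \<in> carrier G" using y_closed[OF assms(1)] by blast
  qed
  have "cls (Suc k) (lp y (expand (p # ls))) = cls (Suc k) ((y w [^] s) [^] k \<otimes> lp y ls [^] k)"
    unfolding 2 by (rule cls_mult_cong[OF 1]) (use Cons.IH w c in auto)
  also have "\<dots> = cls (Suc k) ((y w [^] s \<otimes> lp y ls) [^] k)"
    using cls_pow_mult[of k "y w [^] s" "lp y ls" k] mem c assms(1) by simp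
  finally show ?case by (simp add: p)
qed simp

lemma lp_y_cf_cong:
  assumes "0 < k" "snd ` set ls \<subseteq> W k" "snd ` set ls' \<subseteq> W k" "\<And>v. v \<in> W k \<Longrightarrow> cf ls v = cf ls' v"
  shows "cls (Suc k) (lp y ls) = cls (Suc k) (lp y ls')"
proof -
  have eq: "map (\<lambda>v. (cf ls v, v)) (word_list m k) = map (\<lambda>v. (cf ls' v, v)) (word_list m k)"
    using assms(4) by simp
  have "cls (Suc k) (lp y l) = cls (Suc k) (lp y (map (\<lambda>v. (cf l v, v)) (word_list m k)))"
    if "snd ` set l \<subseteq> W k" for l
    using that y_lc[OF assms(1)] by (intro lp_cf assms(1)) auto
  from this[OF assms(2)] this[OF assms(3), symmetric] show ?thesis
    unfolding eq by (rule HOL.trans)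
qed

text \<open>Modulo \<open>\<Gamma> (Suc k)\<close>, \<open>g\<close> is a product of powers of
  right-normed commutators, with exponents recorded in \<open>ls\<close>. Its degree
  \<open>k\<close> part is the polynomial \<open>expand ls\<close>, so that polynomial is zero and
  its evaluation is trivial. By \<open>lp_y_expand\<close> the same evaluation is congruent to
  \<open>g [^] k\<close>.\<close>

lemma dynkin:
  assumes "0 < k" "g \<in> \<Gamma> k" "\<And>v. v \<in> W k \<Longrightarrow> coef (M g) v = 0"
  shows "g [^] k \<in> \<Gamma> (Suc k)"
proof -
  obtain ls where ls: "snd ` set ls \<subseteq> W k" "cls (Suc k) g = cls (Suc k) (lp y ls)"
    using lc_rep assms by blast
  have c: "g \<in> carrier G" "lp y ls \<in> \<Gamma> k" "lp y ls \<in> carrier G"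
    using lp_y_lc ls assms lc_closed by blast+
  have "cf (expand ls) v = 0" if "v \<in> W k" for v
  proof -
    have v: "length v = k" using that by (simp add: words_of_length_def)
    have "cf (expand ls) v = coef (M (lp y ls)) v" using lead_lp_y assms(1) ls v by simp
    also have "\<dots> = coef (M g) v" using lead_cong[of k g "lp y ls" v] assms ls c v by simp
    finally show ?thesis using assms that by simp
  qed
  then have "cls (Suc k) (lp y (expand ls)) = cls (Suc k) (lp y [])"
    using assms ls expand_words by (intro lp_y_cf_cong) auto
  moreover have "cls (Suc k) (lp y (expand ls)) = cls (Suc k) (lp y ls [^] k)"
    by (rule lp_y_expand) (use assms ls in auto)
  moreover have "cls (Suc k) (g [^] k) = cls (Suc k) (lp y ls [^] k)"
    by (rule cls_pow_cong) (use ls c in auto)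
  ultimately show ?thesis using c by (simp add: cls_eq_iff')
qed

text \<open>A converse of \<open>lc_low\<close> up to powers: passing degree \<open>k\<close>
  multiplies the exponent by \<open>k\<close>, through \<open>dynkin\<close>. Taking powers moves an
  element into the lower central series without leaving a given subgroup.\<close>

lemma low_pow_lc:
  assumes "0 < k" "g \<in> carrier G" "low k g"
  shows "\<exists>n>0. g [^] (n :: nat) \<in> \<Gamma> k"
  using assms
proof (induction k rule: nat_induct_non_zero)
  case 1
  then show ?case by (intro exI[of _ 1]) auto
next
  case (Suc k)
  have "low k g" using Suc.prems unfolding low_def by (auto intro: vanish_mono)
  with Suc obtain n :: nat where n: "0 < n" "g [^] n \<in> \<Gamma> k" by blast
  have "(g [^] n) [^] k \<in> \<Gamma> (Suc k)"
  proof (rule dynkin)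
    fix v assume "v \<in> W k"
    then have v: "length v = k" by (simp add: words_of_length_def)
    then have "coef (M g) v = 0" using Suc.prems Suc.hyps by (auto simp: low_iff)
    then show "coef (M (g [^] n)) v = 0" using lead_pow[of g k v n] v Suc.hyps Suc.prems \<open>low k g\<close> by simp
  qed (use n Suc.hyps in auto)
  then show ?case using n Suc.hyps Suc.prems by (intro exI[of _ "n * k"]) (auto simp: nat_pow_pow)
qed

text \<open>The graded piece is a finitely generated abelian group, so it is finite modulo
  \<open>d\<close>-th powers: all exponents are divided by \<open>d\<close>, the remainders form
  \<open>b\<close> and the quotients form \<open>e\<close>.\<close>

lemma lc_mod_powers_finite:
  assumes "0 < k" "0 < d"
  shows "\<exists>B. finite B \<and> B \<subseteq> \<Gamma> k \<and>
    (\<forall>g\<in>\<Gamma> k. \<exists>b\<in>B. \<exists>e\<in>\<Gamma> k. cls (Suc k) g = cls (Suc k) (b \<otimes> e [^] (d :: nat)))"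
proof -
  let ?L = "{l. set l \<subseteq> {0..<int d} \<times> W k \<and> length l = length (word_list m k)}"
  let ?l = "\<lambda>p. map (\<lambda>v. (p v, v)) (word_list m k)"
  have wl: "snd ` set (?l p) = W k" for p by force
  have fin: "finite ?L" by (intro finite_lists_length_eq) auto
  have L: "lp y l \<in> \<Gamma> k" if "l \<in> ?L" for l using that assms by (intro lp_y_lc) auto
  have "\<exists>b\<in>lp y ` ?L. \<exists>e\<in>\<Gamma> k. cls (Suc k) g = cls (Suc k) (b \<otimes> e [^] d)" if g: "g \<in> \<Gamma> k" for g
  proof -
    obtain ls where ls: "snd ` set ls \<subseteq> W k" "cls (Suc k) g = cls (Suc k) (lp y ls)"
      using lc_rep assms g by blast
    define r where "r = ?l (\<lambda>v. cf ls v mod int d)"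
    define q where "q = ?l (\<lambda>v. cf ls v div int d)"
    have wq: "snd ` set q = W k" "snd ` set r = W k" unfolding q_def r_def by (rule wl)+
    have r: "r \<in> ?L" using assms by (auto simp: r_def)
    have q: "lp y q \<in> \<Gamma> k" using assms wq by (intro lp_y_lc) auto
    have c: "lp y r \<in> carrier G" "lp y q \<in> carrier G" using L r q lc_closed by blast+
    have c': "lp y (scale (int d) q) \<in> carrier G"
      using lp_y_lc[of k "scale (int d) q"] assms wq lc_closed by simp
    have "cls (Suc k) (lp y ls) = cls (Suc k) (lp y (r @ scale (int d) q))"
    proof (rule lp_y_cf_cong[OF assms(1) ls(1)])
      show "snd ` set (r @ scale (int d) q) \<subseteq> W k" using wq by (simp add: image_Un)
      show "cf ls v = cf (r @ scale (int d) q) v" if "v \<in> W k" for v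
        using that by (simp add: r_def q_def cf_map_distinct)
    qed
    also have "\<dots> = cls (Suc k) (lp y r \<otimes> lp y (scale (int d) q))"
    proof (subst lp_append(1))
      fix v assume "v \<in> snd ` set (r @ scale (int d) q)"
      then have "v \<in> W k" using wq by (simp add: image_Un)
      then show "y v \<in> carrier G" using y_closed[OF assms(1)] by blast
    qed simp
    also have "\<dots> = cls (Suc k) (lp y r \<otimes> lp y q [^] d)"
    proof (rule cls_mult_cong[OF HOL.refl])
      show "cls (Suc k) (lp y (scale (int d) q)) = cls (Suc k) (lp y q [^] d)"
        using lp_scale[OF assms(1), of q y "int d"] wq y_lc[OF assms(1)] by (simp add: int_pow_int)
    qed (use c c' in auto)
    finally show ?thesis using r q ls(2) by blast
  qed
  then show ?thesis using fin L by (intro exI[of _ "lp y ` ?L"]) auto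
qed

text \<open>Downward induction on \<open>j\<close>. Representatives are taken modulo
  \<open>j\<close>-th powers because \<open>j\<close> is the exponent in \<open>dynkin\<close>. If
  two kernel elements share the representative \<open>b\<close>, their quotient is congruent to some
  \<open>?e [^] j\<close>. The degree \<open>j\<close> part of this vanishes, hence so does that of
  \<open>?e\<close>, and \<open>dynkin\<close> puts the quotient into
  \<open>\<Gamma> (Suc j)\<close>. So the elements sharing \<open>b\<close> lie in a translate of
  the next kernel, which is finite.\<close>

lemma kernel_finite:
  assumes "0 < j" "j \<le> Suc c"
  shows "finite (cls (Suc c) ` {r \<in> \<Gamma> j. low (Suc c) r})"
  using assms(2,1)
proof (induction rule: inc_induct)
  case base
  have "cls (Suc c) r = cls (Suc c) \<one>" if "r \<in> \<Gamma> (Suc c)" for r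
    using that lc_closed cls_eq_iff' by blast
  then have "cls (Suc c) ` {r \<in> \<Gamma> (Suc c). low (Suc c) r} \<subseteq> {cls (Suc c) \<one>}" by blast
  then show ?case using finite_subset by blast
next
  case (step j)
  let ?K = "\<lambda>j. {r \<in> \<Gamma> j. low (Suc c) r}"
  obtain B where B: "finite B" "B \<subseteq> \<Gamma> j"
    "\<And>g. g \<in> \<Gamma> j \<Longrightarrow> \<exists>b\<in>B. \<exists>e\<in>\<Gamma> j. cls (Suc j) g = cls (Suc j) (b \<otimes> e [^] j)"
    using lc_mod_powers_finite[OF step.prems step.prems] by blast
  let ?Kb = "\<lambda>b. {r \<in> ?K j. \<exists>e\<in>\<Gamma> j. cls (Suc j) r = cls (Suc j) (b \<otimes> e [^] j)}"
  have "finite (cls (Suc c) ` ?Kb b)" if b: "b \<in> B" for b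
  proof (cases "?Kb b = {}")
    case False
    then obtain r0 e0 where r0: "r0 \<in> \<Gamma> j" "low (Suc c) r0" "e0 \<in> \<Gamma> j"
      "cls (Suc j) r0 = cls (Suc j) (b \<otimes> e0 [^] j)" by blast
    have *: "r \<otimes> inv r0 \<in> ?K (Suc j)" if r: "r \<in> ?Kb b" for r
    proof -
      obtain e where e: "r \<in> \<Gamma> j" "low (Suc c) r" "e \<in> \<Gamma> j"
        "cls (Suc j) r = cls (Suc j) (b \<otimes> e [^] j)" using r by blast
      have c: "r \<in> carrier G" "r0 \<in> carrier G" "e \<in> carrier G" "e0 \<in> carrier G" "b \<in> carrier G"
        using e r0 b B lc_closed by blast+
      let ?t = "r \<otimes> inv r0" and ?e = "e \<otimes> inv e0"
      have t: "?t \<in> \<Gamma> j" "low (Suc c) ?t" "?t \<in> carrier G"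
        using e r0 c by (auto intro: low_mult low_inv)
      have E: "?e \<in> \<Gamma> j" "?e \<in> carrier G" using e r0 c by auto
      have "cls (Suc j) (inv r0) = cls (Suc j) (inv (b \<otimes> e0 [^] j))"
        by (rule cls_inv_cong[OF r0(4)]) (use c in auto)
      then have "cls (Suc j) ?t = cls (Suc j) ((b \<otimes> e [^] j) \<otimes> inv (b \<otimes> e0 [^] j))"
        by (rule cls_mult_cong[OF e(4)]) (use c in auto)
      also have "\<dots> = cls (Suc j) (b \<otimes> (e [^] j \<otimes> inv (e0 [^] j)) \<otimes> inv b)"
        using c by (simp add: inv_mult_group m_assoc)
      also have "\<dots> = cls (Suc j) (e [^] j \<otimes> inv (e0 [^] j))"
        by (rule cls_conj, rule comm_lc_Suc) (use step.prems c e r0 in auto)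
      also have "\<dots> = cls (Suc j) (e [^] j \<otimes> (inv e0) [^] j)"
        using c by (simp add: nat_pow_inv)
      also have "\<dots> = cls (Suc j) (?e [^] j)"
        using cls_pow_mult[of j e "inv e0" j] step.prems c r0 by simp
      finally have te: "cls (Suc j) ?t = cls (Suc j) (?e [^] j)" .
      have "?e [^] j \<in> \<Gamma> (Suc j)"
      proof (rule dynkin[OF step.prems E(1)])
        fix v assume "v \<in> W j"
        then have v: "length v = j" by (simp add: words_of_length_def)
        have "int j * coef (M ?e) v = coef (M (?e [^] j)) v"
          using lead_pow[OF E(2) _ v step.prems] lc_low[OF step.prems E(1)] by simp
        also have "\<dots> = coef (M ?t) v"
          using lead_cong[OF step.prems t(1) _ te v] E by simp
        also have "\<dots> = 0" using t v step by (auto simp: low_iff)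
        finally show "coef (M ?e) v = 0" using step.prems by simp
      qed
      then have "cls (Suc j) ?t = cls (Suc j) \<one>" using te E by (simp add: cls_eq_iff')
      then show ?thesis using t by (simp add: cls_eq_iff')
    qed
    have "cls (Suc c) r \<in> (\<lambda>C. C <#> cls (Suc c) r0) ` cls (Suc c) ` ?K (Suc j)" if r: "r \<in> ?Kb b" for r
    proof -
      have c: "r \<in> carrier G" "r0 \<in> carrier G" using r r0 lc_closed by blast+
      then have "cls (Suc c) r = cls (Suc c) (r \<otimes> inv r0) <#> cls (Suc c) r0"
        using normal.rcos_sum[OF normal_lower_central, of "r \<otimes> inv r0" r0 "Suc c"]
        by (simp add: m_assoc)
      then show ?thesis using *[OF r] by blast
    qed
    then have "cls (Suc c) ` ?Kb b \<subseteq> (\<lambda>C. C <#> cls (Suc c) r0) ` cls (Suc c) ` ?K (Suc j)" by blast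
    then show ?thesis using step.IH finite_subset by blast
  next
    case True
    show ?thesis unfolding True by simp
  qed
  then have "finite (\<Union>b\<in>B. cls (Suc c) ` ?Kb b)" using B(1) by blast
  moreover have "cls (Suc c) ` ?K j \<subseteq> (\<Union>b\<in>B. cls (Suc c) ` ?Kb b)" using B(3) by blast
  ultimately show ?case by (rule rev_finite_subset)
qed

end

section \<open>Finite index and lengths of powers\<close>

text \<open>Integral Gaussian elimination on the coordinates below \<open>m\<close>, phrased without
  ranks. The induction passes to the vectors whose last coordinate is 0.\<close>

lemma lattice_dichotomy:
  fixes L :: "(nat \<Rightarrow> int) set"
  assumes "\<And>s t u v. u \<in> L \<Longrightarrow> v \<in> L \<Longrightarrow> (\<lambda>i. s * u i + t * v i) \<in> L"
  shows "(\<exists>a. (\<exists>i<m. a i \<noteq> 0) \<and> (\<forall>v\<in>L. (\<Sum>i<m. a i * v i) = 0)) \<or>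
    (\<exists>d>0. \<forall>i<m. \<exists>v\<in>L. \<forall>j<m. v j = (if j = i then d else 0))"
  using assms
proof (induction m arbitrary: L)
  case 0
  show ?case by (rule disjI2) (auto intro: exI[of _ 1])
next
  case (Suc m)
  note lin = Suc.prems
  define L0 where "L0 = {v \<in> L. v m = 0}"
  have L0: "(\<exists>a. (\<exists>i<m. a i \<noteq> 0) \<and> (\<forall>v\<in>L0. (\<Sum>i<m. a i * v i) = 0)) \<or>
    (\<exists>d>0. \<forall>i<m. \<exists>v\<in>L0. \<forall>j<m. v j = (if j = i then d else 0))"
    by (rule Suc.IH) (auto simp: L0_def intro: lin)
  show ?case
  proof (cases "\<forall>v\<in>L. v m = 0")
    case True
    then show ?thesis by (intro disjI1 exI[of _ "\<lambda>i. if i = m then 1 else 0"]) auto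
  next
    case False
    then obtain u where u: "u \<in> L" "u m \<noteq> 0" by blast
    from L0 show ?thesis
    proof
      assume "\<exists>a. (\<exists>i<m. a i \<noteq> 0) \<and> (\<forall>v\<in>L0. (\<Sum>i<m. a i * v i) = 0)"
      then obtain b i where b: "i < m" "b i \<noteq> 0" "\<And>v. v \<in> L0 \<Longrightarrow> (\<Sum>i<m. b i * v i) = 0" by blast
      define a where "a = (\<lambda>i. if i < m then u m * b i else - (\<Sum>j<m. b j * u j))"
      have "(\<Sum>i<Suc m. a i * v i) = 0" if v: "v \<in> L" for v
      proof -
        have "(\<lambda>i. u m * v i + (- v m) * u i) \<in> L0"
          using lin[OF v u(1), of "u m" "- v m"] by (simp add: L0_def)
        from b(3)[OF this] have "u m * (\<Sum>i<m. b i * v i) = v m * (\<Sum>i<m. b i * u i)"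
          by (simp add: algebra_simps sum_subtractf sum_distrib_left)
        moreover have "(\<Sum>i<Suc m. a i * v i) = u m * (\<Sum>i<m. b i * v i) - v m * (\<Sum>i<m. b i * u i)"
          by (simp add: a_def sum_distrib_left algebra_simps)
        ultimately show ?thesis by simp
      qed
      moreover have "a i \<noteq> 0" "i < Suc m" using b u by (auto simp: a_def)
      ultimately show ?thesis by blast
    next
      assume "\<exists>d>0. \<forall>i<m. \<exists>v\<in>L0. \<forall>j<m. v j = (if j = i then d else 0)"
      then obtain d where d: "d > 0" "\<And>i. i < m \<Longrightarrow> \<exists>v\<in>L0. \<forall>j<m. v j = (if j = i then d else 0)" by blast
      have unit: "\<exists>v\<in>L. \<forall>j<Suc m. v j = (if j = i then d else 0)" if "i < m" for i
      proof -
        note i = that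
        obtain v where "v \<in> L0" "\<forall>j<m. v j = (if j = i then d else 0)" using d(2)[OF i] by blast
        then show ?thesis using i by (intro bexI[of _ v]) (auto simp: L0_def less_Suc_eq)
      qed
      \<comment> \<open>Starting from \<open>d\<close> times \<open>u\<close>, the first
        \<open>n\<close> coordinates are cleared one at a time with multiples of unit vectors; at
        \<open>n = m\<close> only \<open>d * u m\<close> in the last place remains.\<close>
      have "\<exists>w\<in>L. \<forall>j<Suc m. w j = (if j < n then 0 else d * u j)" if "n \<le> m" for n
        using that
      proof (induction n)
        case 0
        show ?case using lin[OF u(1) u(1), of d 0] by (intro bexI[of _ "\<lambda>i. d * u i + 0 * u i"]) auto
      next
        case (Suc n)
        then obtain w where w: "w \<in> L" "\<And>j. j < Suc m \<Longrightarrow> w j = (if j < n then 0 else d * u j)" by auto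
        obtain v where v: "v \<in> L" "\<And>j. j < Suc m \<Longrightarrow> v j = (if j = n then d else 0)"
          using unit[of n] Suc.prems by auto
        show ?case using lin[OF w(1) v(1), of 1 "- u n"] w(2) v(2)
          by (intro bexI[of _ "\<lambda>i. 1 * w i + (- u n) * v i"]) (auto simp: less_Suc_eq)
      qed
      from this[of m] obtain w where w: "w \<in> L" "\<And>j. j < Suc m \<Longrightarrow> w j = (if j < m then 0 else d * u j)"
        by auto
      have "\<exists>v\<in>L. \<forall>j<Suc m. v j = (if j = i then d * \<bar>u m\<bar> else 0)" if "i < Suc m" for i
      proof (cases "i = m")
        case True
        show ?thesis using lin[OF w(1) w(1), of "sgn (u m)" 0] w(2) True
          by (intro bexI[of _ "\<lambda>i. sgn (u m) * w i + 0 * w i"]) (auto simp: sgn_if)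
      next
        case False
        then have "i < m" using that by simp
        from unit[OF this] obtain v where v: "v \<in> L" "\<And>j. j < Suc m \<Longrightarrow> v j = (if j = i then d else 0)"
          by blast
        show ?thesis using lin[OF v(1) v(1), of "\<bar>u m\<bar>" 0] v(2)
          by (intro bexI[of _ "\<lambda>i. \<bar>u m\<bar> * v i + 0 * v i"]) auto
      qed
      moreover have "d * \<bar>u m\<bar> > 0" using d u by simp
      ultimately show ?thesis by blast
    qed
  qed
qed

section \<open>Lifting finite index from the abelianization\<close>

context magnus_rep
begin

text \<open>Bilinearity moves the exponent into the first entry: \<open>y (i # v) [^] d\<close> is
  congruent to \<open>comm (x i [^] d) (y v)\<close>, hence to \<open>comm h (y v)\<close> with
  \<open>h\<close> in \<open>K\<close>, and this lies in \<open>K\<close> by normality.\<close>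

lemma pow_mod_normal:
  assumes K: "K \<lhd> G" and x: "\<And>i. i < m \<Longrightarrow> \<exists>h\<in>K. cls 2 h = cls 2 (x i [^] (d :: nat))"
    and "0 < k" "e \<in> \<Gamma> k"
  shows "\<exists>h\<in>K. cls (Suc k) (e [^] d) = cls (Suc k) h"
  using assms(3,4)
proof (induction rule: lc_word_induct)
  case (word w)
  interpret K: normal K G by fact
  show ?case
  proof (cases "k = 1")
    case True
    then obtain i where i: "w = [i]" "i < m" using word by (auto simp: words_of_length_def length_Suc_conv)
    with x[OF i(2)] True show ?thesis by (auto simp: numeral_2_eq_2)
  next
    case False
    then obtain k' where k: "k = Suc k'" "0 < k'" using \<open>0 < k\<close> by (cases k) auto
    then obtain i v where w: "w = i # v" "i < m" "v \<in> W k'" "v \<noteq> []"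
      using word by (cases w) (auto simp: words_of_length_def)
    obtain h where h: "h \<in> K" "cls 2 h = cls 2 (x i [^] d)" using x w by blast
    have v: "y v \<in> \<Gamma> k'" using y_lc k w by blast
    then have c: "y v \<in> carrier G" "h \<in> carrier G" using h lc_closed K.subset by auto
    have "cls (Suc k) (comm (x i) (y v) [^] d) = cls (Suc k) (comm (x i [^] d) (y v))"
      using comm_pow_left[of 1 k' "Suc k" "x i" "y v" d] k v w by simp
    also have "\<dots> = cls (Suc k) (comm h (y v))"
      by (rule comm_cong_left[of 1 k']) (use h k v w c in \<open>auto simp: numeral_2_eq_2\<close>)
    finally have "cls (Suc k) (y w [^] d) = cls (Suc k) (comm h (y v))" using w by (simp add: y_Cons)
    moreover have "comm h (y v) = h \<otimes> (y v \<otimes> inv h \<otimes> inv (y v))"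
      using c by (simp add: gcomm_def m_assoc)
    then have "comm h (y v) \<in> K" using h c K.inv_op_closed2 by auto
    ultimately show ?thesis by blast
  qed
next
  case (lc t)
  then have "cls (Suc k) (t [^] d) = cls (Suc k) \<one>" using lc_closed by (auto simp flip: cls_eq_iff')
  then show ?case using subgroup.one_closed[OF normal_imp_subgroup[OF K]] by blast
next
  case (mult a b)
  then obtain h h' where h: "h \<in> K" "cls (Suc k) (a [^] d) = cls (Suc k) h"
    "h' \<in> K" "cls (Suc k) (b [^] d) = cls (Suc k) h'" by blast
  have c: "a \<in> carrier G" "b \<in> carrier G" "h \<in> carrier G" "h' \<in> carrier G"
    using lc_closed[OF mult(1)] lc_closed[OF mult(2)] h subgroup.mem_carrier[OF normal_imp_subgroup[OF K]] by auto
  have "cls (Suc k) ((a \<otimes> b) [^] d) = cls (Suc k) (a [^] d \<otimes> b [^] d)"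
    by (rule cls_pow_mult) (use mult c \<open>0 < k\<close> in auto)
  also have "\<dots> = cls (Suc k) (h \<otimes> h')"
    by (rule cls_mult_cong) (use h c in auto)
  finally show ?case using h subgroup.m_closed[OF normal_imp_subgroup[OF K]] by blast
next
  case (inv a)
  then obtain h where h: "h \<in> K" "cls (Suc k) (a [^] d) = cls (Suc k) h" by blast
  have c: "a \<in> carrier G" "h \<in> carrier G"
    using lc_closed[OF inv(1)] h subgroup.mem_carrier[OF normal_imp_subgroup[OF K]] by auto
  have "cls (Suc k) (inv a [^] d) = cls (Suc k) (inv (a [^] d))" using c by (simp add: nat_pow_inv)
  also have "\<dots> = cls (Suc k) (inv h)" by (rule cls_inv_cong) (use h c in auto)
  finally show ?case using h subgroup.m_inv_closed[OF normal_imp_subgroup[OF K]] by blast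
qed

text \<open>To go one term down the series, \<open>t\<close> is written modulo
  \<open>\<Gamma> (Suc n)\<close> as one of finitely many elements times a \<open>d\<close>-th
  power, and \<open>pow_mod_normal\<close> lets \<open>K\<close> absorb the power.\<close>

lemma finite_index_of_powers:
  assumes K: "K \<lhd> G" and d: "0 < (d :: nat)"
    and x: "\<And>i. i < m \<Longrightarrow> \<exists>h\<in>K. cls 2 h = cls 2 (x i [^] d)"
    and "0 < n"
  shows "\<exists>B. finite B \<and> B \<subseteq> carrier G \<and>
    (\<forall>g\<in>carrier G. \<exists>b\<in>B. \<exists>h\<in>K. \<exists>t\<in>\<Gamma> n. g = b \<otimes> h \<otimes> t)"
  using assms(4)
proof (induction n rule: nat_induct_non_zero)
  case 1
  have "\<exists>b\<in>{\<one>}. \<exists>h\<in>K. \<exists>t\<in>\<Gamma> 1. g = b \<otimes> h \<otimes> t" if "g \<in> carrier G" for g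
    by (rule bexI[of _ \<one>], rule bexI[of _ \<one>], rule bexI[of _ g])
      (use that subgroup.one_closed[OF normal_imp_subgroup[OF K]] in auto)
  moreover have "finite {\<one>}" "{\<one>} \<subseteq> carrier G" by auto
  ultimately show ?case by blast
next
  case (Suc n)
  interpret K: normal K G by fact
  interpret N: normal "\<Gamma> (Suc n)" G by (rule normal_lower_central)
  obtain B where B: "finite B" "B \<subseteq> carrier G"
    "\<forall>g\<in>carrier G. \<exists>b\<in>B. \<exists>h\<in>K. \<exists>t\<in>\<Gamma> n. g = b \<otimes> h \<otimes> t" using Suc.IH by (elim exE conjE)
  obtain B' where B': "finite B'" "B' \<subseteq> \<Gamma> n"
    "\<forall>g\<in>\<Gamma> n. \<exists>b\<in>B'. \<exists>e\<in>\<Gamma> n. cls (Suc n) g = cls (Suc n) (b \<otimes> e [^] d)"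
    using lc_mod_powers_finite[OF Suc.hyps d] by (elim exE conjE)
  let ?B = "(\<lambda>(b, b'). b \<otimes> b') ` (B \<times> B')"
  have *: "\<exists>b\<in>?B. \<exists>h\<in>K. \<exists>t\<in>\<Gamma> (Suc n). g = b \<otimes> h \<otimes> t"
    if g: "g \<in> carrier G" for g
  proof -
    obtain b h t where b: "b \<in> B" "h \<in> K" "t \<in> \<Gamma> n" "g = b \<otimes> h \<otimes> t" using bspec[OF B(3) g] by (elim bexE)
    obtain b' e where b': "b' \<in> B'" "e \<in> \<Gamma> n" "cls (Suc n) t = cls (Suc n) (b' \<otimes> e [^] d)"
      using bspec[OF B'(3) b(3)] by (elim bexE)
    obtain h' where h': "h' \<in> K" "cls (Suc n) (e [^] d) = cls (Suc n) h'"
      using pow_mod_normal[OF K x Suc.hyps b'(2)] by blast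
    have b'n: "b' \<in> \<Gamma> n" using b' B' by blast
    have c: "b \<in> carrier G" "h \<in> carrier G" "t \<in> carrier G" "b' \<in> carrier G" "e \<in> carrier G" "h' \<in> carrier G"
      using b B K.subset h' lc_closed[OF b(3)] lc_closed[OF b'n] lc_closed[OF b'(2)] by auto
    have "cls (Suc n) t = cls (Suc n) (b' \<otimes> h')"
      unfolding b'(3) by (rule cls_mult_cong) (use h' c in auto)
    then obtain s where s: "s \<in> \<Gamma> (Suc n)" "t = s \<otimes> (b' \<otimes> h')" using cls_eqE c by (metis m_closed)
    \<comment> \<open>Conjugation moves \<open>s\<close> to the right end. Normality of
      \<open>K\<close> then lets \<open>b'\<close> pass \<open>h\<close> and join
      \<open>b\<close>.\<close>
    define s' where "s' = inv (b' \<otimes> h') \<otimes> s \<otimes> (b' \<otimes> h')"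
    have s': "s' \<in> \<Gamma> (Suc n)" unfolding s'_def using s c by (intro N.inv_op_closed1) auto
    have sc: "s \<in> carrier G" "s' \<in> carrier G" using s s' lc_closed by blast+
    have "t = b' \<otimes> h' \<otimes> s'" using s sc c by (simp add: s'_def m_assoc inv_mult_group)
    then have "g = (b \<otimes> b') \<otimes> ((inv b' \<otimes> h \<otimes> b') \<otimes> h') \<otimes> s'"
      using b c sc by (simp add: m_assoc)
    moreover have "(inv b' \<otimes> h \<otimes> b') \<otimes> h' \<in> K" using b c h' K.inv_op_closed1 by auto
    moreover have "b \<otimes> b' \<in> ?B" using b b' by force
    ultimately show ?thesis using s' by blast
  qed
  have "finite ?B" using B(1) B'(1) by (intro finite_imageI finite_cartesian_product)
  moreover have "?B \<subseteq> carrier G"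
    using B(2) subset_trans[OF B'(2) subgroup.subset[OF lc_subgroup]] by auto
  ultimately show ?case using * by (intro exI[of _ ?B] conjI ballI)
qed

end

context group
begin

lemma foldr_map_inv:
  "set ws \<subseteq> carrier G \<Longrightarrow> foldr (\<otimes>) (map (m_inv G) (rev ws)) \<one> = inv (foldr (\<otimes>) ws \<one>)"
proof (induction ws)
  case (Cons w ws)
  have "foldr (\<otimes>) (map (m_inv G) (rev ws) @ [inv w]) \<one>
      = foldr (\<otimes>) (map (m_inv G) (rev ws)) \<one> \<otimes> foldr (\<otimes>) [inv w] \<one>"
    using Cons.prems by (intro foldr_mult_append) auto
  then show ?case using Cons foldr_mult_closed[of ws] by (simp add: inv_mult_group)
qed simp

lemma word_length_inv:
  assumes "S \<subseteq> carrier G" "g \<in> generate G S"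
  shows "word_length G S (inv g) \<le> word_length G S g"
proof -
  obtain ws where ws: "length ws = word_length G S g" "set ws \<subseteq> S \<union> m_inv G ` S" "foldr (\<otimes>) ws \<one> = g"
    using word_length_obtain[OF assms] .
  have "set ws \<subseteq> carrier G" using ws assms by auto
  then have "foldr (\<otimes>) (map (m_inv G) (rev ws)) \<one> = inv g" using ws by (simp add: foldr_map_inv)
  moreover have "m_inv G ` (S \<union> m_inv G ` S) \<subseteq> S \<union> m_inv G ` S" using assms by auto
  then have "m_inv G ` set ws \<subseteq> S \<union> m_inv G ` S" by (rule subset_trans[OF image_mono[OF ws(2)]])
  ultimately show ?thesis
    using word_length_le[of "map (m_inv G) (rev ws)" S "inv g"] ws(1) by simp
qed

end

section \<open>Short representatives of high powers\<close>

context magnus_rep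
begin

abbreviation "len \<equiv> word_length G (x ` {..<m})"

lemma gens_closed: "x ` {..<m} \<subseteq> carrier G"
  by auto

lemma len_mult: "a \<in> carrier G \<Longrightarrow> b \<in> carrier G \<Longrightarrow> len (a \<otimes> b) \<le> len a + len b"
  using word_length_mult[OF gens_closed] x_gen by simp

lemma len_inv: "a \<in> carrier G \<Longrightarrow> len (inv a) \<le> len a"
  using word_length_inv[OF gens_closed] x_gen by simp

lemma len_x: "i < m \<Longrightarrow> len (x i) \<le> 1"
  using word_length_le[of "[x i]" "x ` {..<m}" "x i"] by simp

lemma len_pow: "a \<in> carrier G \<Longrightarrow> len (a [^] (n :: nat)) \<le> n * len a"
proof (induction n)
  case (Suc n)
  then have "len (a [^] n \<otimes> a) \<le> len (a [^] n) + len a" by (intro len_mult) auto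
  then show ?case using Suc by simp
qed simp

lemma len_comm:
  assumes "a \<in> carrier G" "b \<in> carrier G"
  shows "len (comm a b) \<le> 2 * (len a + len b)"
proof -
  have "len (a \<otimes> b \<otimes> inv a \<otimes> inv b) \<le> len (a \<otimes> b \<otimes> inv a) + len (inv b)"
    using assms by (intro len_mult) auto
  also have "\<dots> \<le> len (a \<otimes> b) + len (inv a) + len (inv b)"
    using assms len_mult[of "a \<otimes> b" "inv a"] by simp
  also have "\<dots> \<le> len a + len b + len a + len b"
    using assms len_mult[of a b] len_inv[of a] len_inv[of b] by simp
  finally show ?thesis by (simp add: gcomm_def)
qed

text \<open>Exponents multiply in a commutator: if \<open>r\<close> represents
  \<open>y w [^] (n ^ k')\<close>, then \<open>comm (x i [^] n) r\<close> represents
  \<open>y (i # w) [^] (n ^ Suc k')\<close>. Its length is at most twice the sum of the lengths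
  \<open>n\<close> and \<open>C * n\<close>, whence the new constant
  \<open>2 * (1 + C)\<close>.\<close>

lemma y_pow_len:
  "0 < k \<Longrightarrow> w \<in> W k \<Longrightarrow>
    \<exists>C. \<forall>n. \<exists>r\<in>\<Gamma> k. cls (Suc k) r = cls (Suc k) (y w [^] (n ^ k)) \<and> len r \<le> C * n"
proof (induction w arbitrary: k)
  case (Cons i w)
  show ?case
  proof (cases "w = []")
    case True
    then have k: "k = 1" "i < m" using Cons.prems by (auto simp: words_of_length_def)
    have "len (x i [^] n) \<le> 1 * n" for n :: nat
    proof -
      have "len (x i [^] n) \<le> n * len (x i)" using k by (intro len_pow) auto
      also have "\<dots> \<le> n * 1" using k len_x by (intro mult_le_mono2) auto
      finally show ?thesis by simp
    qed
    then show ?thesis using True k by (intro exI[of _ 1] allI) (auto intro!: bexI[of _ "x i [^] _"])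
  next
    case False
    obtain k' where k: "k = Suc k'" using Cons.prems by (cases k) auto
    have k': "0 < k'" "w \<in> W k'" "i < m" using Cons.prems False k by (cases k'; auto)+
    obtain C where C: "\<And>n. \<exists>r\<in>\<Gamma> k'. cls (Suc k') r = cls (Suc k') (y w [^] (n ^ k')) \<and> len r \<le> C * n"
      using Cons.IH k' by blast
    have yw: "y w \<in> \<Gamma> k'" "y w \<in> carrier G" using y_lc y_closed k' by auto
    have "\<exists>r\<in>\<Gamma> k. cls (Suc k) r = cls (Suc k) (y (i # w) [^] (n ^ k)) \<and> len r \<le> (2 * (1 + C)) * n" for n
    proof -
      obtain r where r: "r \<in> \<Gamma> k'" "cls (Suc k') r = cls (Suc k') (y w [^] (n ^ k'))" "len r \<le> C * n"
        using C by blast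
      have rc: "r \<in> carrier G" using r lc_closed by blast
      have xn: "x i [^] n \<in> carrier G" using k' by simp
      have "cls (Suc k) (comm (x i [^] n) r) = cls (Suc k) (comm (x i [^] n) (y w [^] (n ^ k')))"
        by (rule comm_cong_right[of 1 k']) (use r xn yw k' k in auto)
      also have "\<dots> = cls (Suc k) (comm (x i) (y w [^] (n ^ k')) [^] n)"
        by (rule comm_pow_left[of 1 k']) (use yw k' k in auto)
      also have "\<dots> = cls (Suc k) ((comm (x i) (y w) [^] (n ^ k')) [^] n)"
        by (rule cls_pow_cong, rule comm_pow_right[of 1 k']) (use yw k' k in auto)
      also have "\<dots> = cls (Suc k) (y (i # w) [^] (n ^ k))"
        using yw k' False by (simp add: y_Cons nat_pow_pow k mult.commute)
      finally have 1: "cls (Suc k) (comm (x i [^] n) r) = cls (Suc k) (y (i # w) [^] (n ^ k))" .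
      have "len (x i [^] n) \<le> n * len (x i)" using k' by (intro len_pow) auto
      also have "\<dots> \<le> n" using len_x[of i] k' by (cases "len (x i)") auto
      finally have "len (x i [^] n) + len r \<le> n + C * n" using r by simp
      then have "len (comm (x i [^] n) r) \<le> 2 * (n + C * n)"
        using order_trans[OF len_comm[OF xn rc]] by simp
      then have "len (comm (x i [^] n) r) \<le> (2 * (1 + C)) * n" by (simp add: algebra_simps)
      moreover have "comm (x i [^] n) r \<in> \<Gamma> k" using comm_lc_Suc k k' xn r by blast
      ultimately show ?thesis using 1 by blast
    qed
    then show ?thesis by blast
  qed
qed (auto simp: words_of_length_def)

lemma lc_pow_len:
  assumes "0 < k" "z \<in> \<Gamma> k"
  shows "\<exists>C. \<forall>n. \<exists>r\<in>carrier G. cls (Suc k) r = cls (Suc k) (z [^] (n ^ k)) \<and> len r \<le> C * n"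
  using assms
proof (induction rule: lc_word_induct)
  case (word w)
  then show ?case using y_pow_len[OF assms(1), of w] lc_closed by blast
next
  case (lc t)
  have "cls (Suc k) \<one> = cls (Suc k) (t [^] (n ^ k))" for n :: nat
    using cls_eq_iff'[of "t [^] (n ^ k)" "Suc k"] lc_closed[OF lc] lc by simp
  then show ?case by (intro exI[of _ 0] allI bexI[of _ \<one>]) auto
next
  case (mult a b)
  then obtain C D where
    C: "\<And>n. \<exists>r\<in>carrier G. cls (Suc k) r = cls (Suc k) (a [^] (n ^ k)) \<and> len r \<le> C * n" and
    D: "\<And>n. \<exists>r\<in>carrier G. cls (Suc k) r = cls (Suc k) (b [^] (n ^ k)) \<and> len r \<le> D * n" by blast
  have c: "a \<in> carrier G" "b \<in> carrier G" using lc_closed[OF mult(1)] lc_closed[OF mult(2)] .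
  have "\<exists>r\<in>carrier G. cls (Suc k) r = cls (Suc k) ((a \<otimes> b) [^] (n ^ k)) \<and> len r \<le> (C + D) * n" for n
  proof -
    obtain r s where r: "r \<in> carrier G" "cls (Suc k) r = cls (Suc k) (a [^] (n ^ k))" "len r \<le> C * n"
      and s: "s \<in> carrier G" "cls (Suc k) s = cls (Suc k) (b [^] (n ^ k))" "len s \<le> D * n"
      using C[of n] D[of n] by blast
    have "cls (Suc k) (r \<otimes> s) = cls (Suc k) (a [^] (n ^ k) \<otimes> b [^] (n ^ k))"
      by (rule cls_mult_cong) (use r s c in auto)
    also have "\<dots> = cls (Suc k) ((a \<otimes> b) [^] (n ^ k))"
      using cls_pow_mult[OF assms(1) c(1) mult(2), of "n ^ k"] by simp
    finally show ?thesis using r s len_mult[of r s]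
      by (intro bexI[of _ "r \<otimes> s"]) (auto simp: algebra_simps)
  qed
  then show ?case by blast
next
  case (inv a)
  then obtain C where
    C: "\<And>n. \<exists>r\<in>carrier G. cls (Suc k) r = cls (Suc k) (a [^] (n ^ k)) \<and> len r \<le> C * n" by blast
  have c: "a \<in> carrier G" using lc_closed[OF inv(1)] .
  have "\<exists>r\<in>carrier G. cls (Suc k) r = cls (Suc k) ((inv a) [^] (n ^ k)) \<and> len r \<le> C * n" for n
  proof -
    obtain r where r: "r \<in> carrier G" "cls (Suc k) r = cls (Suc k) (a [^] (n ^ k))" "len r \<le> C * n"
      using C[of n] by blast
    have "cls (Suc k) (inv r) = cls (Suc k) (inv (a [^] (n ^ k)))"
      by (rule cls_inv_cong) (use r c in auto)
    then have "cls (Suc k) (inv r) = cls (Suc k) ((inv a) [^] (n ^ k))" using c by (simp add: nat_pow_inv)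
    then show ?thesis using r len_inv[of r] by (intro bexI[of _ "inv r"]) auto
  qed
  then show ?case by blast
qed

end

section \<open>Growth of Magnus coefficients\<close>

text \<open>\<open>P\<close> is a tensor given by its coefficients, and the linear form
  \<open>a\<close> is applied to its first slot. Iteration fills further slots from the
  left.\<close>

definition contract :: "nat \<Rightarrow> (nat \<Rightarrow> int) \<Rightarrow> (nat list \<Rightarrow> int) \<Rightarrow> nat list \<Rightarrow> int"
  where "contract m a P u = (\<Sum>i<m. a i * P (i # u))"

text \<open>The coefficients of the ring commutator of the letter \<open>p\<close> with
  \<open>P\<close>, in the form in which \<open>lead_comm\<close> yields them for
  \<open>x p\<close>.\<close>

definition lie :: "nat \<Rightarrow> (nat list \<Rightarrow> int) \<Rightarrow> nat list \<Rightarrow> int"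
  where "lie p P w = (if hd w = p then P (tl w) else 0) - (if last w = p then P (butlast w) else 0)"

lemma contract_pow_Suc:
  "(contract m a ^^ Suc j) P u = (\<Sum>i<m. a i * (contract m a ^^ j) P (i # u))"
  by (simp add: contract_def[of m a "(contract m a ^^ j) P"])

lemma contract_pow_cong:
  "(\<And>w. length w = n + j \<Longrightarrow> P w = Q w) \<Longrightarrow> length u = n \<Longrightarrow>
    (contract m a ^^ j) P u = (contract m a ^^ j) Q u"
proof (induction j arbitrary: n u)
  case (Suc j)
  have "(contract m a ^^ j) P (i # u) = (contract m a ^^ j) Q (i # u)" for i
    using Suc.prems by (intro Suc.IH[of "Suc n"]) auto
  then show ?case by (simp add: contract_pow_Suc del: funpow.simps)
qed simp

lemma contract_pow_zero:
  "(\<And>w. w \<in> words_of_length m (n + j) \<Longrightarrow> P w = 0) \<Longrightarrow> u \<in> words_of_length m n \<Longrightarrow>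
    (contract m a ^^ j) P u = 0"
proof (induction j arbitrary: n u)
  case (Suc j)
  have "(contract m a ^^ j) P (i # u) = 0" if "i < m" for i
    using Suc.prems that by (intro Suc.IH[of "Suc n"]) auto
  then show ?case by (simp add: contract_pow_Suc del: funpow.simps)
qed simp

text \<open>In the product with the letter \<open>p\<close> on the left, the first contraction
  consumes that letter and yields \<open>a p\<close>. In the product with \<open>p\<close> on the
  right, all contractions stay inside \<open>P\<close>, because \<open>u\<close> is nonempty and
  keeps the last slot.\<close>

lemma contract_pow_lie:
  assumes "p < m" "u \<noteq> []"
  shows "(contract m a ^^ Suc j) (lie p P) u = a p * (contract m a ^^ j) P u -
    (if last u = p then (contract m a ^^ Suc j) P (butlast u) else 0)"
  using assms(2)
proof (induction j arbitrary: u)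
  case 0
  have "a i * lie p P (i # u) = (if i = p then a p * P u else 0)
      - (if last u = p then a i * P (i # butlast u) else 0)" for i
    using 0 by (auto simp: lie_def algebra_simps)
  then show ?case using assms(1) by (simp add: contract_def sum_subtractf)
next
  case (Suc j)
  have "a i * (contract m a ^^ Suc j) (lie p P) (i # u) = a p * (a i * (contract m a ^^ j) P (i # u))
      - (if last u = p then a i * (contract m a ^^ Suc j) P (i # butlast u) else 0)" for i
    using Suc.prems by (subst Suc.IH) (auto simp: algebra_simps simp del: funpow.simps)
  then show ?case
    unfolding contract_pow_Suc[of "Suc j"] contract_pow_Suc[of j m a P u]
    by (simp add: sum_subtractf sum_distrib_left del: funpow.simps)
qed

text \<open>If the contraction vanished, contracting further would give
  \<open>a p * (contract m a ^^ j) P = 0\<close> for \<open>j\<close> from \<open>k\<close> down to \<open>0\<close>, hence \<open>P = 0\<close>.\<close>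

lemma lie_contract_nonzero:
  assumes p: "p < m" "a p \<noteq> 0" and P: "(contract m a ^^ k) P [] = 0"
    and v: "v \<in> words_of_length m k" "P v \<noteq> 0"
  shows "\<exists>u\<in>words_of_length m k. contract m a (lie p P) u \<noteq> 0"
proof (rule ccontr)
  assume "\<not> ?thesis"
  then have *: "\<And>u. u \<in> words_of_length m k \<Longrightarrow> contract m a (lie p P) u = 0" by blast
  have "\<forall>u\<in>words_of_length m (k - j). (contract m a ^^ j) P u = 0" if "j \<le> k" for j
    using that
  proof (induction rule: inc_induct)
    case base
    show ?case using P by simp
  next
    case (step j)
    show ?case
    proof
      fix u assume u: "u \<in> words_of_length m (k - j)"
      define n where "n = k - Suc j"
      have n: "k - j = Suc n" using step by (simp add: n_def)
      obtain w i where w: "u = w @ [i]" using u n by (cases u rule: rev_cases) (auto simp: words_of_length_def)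
      with u n have "w \<in> words_of_length m n" by simp
      then have 1: "(contract m a ^^ Suc j) P w = 0" using step.IH by (simp add: n_def)
      have "(contract m a ^^ j) (contract m a (lie p P)) u = 0"
        using * u step by (intro contract_pow_zero[of m "k - j"]) auto
      then have "(contract m a ^^ Suc j) (lie p P) u = 0" by (simp add: funpow_swap1)
      then have "a p * (contract m a ^^ j) P u = 0"
        using contract_pow_lie[OF p(1), of u j a P] w 1 by (simp del: funpow.simps split: if_splits)
      then show "(contract m a ^^ j) P u = 0" using p by simp
    qed
  qed
  from this[of 0] v show False by simp
qed

text \<open>Preserves the condition on the full contraction that \<open>lie_contract_nonzero\<close>
  asks for, so that bracketing with \<open>p\<close> can be repeated.\<close>

lemma contract_pow_lie_Nil:
  assumes "p < m" "0 < k" "(contract m a ^^ k) P [] = 0"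
  shows "(contract m a ^^ Suc k) (lie p P) [] = 0"
proof -
  obtain j where k: "k = Suc j" using assms by (cases k) auto
  have *: "a i * (contract m a ^^ k) (lie p P) [i] = a p * (a i * (contract m a ^^ j) P [i])" for i
    using contract_pow_lie[OF assms(1), of "[i]" j a P] assms(3) by (simp add: k del: funpow.simps)
  have "(\<Sum>i<m. a i * (contract m a ^^ k) (lie p P) [i]) = a p * (\<Sum>i<m. a i * (contract m a ^^ j) P [i])"
    by (simp only: sum_distrib_left *)
  also have "\<dots> = a p * (contract m a ^^ k) P []" by (simp add: k contract_pow_Suc del: funpow.simps)
  finally show ?thesis using assms(3) by (simp add: contract_pow_Suc[of k] del: funpow.simps)
qed

text \<open>The contracted letter comes either from \<open>g\<close>, and then \<open>f\<close>
  contributes its constant term, or from \<open>f\<close>.\<close>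

lemma contract_mult:
  "contract m a (coef (f * g)) u = coef f [] * contract m a (coef g) u +
    (\<Sum>j\<le>length u. contract m a (coef f) (take j u) * coef g (drop j u))"
proof -
  have "contract m a (coef (f * g)) u =
      (\<Sum>i<m. coef f [] * (a i * coef g (i # u)) +
        (\<Sum>j\<le>length u. a i * coef f (i # take j u) * coef g (drop j u)))"
    unfolding contract_def coef_mult_Cons
    by (simp add: coef_mult algebra_simps sum_distrib_left)
  also have "\<dots> = coef f [] * contract m a (coef g) u +
      (\<Sum>i<m. \<Sum>j\<le>length u. a i * coef f (i # take j u) * coef g (drop j u))"
    by (simp add: contract_def sum.distrib sum_distrib_left)
  also have "(\<Sum>i<m. \<Sum>j\<le>length u. a i * coef f (i # take j u) * coef g (drop j u))
      = (\<Sum>j\<le>length u. \<Sum>i<m. a i * coef f (i # take j u) * coef g (drop j u))"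
    by (rule sum.swap)
  finally show ?thesis by (simp add: contract_def sum_distrib_right)
qed

context magnus_rep
begin

text \<open>Commutators with \<open>x p\<close> stay in the normal subgroup. A nonzero coefficient
  and a vanishing full contraction are the invariants of the iteration; the nonzero simple
  contraction is produced by a bracketing step, hence the guard \<open>k < n\<close>.\<close>

lemma ex_deep_element:
  assumes K: "K \<lhd> G" and p: "p < m" "a p \<noteq> 0" and "0 < k" and h: "h \<in> K" "h \<in> \<Gamma> k"
    and v: "v \<in> W k" "coef (M h) v \<noteq> 0" and P: "(contract m a ^^ k) (coef (M h)) [] = 0"
    and "k \<le> n"
  shows "\<exists>z\<in>K. z \<in> \<Gamma> n \<and> (\<exists>v\<in>W n. coef (M z) v \<noteq> 0) \<and> (contract m a ^^ n) (coef (M z)) [] = 0 \<and>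
    (k < n \<longrightarrow> (\<exists>u\<in>W (n - 1). contract m a (coef (M z)) u \<noteq> 0))"
  using \<open>k \<le> n\<close>
proof (induction rule: dec_induct)
  case base
  then show ?case using h v P by blast
next
  case (step n)
  interpret K: normal K G by fact
  have n: "0 < n" using step \<open>0 < k\<close> by simp
  obtain z v where z: "z \<in> K" "z \<in> \<Gamma> n" "v \<in> W n" "coef (M z) v \<noteq> 0"
    "(contract m a ^^ n) (coef (M z)) [] = 0" using step.IH by blast
  have c: "z \<in> carrier G" using z lc_closed by blast
  define z' where "z' = comm (x p) z"
  have z': "z' \<in> \<Gamma> (Suc n)" using comm_lc_Suc[OF n _ z(2)] p by (simp add: z'_def)
  have "x p \<otimes> z \<otimes> inv (x p) \<otimes> inv z \<in> K" using z p K.inv_op_closed2[of "x p" z] by auto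
  then have zK: "z' \<in> K" by (simp add: z'_def gcomm_def)
  have lie: "coef (M z') w = lie p (coef (M z)) w" if "length w = Suc n" for w
  proof -
    have "coef (M z') w = coef (M (x p)) [hd w] * coef (M z) (tl w) - coef (M z) (butlast w) * coef (M (x p)) [last w]"
      unfolding z'_def using p c n that lc_low[OF n z(2)] by (intro lead_comm) auto
    then show ?thesis using p by (simp add: lie_def M_x)
  qed
  have "\<exists>u\<in>W n. contract m a (lie p (coef (M z))) u \<noteq> 0"
    using lie_contract_nonzero[of p m a n "coef (M z)" v] p z by blast
  then obtain u where u: "u \<in> W n" "contract m a (lie p (coef (M z))) u \<noteq> 0" by blast
  have ul: "length u = n" using u by (simp add: words_of_length_def)
  have "contract m a (coef (M z')) u = contract m a (lie p (coef (M z))) u"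
    using contract_pow_cong[of n 1 "coef (M z')" "lie p (coef (M z))" u m a] lie ul by simp
  with u have u': "contract m a (coef (M z')) u \<noteq> 0" by simp
  then obtain i where "i < m" "coef (M z') (i # u) \<noteq> 0"
    unfolding contract_def by (metis (no_types, lifting) lessThan_iff mult_zero_right sum.neutral)
  then have "\<exists>v\<in>W (Suc n). coef (M z') v \<noteq> 0" using u by (intro bexI[of _ "i # u"]) auto
  moreover have "(contract m a ^^ Suc n) (coef (M z')) [] = (contract m a ^^ Suc n) (lie p (coef (M z))) []"
    using lie by (intro contract_pow_cong[of 0]) auto
  then have "(contract m a ^^ Suc n) (coef (M z')) [] = 0"
    using contract_pow_lie_Nil[OF p(1) n z(5)] by simp
  ultimately show ?case using zK z' u u' by auto
qed

abbreviation pr :: "'a list \<Rightarrow> 'a"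
  where "pr ss \<equiv> foldr (\<otimes>) ss \<one>"

text \<open>Discrete integration: prepending a generator changes \<open>\<phi>\<close> by terms of
  order less than \<open>length w\<close> in the number of factors, so \<open>\<phi>\<close> has
  order at most \<open>length w\<close>. The abstract \<open>\<phi>\<close> and \<open>F\<close>
  cover plain and contracted coefficients alike.\<close>

lemma growth:
  fixes \<phi> :: "'a list \<Rightarrow> int" and F :: "'a \<Rightarrow> nat \<Rightarrow> int"
  assumes S: "finite S" "w \<noteq> []"
    and C: "\<And>j. 1 \<le> j \<Longrightarrow> j \<le> length w \<Longrightarrow> \<exists>C\<ge>0. \<forall>ss. set ss \<subseteq> S \<longrightarrow>
      \<bar>coef (M (pr ss)) (drop j w)\<bar> \<le> C * int (Suc (length ss)) ^ length (drop j w)"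
    and \<phi>: "\<phi> [] = 0" "\<And>s ss. s \<in> S \<Longrightarrow> set ss \<subseteq> S \<Longrightarrow>
      \<phi> (s # ss) = \<phi> ss + (\<Sum>j\<in>{1..length w}. F s j * coef (M (pr ss)) (drop j w))"
  shows "\<exists>C\<ge>0. \<forall>ss. set ss \<subseteq> S \<longrightarrow> \<bar>\<phi> ss\<bar> \<le> C * int (Suc (length ss)) ^ length w"
proof -
  obtain L where L: "length w = Suc L" using S by (cases w) auto
  have "\<exists>C. \<forall>j\<in>{1..length w}. C j \<ge> 0 \<and> (\<forall>ss. set ss \<subseteq> S \<longrightarrow>
      \<bar>coef (M (pr ss)) (drop j w)\<bar> \<le> C j * int (Suc (length ss)) ^ length (drop j w))"
    by (rule bchoice) (use C in auto)
  then obtain C where C: "\<And>j. j \<in> {1..length w} \<Longrightarrow> C j \<ge> 0"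
    "\<And>j ss. j \<in> {1..length w} \<Longrightarrow> set ss \<subseteq> S \<Longrightarrow>
      \<bar>coef (M (pr ss)) (drop j w)\<bar> \<le> C j * int (Suc (length ss)) ^ length (drop j w)" by blast
  define D where "D = (\<Sum>j\<in>{1..length w}. (\<Sum>s\<in>S. \<bar>F s j\<bar>) * C j)"
  have D: "D \<ge> 0" unfolding D_def using C by (intro sum_nonneg mult_nonneg_nonneg) auto
  have "\<bar>\<phi> ss\<bar> \<le> D * int (Suc (length ss)) ^ Suc L" if "set ss \<subseteq> S" for ss
    using that
  proof (induction ss)
    case Nil
    then show ?case using D \<phi> by simp
  next
    case (Cons s ss)
    let ?n = "int (Suc (length ss))"
    have "\<bar>\<Sum>j\<in>{1..length w}. F s j * coef (M (pr ss)) (drop j w)\<bar>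
        \<le> (\<Sum>j\<in>{1..length w}. \<bar>F s j * coef (M (pr ss)) (drop j w)\<bar>)" by (rule sum_abs)
    also have "\<dots> \<le> (\<Sum>j\<in>{1..length w}. ((\<Sum>s\<in>S. \<bar>F s j\<bar>) * C j) * ?n ^ L)"
    proof (rule sum_mono)
      fix j assume j: "j \<in> {1..length w}"
      have 1: "\<bar>F s j\<bar> \<le> (\<Sum>s\<in>S. \<bar>F s j\<bar>)" using S Cons.prems by (intro member_le_sum) auto
      have "\<bar>coef (M (pr ss)) (drop j w)\<bar> \<le> C j * ?n ^ length (drop j w)"
        using C(2)[OF j] Cons.prems by simp
      moreover have "C j * ?n ^ length (drop j w) \<le> C j * ?n ^ L"
        using C(1)[OF j] j L by (intro mult_left_mono power_increasing) auto
      ultimately have 2: "\<bar>coef (M (pr ss)) (drop j w)\<bar> \<le> C j * ?n ^ L" by (rule order_trans)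
      show "\<bar>F s j * coef (M (pr ss)) (drop j w)\<bar> \<le> ((\<Sum>s\<in>S. \<bar>F s j\<bar>) * C j) * ?n ^ L"
        unfolding abs_mult mult.assoc using 1 2 by (intro mult_mono) (auto intro: sum_nonneg)
    qed
    also have "\<dots> = D * ?n ^ L" by (simp add: D_def sum_distrib_right)
    \<comment> \<open>The induction closes with the same \<open>D\<close> because
      \<open>?n ^ Suc L + ?n ^ L\<close> is at most \<open>(?n + 1) ^ Suc L\<close>.\<close>
    finally have "\<bar>\<phi> (s # ss)\<bar> \<le> D * ?n ^ Suc L + D * ?n ^ L"
      using \<phi>(2)[of s ss] Cons by simp
    also have "\<dots> = D * ((?n + 1) * ?n ^ L)" by (simp add: algebra_simps)
    also have "\<dots> \<le> D * ((?n + 1) * (?n + 1) ^ L)"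
      using D by (intro mult_left_mono power_mono) auto
    finally show ?case by (simp add: algebra_simps)
  qed
  then show ?thesis using D L by auto
qed

lemma prod_bound:
  assumes S: "finite S" "S \<subseteq> carrier G"
  shows "\<exists>C\<ge>0. \<forall>ss. set ss \<subseteq> S \<longrightarrow> \<bar>coef (M (pr ss)) w\<bar> \<le> C * int (Suc (length ss)) ^ length w"
proof (induction w rule: length_induct)
  case (1 w)
  show ?case
  proof (cases "w = []")
    case True
    have "pr ss \<in> carrier G" if "set ss \<subseteq> S" for ss using that S foldr_mult_closed by blast
    then show ?thesis using True by (intro exI[of _ 1]) auto
  next
    case False
    show ?thesis
    proof (rule growth[OF S(1) False])
      fix j assume "1 \<le> j" "j \<le> length w"
      then have "length (drop j w) < length w" using False by simp
      with 1 show "\<exists>C\<ge>0. \<forall>ss. set ss \<subseteq> S \<longrightarrow>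
          \<bar>coef (M (pr ss)) (drop j w)\<bar> \<le> C * int (Suc (length ss)) ^ length (drop j w)"
        by blast
    next
      show "coef (M (pr [])) w = 0" using False by simp
    next
      fix s ss assume s: "s \<in> S" "set ss \<subseteq> S"
      then have c: "s \<in> carrier G" "pr ss \<in> carrier G" using S foldr_mult_closed by blast+
      have "{..length w} = insert 0 {1..length w}" by auto
      then show "coef (M (pr (s # ss))) w = coef (M (pr ss)) w +
          (\<Sum>j\<in>{1..length w}. coef (M s) (take j w) * coef (M (pr ss)) (drop j w))"
        using c by (simp add: M_mult coef_mult)
    qed
  qed
qed

text \<open>The gain from contracting: the summand \<open>j = 0\<close> of
  \<open>contract_mult\<close>, where a generator supplies the contracted letter and nothing else,
  vanishes by the hypothesis on \<open>S\<close>. Words of length \<open>length u + 1\<close> thus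
  grow with degree \<open>length u\<close> only.\<close>

lemma contract_prod_bound:
  assumes S: "finite S" "S \<subseteq> carrier G" and a: "\<And>s. s \<in> S \<Longrightarrow> contract m a (coef (M s)) [] = 0"
  shows "\<exists>C\<ge>0. \<forall>ss. set ss \<subseteq> S \<longrightarrow>
    \<bar>contract m a (coef (M (pr ss))) u\<bar> \<le> C * int (Suc (length ss)) ^ length u"
proof -
  have one: "contract m a (coef (M (pr []))) u = 0" by (simp add: contract_def)
  have step: "contract m a (coef (M (pr (s # ss)))) u = contract m a (coef (M (pr ss))) u +
      (\<Sum>j\<in>{1..length u}. contract m a (coef (M s)) (take j u) * coef (M (pr ss)) (drop j u))"
    if s: "s \<in> S" "set ss \<subseteq> S" for s ss
  proof -
    have c: "s \<in> carrier G" "pr ss \<in> carrier G" using s S foldr_mult_closed by blast+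
    have "{..length u} = insert 0 {1..length u}" by auto
    then show ?thesis using c a[OF s(1)] by (simp add: M_mult contract_mult)
  qed
  show ?thesis
  proof (cases "u = []")
    case True
    have "contract m a (coef (M (pr ss))) u = 0" if "set ss \<subseteq> S" for ss
      using that
    proof (induction ss)
      case (Cons s ss)
      then show ?case using step[of s ss] True by simp
    qed (use one in simp)
    then show ?thesis by (intro exI[of _ 0]) auto
  next
    case False
    show ?thesis
      by (rule growth[where F = "\<lambda>s j. contract m a (coef (M s)) (take j u)", OF S(1) False])
        (rule prod_bound[OF S] one step; assumption)+
  qed
qed

end

section \<open>Distortion in the nilpotent quotient\<close>

lemma power_not_le_lower_power:
  fixes A B D c :: nat
  assumes "0 < c"
  shows "\<exists>n. \<not> n ^ c \<le> A * (B * n + D) ^ (c - 1)"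
proof (rule exI, rule notI)
  define n where "n = Suc (A * (B + D) ^ (c - 1))"
  obtain k where k: "c = Suc k" using assms by (cases c) auto
  assume "n ^ c \<le> A * (B * n + D) ^ (c - 1)"
  also have "\<dots> \<le> A * ((B + D) * n) ^ (c - 1)"
    by (intro mult_le_mono2 power_mono) (auto simp: n_def algebra_simps)
  also have "\<dots> = (A * (B + D) ^ k) * n ^ k" by (simp add: k power_mult_distrib)
  finally have "n * n ^ k \<le> (A * (B + D) ^ k) * n ^ k" by (simp add: k)
  moreover have "0 < n ^ k" by (simp add: n_def)
  ultimately have "n \<le> A * (B + D) ^ k" by (simp only: mult_le_cancel2)
  then show False by (simp add: n_def k)
qed

section \<open>Schreier generators of a subgroup of finite index\<close>

context group
begin

text \<open>A word is rewritten from the right: a representative \<open>b\<close> passes the letter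
  \<open>a\<close> and becomes \<open>b'\<close>, at the cost of the generator
  \<open>inv b' \<otimes> a \<otimes> b\<close>. The representatives are chosen by
  \<open>SOME\<close> and may omit the identity, so those in \<open>H\<close> are added to
  \<open>S\<close>; one of them starts the rewriting and one ends it, which makes the
  \<open>+ 2\<close>.\<close>

lemma finite_index_length:
  assumes T: "fin_generates G T (carrier G)" and H: "H \<lhd> G" and fin: "finite (rcosets H)"
  shows "\<exists>S. fin_generates G S H \<and> (\<forall>h\<in>H. word_length G S h \<le> word_length G T h + 2)"
proof -
  interpret H: normal H G by fact
  have T': "finite T" "T \<subseteq> carrier G" "generate G T = carrier G" using T by (auto simp: fin_generates_def)
  define B where "B = (\<lambda>C. SOME g. g \<in> C) ` (rcosets H)"
  have B: "finite B" using fin by (simp add: B_def)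
  have some: "(SOME g. g \<in> C) \<in> C" if "C \<in> rcosets H" for C
    using H.rcosets_non_empty[OF that] by (simp add: some_in_eq)
  have BG: "B \<subseteq> carrier G"
    using some H.rcosets_carrier[OF is_group] by (auto simp: B_def)
  have rep: "\<exists>b\<in>B. inv b \<otimes> g \<in> H" if g: "g \<in> carrier G" for g
  proof -
    define b where "b = (SOME g'. g' \<in> H #> g)"
    have C: "H #> g \<in> rcosets H" using g H.subset by (rule rcosetsI[rotated])
    have b: "b \<in> H #> g" "b \<in> B" using some[OF C] C by (auto simp: b_def B_def)
    have bc: "b \<in> carrier G" using b BG by blast
    have "b \<otimes> inv g \<in> H" using H.rcos_module[OF is_group g bc] b by simp
    then have "inv (b \<otimes> inv g) \<in> H" by simp
    then have "inv b \<otimes> inv (b \<otimes> inv g) \<otimes> b \<in> H" using bc by (intro H.inv_op_closed1)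
    then have "inv b \<otimes> g \<in> H" using bc g by (simp add: inv_mult_group m_assoc)
    then show ?thesis using b by blast
  qed
  define A where "A = T \<union> m_inv G ` T"
  have A: "finite A" "A \<subseteq> carrier G" using T' by (auto simp: A_def)
  define S where "S = ((\<lambda>(b', a, b). inv b' \<otimes> a \<otimes> b) ` (B \<times> A \<times> B) \<union> B) \<inter> H"
  have S: "finite S" "S \<subseteq> H" using A B by (auto simp: S_def)
  have SG: "S \<subseteq> carrier G" using S H.subset by blast
  let ?S = "S \<union> m_inv G ` S"
  have words: "\<exists>b\<in>B. \<exists>ss. set ss \<subseteq> ?S \<and> length ss = Suc (length ts) \<and>
      foldr (\<otimes>) ts \<one> = b \<otimes> foldr (\<otimes>) ss \<one>" if "set ts \<subseteq> A" for ts
    using that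
  proof (induction ts)
    case Nil
    obtain b where b: "b \<in> B" "inv b \<otimes> \<one> \<in> H" using rep[of \<one>] by blast
    have bc: "b \<in> carrier G" using b BG by blast
    then have "inv (inv b) \<in> H" using b H.m_inv_closed[of "inv b"] by simp
    then have "b \<in> S" using b bc by (simp add: S_def)
    then show ?case using b bc by (intro bexI[of _ b] exI[of _ "[inv b]"]) auto
  next
    case (Cons t ts)
    then obtain b ss where b: "b \<in> B" "set ss \<subseteq> ?S" "length ss = Suc (length ts)"
      "foldr (\<otimes>) ts \<one> = b \<otimes> foldr (\<otimes>) ss \<one>" by auto
    have t: "t \<in> A" "t \<in> carrier G" "b \<in> carrier G" using Cons.prems A b BG by auto
    obtain b' where b': "b' \<in> B" "inv b' \<otimes> (t \<otimes> b) \<in> H" using rep[of "t \<otimes> b"] t by blast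
    have b'c: "b' \<in> carrier G" using b' BG by blast
    let ?s = "inv b' \<otimes> t \<otimes> b"
    have "?s \<in> (\<lambda>(b', a, b). inv b' \<otimes> a \<otimes> b) ` (B \<times> A \<times> B)"
      by (rule image_eqI[of _ _ "(b', t, b)"]) (use b b' t in auto)
    then have s: "?s \<in> S" using b' b'c t by (simp add: S_def m_assoc)
    have ssc: "foldr (\<otimes>) ss \<one> \<in> carrier G"
      using b(2) letters_carrier[OF SG] by (intro foldr_mult_closed) auto
    have "foldr (\<otimes>) (t # ts) \<one> = b' \<otimes> foldr (\<otimes>) (?s # ss) \<one>"
      using b(4) t b'c ssc by (simp add: m_assoc)
    then show ?case using b' b s by (intro bexI[of _ b'] exI[of _ "?s # ss"]) auto
  qed
  have H_words: "\<exists>ss. set ss \<subseteq> ?S \<and> length ss = length ts + 2 \<and> foldr (\<otimes>) ss \<one> = foldr (\<otimes>) ts \<one>"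
    if ts: "set ts \<subseteq> A" "foldr (\<otimes>) ts \<one> \<in> H" for ts
  proof -
    obtain b ss where b: "b \<in> B" "set ss \<subseteq> ?S" "length ss = Suc (length ts)"
      "foldr (\<otimes>) ts \<one> = b \<otimes> foldr (\<otimes>) ss \<one>" using words[OF ts(1)] by blast
    have bc: "b \<in> carrier G" using b BG by blast
    have "foldr (\<otimes>) ss \<one> \<in> generate G S" using word_generate[OF SG b(2)] .
    then have ssH: "foldr (\<otimes>) ss \<one> \<in> H"
      using generate_subgroup_incl[OF S(2) H.subgroup_axioms] by blast
    have "b \<otimes> foldr (\<otimes>) ss \<one> \<otimes> inv (foldr (\<otimes>) ss \<one>) \<in> H" using ts b ssH by auto
    then have "b \<in> H" using bc ssH H.subset by (simp add: m_assoc subsetD)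
    then have "b \<in> S" using b by (simp add: S_def)
    then show ?thesis using b by (intro exI[of _ "b # ss"]) auto
  qed
  have T_word: "\<exists>ts. set ts \<subseteq> A \<and> length ts = word_length G T h \<and> foldr (\<otimes>) ts \<one> = h" if "h \<in> H" for h
  proof -
    have "h \<in> generate G T" using T' H.subset that by auto
    then show ?thesis using word_length_obtain[OF T'(2)] unfolding A_def by metis
  qed
  have *: "\<exists>ss. set ss \<subseteq> ?S \<and> length ss = word_length G T h + 2 \<and> foldr (\<otimes>) ss \<one> = h" if "h \<in> H" for h
    using T_word[OF that] H_words that by metis
  have "generate G S = H"
  proof
    show "generate G S \<subseteq> H" by (rule generate_subgroup_incl[OF S(2) H.subgroup_axioms])
    show "H \<subseteq> generate G S"
    proof
      fix h assume "h \<in> H"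
      from *[OF this] obtain ss where "set ss \<subseteq> ?S" "foldr (\<otimes>) ss \<one> = h" by blast
      then show "h \<in> generate G S" using word_generate[OF SG] by blast
    qed
  qed
  moreover have "word_length G S h \<le> word_length G T h + 2" if "h \<in> H" for h
    using *[OF that] word_length_le by metis
  ultimately show ?thesis using S SG by (intro exI[of _ S]) (auto simp: fin_generates_def)
qed

end

locale magnus_quotient = magnus_rep +
  fixes c :: nat and H :: "'a set set"
  assumes c: "2 \<le> c" and H_normal: "H \<lhd> G Mod lower_central G (Suc c)"
begin

abbreviation "F \<equiv> G Mod \<Gamma> (Suc c)"
abbreviation "\<pi> \<equiv> cls (Suc c)"

declare mult_FactGroup [simp del] one_FactGroup [simp del]

sublocale F: group F
  by (rule normal.factorgroup_is_group[OF normal_lower_central])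

sublocale pi: group_hom G F \<pi>
  by unfold_locales (rule normal.r_coset_hom_Mod[OF normal_lower_central])

sublocale H: normal H F
  by (rule H_normal)

text \<open>The full preimage of \<open>H\<close>: subgroup arguments take place in
  \<open>G\<close>, where \<open>M\<close> is defined, and the quotient is left for word
  lengths.\<close>

definition "K = {r \<in> carrier G. \<pi> r \<in> H}"

lemma K_normal: "K \<lhd> G"
proof (rule normal_invI)
  show "subgroup K G"
    by (rule subgroupI) (auto simp: K_def intro!: exI[of _ \<one>])
  show "g \<otimes> h \<otimes> inv g \<in> K" if "g \<in> carrier G" "h \<in> K" for g h
    using that by (auto simp: K_def H.inv_op_closed2)
qed

lemma K_nat_pow: "h \<in> K \<Longrightarrow> h [^] (n :: nat) \<in> K"
  using subgroup.m_closed[OF normal_imp_subgroup[OF K_normal]]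
    subgroup.one_closed[OF normal_imp_subgroup[OF K_normal]]
  by (induction n) auto

lemma carrier_F: "carrier F = \<pi> ` carrier G"
  by (rule carrier_FactGroup)

lemma H_lift: "h \<in> H \<Longrightarrow> \<exists>r\<in>K. \<pi> r = h"
  using H.subset unfolding carrier_F K_def by blast

abbreviation "T \<equiv> \<pi> ` x ` {..<m}"

lemma T_generates: "fin_generates F T (carrier F)"
proof -
  have "generate F T = \<pi> ` generate G (x ` {..<m})" by (rule pi.generate_img[OF gens_closed])
  then show ?thesis using gens_closed by (auto simp: fin_generates_def x_gen carrier_F)
qed

lemma pi_foldr: "set ws \<subseteq> carrier G \<Longrightarrow> foldr (\<otimes>\<^bsub>F\<^esub>) (map \<pi> ws) \<one>\<^bsub>F\<^esub> = \<pi> (foldr (\<otimes>) ws \<one>)"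
proof (induction ws)
  case (Cons w ws)
  then have "foldr (\<otimes>) ws \<one> \<in> carrier G" by (intro foldr_mult_closed) auto
  then show ?case using Cons pi.hom_mult[of w "foldr (\<otimes>) ws \<one>"] by simp
qed simp

lemma length_pi_le:
  assumes "r \<in> carrier G"
  shows "word_length F T (\<pi> r) \<le> len r"
proof -
  obtain ws where ws: "length ws = len r" "set ws \<subseteq> x ` {..<m} \<union> m_inv G ` x ` {..<m}"
    "foldr (\<otimes>) ws \<one> = r" using word_length_obtain[OF gens_closed] x_gen assms by metis
  have wc: "set ws \<subseteq> carrier G" using ws letters_carrier[OF gens_closed] by blast
  have "\<pi> w \<in> T \<union> m_inv F ` T" if "w \<in> set ws" for w
  proof -
    from that ws consider i where "i < m" "w = x i" | i where "i < m" "w = inv (x i)" by blast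
    then show ?thesis
    proof cases
      case 2
      then have "\<pi> w = inv\<^bsub>F\<^esub> (\<pi> (x i))" by simp
      then show ?thesis using 2 by blast
    qed auto
  qed
  then have "set (map \<pi> ws) \<subseteq> T \<union> m_inv F ` T" by auto
  moreover have "foldr (\<otimes>\<^bsub>F\<^esub>) (map \<pi> ws) \<one>\<^bsub>F\<^esub> = \<pi> r" using pi_foldr[OF wc] ws by simp
  ultimately have "word_length F T (\<pi> r) \<le> length (map \<pi> ws)" by (rule F.word_length_le)
  then show ?thesis using ws by simp
qed

text \<open>Shortest words of \<open>H\<close> lift letter by letter, inverse letters included, to
  products over one finite subset of \<open>K\<close>; the growth bounds apply to these
  products.\<close>

lemma lift_words:
  assumes S: "fin_generates F S H"
  shows "\<exists>S'. finite S' \<and> S' \<subseteq> K \<and>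
    (\<forall>h\<in>H. \<exists>ss. set ss \<subseteq> S' \<and> length ss = word_length F S h \<and> \<pi> (pr ss) = h)"
proof -
  have S': "finite S" "S \<subseteq> carrier F" "generate F S = H" using S by (auto simp: fin_generates_def)
  define A where "A = S \<union> m_inv F ` S"
  have "S \<subseteq> H" using S' generate.incl[of _ S F] by auto
  then have A: "finite A" "A \<subseteq> H" using S'(1) H.m_inv_closed by (auto simp: A_def)
  have "\<exists>l. \<forall>h\<in>H. l h \<in> K \<and> \<pi> (l h) = h" using H_lift by (intro bchoice) blast
  then obtain l where l: "\<And>h. h \<in> H \<Longrightarrow> l h \<in> K" "\<And>h. h \<in> H \<Longrightarrow> \<pi> (l h) = h" by blast
  have lA: "l ` A \<subseteq> K" using l A by blast
  have "\<exists>ss. set ss \<subseteq> l ` A \<and> length ss = word_length F S h \<and> \<pi> (pr ss) = h" if h: "h \<in> H" for h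
  proof -
    have "h \<in> generate F S" using h S' by simp
    then obtain ws where ws: "length ws = word_length F S h" "set ws \<subseteq> A"
      "foldr (\<otimes>\<^bsub>F\<^esub>) ws \<one>\<^bsub>F\<^esub> = h" using F.word_length_obtain[OF S'(2)] unfolding A_def by metis
    have "map \<pi> (map l ws) = ws" using ws A l by (auto intro!: map_idI)
    moreover have "set (map l ws) \<subseteq> carrier G" using ws lA by (auto simp: K_def)
    ultimately have "\<pi> (pr (map l ws)) = h" using pi_foldr[of "map l ws"] ws by simp
    then show ?thesis using ws by (intro exI[of _ "map l ws"]) auto
  qed
  then show ?thesis using A lA by (intro exI[of _ "l ` A"]) auto
qed

text \<open>As \<open>k \<le> c\<close>, congruence modulo \<open>\<Gamma> (Suc c)\<close> implies
  congruence modulo \<open>\<Gamma> (Suc k)\<close>; so leading coefficients can be read off in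
  \<open>F\<close>.\<close>

lemma coef_cong:
  assumes "\<pi> r = \<pi> s" "r \<in> carrier G" "s \<in> \<Gamma> k" "0 < k" "k \<le> c" "length w = k"
  shows "coef (M r) w = coef (M s) w"
proof -
  have sc: "s \<in> carrier G" using assms lc_closed by blast
  obtain t where t: "t \<in> \<Gamma> (Suc c)" "r = t \<otimes> s" using cls_eqE[OF assms(1,2) sc] .
  have "t \<in> \<Gamma> k" by (rule lc_mono_mem[OF t(1)]) (use assms in simp)
  then have "r \<in> \<Gamma> k" using t assms by simp
  moreover have "cls (Suc k) r = cls (Suc k) s"
    by (rule cls_mono[OF assms(1)]) (use assms sc in auto)
  ultimately show ?thesis using lead_cong assms by blast
qed

lemma not_undistorted:
  assumes S: "fin_generates F S H" and a: "\<And>h. h \<in> K \<Longrightarrow> contract m a (coef (M h)) [] = 0"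
    and z: "z \<in> K" "z \<in> \<Gamma> c" and u: "length u = c - 1" "contract m a (coef (M z)) u \<noteq> 0"
  shows "\<not> undistorted F H"
proof
  assume "undistorted F H"
  then have "asymp_le (distortion F T H S) (\<lambda>n. n)"
    using F.undistorted_iff[OF T_generates S] by (simp add: asymp_equiv_def)
  then obtain C where C: "\<And>n. distortion F T H S n \<le> C * (C * n + C)"
    unfolding asymp_le_def by blast
  obtain D where D: "\<And>n. \<exists>r\<in>carrier G. cls (Suc c) r = cls (Suc c) (z [^] (n ^ c)) \<and> len r \<le> D * n"
    using lc_pow_len[OF _ z(2)] c by auto
  obtain S' where S': "finite S'" "S' \<subseteq> K"
    "\<And>h. h \<in> H \<Longrightarrow> \<exists>ss. set ss \<subseteq> S' \<and> length ss = word_length F S h \<and> \<pi> (pr ss) = h"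
    using lift_words[OF S] by blast
  have S'c: "S' \<subseteq> carrier G" using S' by (auto simp: K_def)
  obtain E where E: "E \<ge> 0" "\<And>ss. set ss \<subseteq> S' \<Longrightarrow>
    \<bar>contract m a (coef (M (pr ss))) u\<bar> \<le> E * int (Suc (length ss)) ^ length u"
    using contract_prod_bound[OF S'(1) S'c, of a u] a S' by blast
  have zc: "z \<in> carrier G" using z lc_closed by blast
  \<comment> \<open>\<open>C\<close> comes from the assumed linear distortion, inside and outside
    the argument; \<open>D\<close> bounds the length of the power of \<open>z\<close> in
    \<open>F\<close>; \<open>E\<close> comes from \<open>contract_prod_bound\<close>, whose
    \<open>Suc\<close> accounts for the final \<open>+ 1\<close>.\<close>
  have "n ^ c \<le> nat E * (C * C * D * n + (C * C + 1)) ^ (c - 1)" for n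
  proof -
    let ?h = "\<pi> (z [^] (n ^ c))"
    have hH: "?h \<in> H" using K_nat_pow[OF z(1)] by (simp add: K_def)
    obtain r where r: "r \<in> carrier G" "\<pi> r = ?h" "len r \<le> D * n" using D by blast
    have "word_length F T ?h \<le> D * n" using length_pi_le[OF r(1)] r by simp
    then have "word_length F S ?h \<le> distortion F T H S (D * n)"
      by (intro F.distortion_ge T_generates hH H.subset)
    also have "\<dots> \<le> C * (C * (D * n) + C)" by (rule C)
    finally have len: "word_length F S ?h \<le> C * C * D * n + C * C" by (simp add: algebra_simps)
    obtain ss where ss: "set ss \<subseteq> S'" "length ss = word_length F S ?h" "\<pi> (pr ss) = ?h"
      using S'(3)[OF hH] by blast
    have prc: "pr ss \<in> carrier G" using ss S'c by (intro foldr_mult_closed) auto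
    have "coef (M (pr ss)) (i # u) = int (n ^ c) * coef (M z) (i # u)" for i
    proof -
      have len: "length (i # u) = c" using u c by simp
      have "coef (M (pr ss)) (i # u) = coef (M (z [^] (n ^ c))) (i # u)"
        by (rule coef_cong[of _ _ c]) (use ss prc z c len in auto)
      also have "\<dots> = int (n ^ c) * coef (M z) (i # u)"
        using lead_pow[OF zc lc_low[OF _ z(2)] len] c by simp
      finally show ?thesis .
    qed
    then have "contract m a (coef (M (pr ss))) u = int (n ^ c) * contract m a (coef (M z)) u"
      by (simp add: contract_def sum_distrib_left algebra_simps)
    then have "int (n ^ c) * \<bar>contract m a (coef (M z)) u\<bar> \<le> E * int (Suc (length ss)) ^ length u"
      using E(2)[OF ss(1)] by (simp add: abs_mult)
    moreover have "int (n ^ c) * 1 \<le> int (n ^ c) * \<bar>contract m a (coef (M z)) u\<bar>"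
      using u by (intro mult_left_mono) auto
    moreover have le: "Suc (length ss) \<le> C * C * D * n + (C * C + 1)" using len ss by simp
    ultimately have "int (n ^ c) \<le> E * int (Suc (length ss)) ^ length u" by linarith
    moreover have "E * int (Suc (length ss)) ^ length u \<le> E * int (C * C * D * n + (C * C + 1)) ^ (c - 1)"
      unfolding u(1) using E(1) by (intro mult_left_mono power_mono of_nat_mono le) auto
    moreover have "\<dots> = int (nat E * (C * C * D * n + (C * C + 1)) ^ (c - 1))" using E(1) by simp
    ultimately have "int (n ^ c) \<le> int (nat E * (C * C * D * n + (C * C + 1)) ^ (c - 1))" by linarith
    then show ?thesis by (simp only: of_nat_le_iff)
  qed
  then show False using power_not_le_lower_power[of c "nat E" "C * C * D" "C * C + 1"] c by auto
qed

text \<open>The lower half of the equivalence makes the distortion function unbounded, while lengths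
  on a finite subgroup are bounded.\<close>

lemma infinite_if_undistorted:
  assumes "undistorted F H"
  shows "infinite H"
proof
  assume fin: "finite H"
  obtain T0 S where *: "fin_generates F T0 (carrier F)" "fin_generates F S H"
    "asymp_equiv (distortion F T0 H S) (\<lambda>n. n)" using assms unfolding undistorted_def by blast
  then obtain C where C: "\<And>n. n \<le> C * distortion F T0 H S (C * n + C)"
    unfolding asymp_equiv_def asymp_le_def by blast
  have "distortion F T0 H S n \<le> Max (word_length F S ` H)" for n
    by (rule F.distortion_le[OF *(1) H.subgroup_axioms]) (use fin in auto)
  then have "n \<le> C * Max (word_length F S ` H)" for n
    using C[of n] mult_le_mono2 order_trans by blast
  then show False using not_less_eq_eq by blast
qed

lemma finite_rcosets:
  assumes d: "0 < (d :: nat)" and x: "\<And>i. i < m \<Longrightarrow> \<exists>h\<in>K. cls 2 h = cls 2 (x i [^] d)"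
  shows "finite (rcosets\<^bsub>F\<^esub> H)"
proof -
  obtain B where B: "finite B" "B \<subseteq> carrier G"
    "\<forall>g\<in>carrier G. \<exists>b\<in>B. \<exists>h\<in>K. \<exists>t\<in>\<Gamma> (Suc c). g = b \<otimes> h \<otimes> t"
  proof -
    have "\<exists>B. finite B \<and> B \<subseteq> carrier G \<and>
        (\<forall>g\<in>carrier G. \<exists>b\<in>B. \<exists>h\<in>K. \<exists>t\<in>\<Gamma> (Suc c). g = b \<otimes> h \<otimes> t)"
      by (rule finite_index_of_powers[OF K_normal d]) (use x in auto)
    then show ?thesis using that by (elim exE conjE)
  qed
  have "H #>\<^bsub>F\<^esub> f \<in> (\<lambda>b. H #>\<^bsub>F\<^esub> \<pi> b) ` B" if f: "f \<in> carrier F" for f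
  proof -
    obtain g where g: "g \<in> carrier G" "f = \<pi> g" using f carrier_F by blast
    obtain b h t where b: "b \<in> B" "h \<in> K" "t \<in> \<Gamma> (Suc c)" "g = b \<otimes> h \<otimes> t"
      using bspec[OF B(3) g(1)] by (elim bexE)
    have bc: "b \<in> carrier G" "h \<in> carrier G" "\<pi> h \<in> H" using b B by (auto simp: K_def)
    have "f = \<pi> (b \<otimes> h)" unfolding g(2) b(4) using b(3) bc by (intro cls_absorb_right) auto
    then have "f = (\<pi> b \<otimes>\<^bsub>F\<^esub> \<pi> h \<otimes>\<^bsub>F\<^esub> inv\<^bsub>F\<^esub> \<pi> b) \<otimes>\<^bsub>F\<^esub> \<pi> b"
      using bc by (simp add: F.m_assoc)
    moreover have "\<pi> b \<otimes>\<^bsub>F\<^esub> \<pi> h \<otimes>\<^bsub>F\<^esub> inv\<^bsub>F\<^esub> \<pi> b \<in> H"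
      using bc by (intro H.inv_op_closed2) auto
    ultimately have "f \<in> H #>\<^bsub>F\<^esub> \<pi> b" unfolding r_coset_def by blast
    then have "H #>\<^bsub>F\<^esub> \<pi> b = H #>\<^bsub>F\<^esub> f"
      using F.repr_independence[of f H "\<pi> b"] H.subgroup_axioms bc by simp
    then show ?thesis using b by blast
  qed
  then have "rcosets\<^bsub>F\<^esub> H \<subseteq> (\<lambda>b. H #>\<^bsub>F\<^esub> \<pi> b) ` B" unfolding RCOSETS_def by blast
  then show ?thesis using B finite_subset by blast
qed

lemma contract_pow_unit:
  "p < m \<Longrightarrow> (contract m (\<lambda>i. if i = p then 1 else 0) ^^ j) P u = P (replicate j p @ u)"
proof (induction j arbitrary: u)
  case (Suc j)
  have "(contract m (\<lambda>i. if i = p then 1 else 0) ^^ Suc j) P u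
      = (\<Sum>i<m. if i = p then P (replicate j p @ p # u) else 0)"
    unfolding contract_pow_Suc using Suc by (intro sum.cong) auto
  then show ?case using Suc.prems by (simp add: replicate_app_Cons_same)
qed simp

text \<open>At a constant word the two terms of \<open>lead_comm\<close> cancel. With
  \<open>contract_pow_unit\<close> this makes the full contraction by a coordinate form vanish in
  degrees at least 2, as \<open>ex_deep_element\<close> requires.\<close>

lemma lead_replicate:
  assumes "0 < k" "g \<in> \<Gamma> (Suc k)"
  shows "coef (M g) (replicate (Suc k) p) = 0"
  using assms
proof (induction rule: lc_Suc_induct)
  case (comm a b)
  have "replicate (Suc k) p = replicate k p @ [p]" by (simp add: replicate_append_same)
  then have "last (replicate (Suc k) p) = p" "butlast (replicate (Suc k) p) = replicate k p"
    by (simp_all only: last_snoc butlast_snoc)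
  then show ?case
    using lead_comm[of a b k "replicate (Suc k) p"] comm lc_closed lc_low[OF assms(1)] assms(1) by simp
next
  case one
  then show ?case by simp
next
  case (mult a b)
  then show ?case using lead_mult[of a b "Suc k" "replicate (Suc k) p"] lc_low lc_closed by simp
next
  case (inv a)
  then show ?case using lead_inv[of a "Suc k" "replicate (Suc k) p"] lc_low lc_closed by simp
qed

text \<open>In degree 1 the exponent in \<open>dynkin\<close> is 1, so no torsion is lost: the
  degree 1 coefficients determine the class in the abelianization.\<close>

lemma cls2_eq:
  assumes "g \<in> carrier G" "h \<in> carrier G" "\<And>i. i < m \<Longrightarrow> coef (M g) [i] = coef (M h) [i]"
  shows "cls 2 g = cls 2 h"
proof -
  have "(g \<otimes> inv h) [^] (1 :: nat) \<in> \<Gamma> (Suc 1)"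
  proof (rule dynkin)
    fix v assume "v \<in> W 1"
    then obtain i where v: "v = [i]" "i < m" by (auto simp: words_of_length_def length_Suc_conv)
    then show "coef (M (g \<otimes> inv h)) v = 0"
      using lead_mult[of g "inv h" 1 v] lead_inv[of h 1 v] assms by simp
  qed (use assms in auto)
  then show ?thesis using assms by (simp add: cls_eq_iff numeral_2_eq_2)
qed

theorem finite_index_if_undistorted:
  assumes und: "undistorted F H" and m: "0 < m"
  shows "finite (rcosets\<^bsub>F\<^esub> H)"
proof (rule ccontr)
  assume inf: "\<not> ?thesis"
  interpret K: normal K G by (rule K_normal)
  obtain S where S: "fin_generates F S H" using und unfolding undistorted_def by blast
  define L where "L = (\<lambda>h i. coef (M h) [i]) ` K"
  have "\<exists>a. (\<exists>i<m. a i \<noteq> 0) \<and> (\<forall>v\<in>L. (\<Sum>i<m. a i * v i) = 0)"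
  proof (rule ccontr)
    assume "\<not> ?thesis"
    moreover have "(\<lambda>i. s * u i + t * v i) \<in> L" if "u \<in> L" "v \<in> L" for s t u v
    proof -
      note uv = that
      obtain g h where g: "g \<in> K" "u = (\<lambda>i. coef (M g) [i])" "h \<in> K" "v = (\<lambda>i. coef (M h) [i])"
        using uv by (auto simp: L_def)
      have gc: "g \<in> carrier G" "h \<in> carrier G" using g K.subset by auto
      have "g [^] s \<in> K" "h [^] t \<in> K" using g subgroup_int_pow_closed[OF K.subgroup_axioms] by auto
      then have K: "g [^] s \<otimes> h [^] t \<in> K" by simp
      have "coef (M (g [^] s \<otimes> h [^] t)) [i] = s * coef (M g) [i] + t * coef (M h) [i]" for i
        using lead_mult[of "g [^] s" "h [^] t" 1 "[i]"] lead_int_pow[of g 1 "[i]" s]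
          lead_int_pow[of h 1 "[i]" t] gc by simp
      then show ?thesis using K g unfolding L_def by (intro image_eqI[of _ _ "g [^] s \<otimes> h [^] t"]) auto
    qed
    ultimately obtain d where d: "d > 0" "\<forall>i<m. \<exists>v\<in>L. \<forall>j<m. v j = (if j = i then d else 0)"
      using lattice_dichotomy[of L m] by blast
    have "\<exists>h\<in>K. cls 2 h = cls 2 (x i [^] nat d)" if i: "i < m" for i
    proof -
      obtain h where h: "h \<in> K" "\<forall>j<m. coef (M h) [j] = (if j = i then d else 0)"
        using d(2) i unfolding L_def by blast
      have "cls 2 h = cls 2 (x i [^] nat d)"
      proof (rule cls2_eq)
        show "coef (M h) [j] = coef (M (x i [^] nat d)) [j]" if "j < m" for j
          using lead_pow[of "x i" 1 "[j]" "nat d"] h(2) i that d by (auto simp: M_x)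
      qed (use h i in auto)
      then show ?thesis using h by blast
    qed
    then show False using finite_rcosets[of "nat d"] inf d by auto
  qed
  then obtain a p where a: "p < m" "a p \<noteq> 0" "\<And>v. v \<in> L \<Longrightarrow> (\<Sum>i<m. a i * v i) = 0" by blast
  have aK: "contract m a (coef (M h)) [] = 0" if "h \<in> K" for h
    using a(3)[of "\<lambda>i. coef (M h) [i]"] that by (simp add: contract_def L_def)
  show False
  proof (cases "\<exists>h\<in>K. \<exists>v\<in>W 1. coef (M h) v \<noteq> 0")
    case True
    then obtain h v where h: "h \<in> K" "v \<in> W 1" "coef (M h) v \<noteq> 0" by blast
    \<comment> \<open>Starting in degree 1, the condition on the full contraction is just
      \<open>aK\<close>; \<open>1 < c\<close> guarantees at least one bracketing step.\<close>
    have "\<exists>z\<in>K. z \<in> \<Gamma> c \<and> (\<exists>v\<in>W c. coef (M z) v \<noteq> 0) \<and> (contract m a ^^ c) (coef (M z)) [] = 0 \<and>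
      (1 < c \<longrightarrow> (\<exists>u\<in>W (c - 1). contract m a (coef (M z)) u \<noteq> 0))"
      by (rule ex_deep_element[OF K_normal, of p a 1 h v]) (use a h aK c in auto)
    then obtain z u where z: "z \<in> K" "z \<in> \<Gamma> c" "u \<in> W (c - 1)" "contract m a (coef (M z)) u \<noteq> 0"
      using c by auto
    then have "length u = c - 1" by (simp add: words_of_length_def)
    then show False using not_undistorted[OF S aK z(1,2)] z und by blast
  next
    case False
    \<comment> \<open>All of \<open>K\<close> now vanishes in degree 1, so every linear form meets
      the hypothesis of \<open>not_undistorted\<close> and the form may change during the
      argument.\<close>
    then have K1: "coef (M h) [i] = 0" if "h \<in> K" "i < m" for h i
      using that by (force simp: words_of_length_def)
    \<comment> \<open>Otherwise \<open>H\<close> would lie in the image of the finite Magnus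
      kernel.\<close>
    have "\<exists>h\<in>K. \<not> low (Suc c) h"
    proof (rule ccontr)
      assume "\<not> ?thesis"
      then have "H \<subseteq> \<pi> ` {r \<in> \<Gamma> 1. low (Suc c) r}"
        using H_lift K.subset by (fastforce simp: lc_one)
      then show False using kernel_finite[of 1 c] infinite_if_undistorted[OF und] finite_subset by auto
    qed
    then obtain h where h: "h \<in> K" "\<not> low (Suc c) h" by blast
    have hc: "h \<in> carrier G" using h by auto
    define Q where "Q = (\<lambda>j. 0 < j \<and> j < Suc c \<and> (\<exists>v\<in>W j. coef (M h) v \<noteq> 0))"
    define k where "k = (LEAST j. Q j)"
    have "\<exists>j. Q j" using h low_iff_words[OF hc] by (auto simp: Q_def)
    then have k: "Q k" unfolding k_def by (rule LeastI_ex)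
    have "low k h" unfolding low_iff_words[OF hc]
    proof (intro allI impI)
      fix j v assume j: "0 < j \<and> j < k \<and> v \<in> W j"
      then have "\<not> Q j" using not_less_Least unfolding k_def by blast
      then show "coef (M h) v = 0" using j k by (auto simp: Q_def)
    qed
    obtain v where v: "v \<in> W k" "coef (M h) v \<noteq> 0" and k0: "0 < k" "k \<le> c" using k by (auto simp: Q_def)
    have "k \<noteq> 1" using K1[OF h(1)] v by (auto simp: words_of_length_def length_Suc_conv)
    then obtain k' where k': "k = Suc k'" "0 < k'" using k0 by (cases k) auto
    obtain n :: nat where n: "n > 0" "h [^] n \<in> \<Gamma> k" using low_pow_lc[OF k0(1) hc \<open>low k h\<close>] by blast
    have hn: "h [^] n \<in> K" by (rule K_nat_pow[OF h(1)])
    have vl: "length v = k" using v by (simp add: words_of_length_def)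
    have hv: "coef (M (h [^] n)) v \<noteq> 0"
      using lead_pow[OF hc \<open>low k h\<close> vl k0(1)] v n by simp
    let ?e = "\<lambda>p i. if i = p then 1 else (0 :: int)"
    \<comment> \<open>The form \<open>?e 0\<close> only serves to reach degree \<open>c\<close> with
      some nonzero coefficient.\<close>
    have "(contract m (?e 0) ^^ k) (coef (M (h [^] n))) [] = 0"
      using contract_pow_unit[OF m, of k "coef (M (h [^] n))" "[]"] lead_replicate[OF k'(2)] n k' by simp
    then have "\<exists>z\<in>K. z \<in> \<Gamma> c \<and> (\<exists>v\<in>W c. coef (M z) v \<noteq> 0) \<and>
      (contract m (?e 0) ^^ c) (coef (M z)) [] = 0 \<and>
      (k < c \<longrightarrow> (\<exists>u\<in>W (c - 1). contract m (?e 0) (coef (M z)) u \<noteq> 0))"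
      by (intro ex_deep_element[OF K_normal, of 0 "?e 0" k "h [^] n" v]) (use m k0 hn n v hv in auto)
    then obtain z w where z: "z \<in> K" "z \<in> \<Gamma> c" "w \<in> W c" "coef (M z) w \<noteq> 0" by blast
    obtain i u where w: "w = i # u" "i < m" "length u = c - 1"
      using z(3) c by (cases w) (auto simp: words_of_length_def)
    \<comment> \<open>The form is now matched to the first letter of the word found, so that the
      contraction is the nonzero coefficient itself.\<close>
    have e: "contract m (?e i) P u = P (i # u)" for P u
      using contract_pow_unit[OF w(2), of 1 P u] by simp
    show False
      using not_undistorted[OF S _ z(1,2) w(3), of "?e i"] K1 w z(4) und by (simp add: e)
  qed
qed

text \<open>The lower bound needs elements that are long in \<open>H\<close>. With \<open>q\<close>
  the index, powers of \<open>x 0 [^] q\<close> lie in \<open>H\<close> modulo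
  \<open>\<Gamma> (Suc c)\<close>; their degree 1 coefficient is proportional to the exponent, while
  a product of generators of \<open>H\<close> reaches such a value at most linearly in its
  length.\<close>

theorem undistorted_if_finite_index:
  assumes fin: "finite (rcosets\<^bsub>F\<^esub> H)" and m: "0 < m"
  shows "undistorted F H"
proof -
  obtain S where S: "fin_generates F S H" "\<And>h. h \<in> H \<Longrightarrow> word_length F S h \<le> word_length F T h + 2"
    using F.finite_index_length[OF T_generates H_normal fin] by blast
  let ?d = "distortion F T H S"
  have mono: "mono ?d" by (rule F.mono_distortion[OF T_generates H.subgroup_axioms])
  have "?d n \<le> 2 * (2 * n + 2)" for n
    by (rule F.distortion_le[OF T_generates H.subgroup_axioms]) (use S(2) in fastforce)
  then have 1: "asymp_le ?d (\<lambda>n. n)" unfolding asymp_le_def by (intro exI[of _ 2]) auto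
  define q where "q = order (F Mod H)"
  have grp: "group (F Mod H)" by (rule H.factorgroup_is_group)
  have q: "0 < q" using fin monoid.one_closed[OF group.is_monoid[OF grp]] by (auto simp: q_def order_def card_gt_0_iff FactGroup_def)
  have x0: "x 0 \<in> carrier G" using m by simp
  have "(H #>\<^bsub>F\<^esub> \<pi> (x 0)) [^]\<^bsub>F Mod H\<^esub> q = \<one>\<^bsub>F Mod H\<^esub>"
    unfolding q_def by (rule group.pow_order_eq_1[OF grp]) (use x0 in \<open>auto simp: carrier_FactGroup[of F H]\<close>)
  then have "H #>\<^bsub>F\<^esub> (\<pi> (x 0) [^]\<^bsub>F\<^esub> q) = H" using x0 by (simp add: H.FactGroup_pow one_FactGroup)
  then have "\<pi> (x 0) [^]\<^bsub>F\<^esub> q \<in> H"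
    using F.rcos_self[of "\<pi> (x 0) [^]\<^bsub>F\<^esub> q" H] x0 H.subgroup_axioms by auto
  then have zH: "\<pi> (x 0 [^] q) \<in> H" using x0 pi.hom_nat_pow by simp
  obtain S' where S': "finite S'" "S' \<subseteq> K"
    "\<And>h. h \<in> H \<Longrightarrow> \<exists>ss. set ss \<subseteq> S' \<and> length ss = word_length F S h \<and> \<pi> (pr ss) = h"
    using lift_words[OF S(1)] by blast
  have S'c: "S' \<subseteq> carrier G" using S' by (auto simp: K_def)
  obtain E where E: "E \<ge> 0" "\<And>ss. set ss \<subseteq> S' \<Longrightarrow>
    \<bar>coef (M (pr ss)) [0]\<bar> \<le> E * int (Suc (length ss)) ^ length [0 :: nat]"
    using prod_bound[OF S'(1) S'c, of "[0]"] by blast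
  have bound: "n \<le> nat E * (?d (q * n) + 1)" for n
  proof -
    let ?z = "x 0 [^] (q * n)"
    have "\<pi> ?z = \<pi> (x 0 [^] q) [^]\<^bsub>F\<^esub> n"
      using x0 pi.hom_nat_pow[of "x 0 [^] q" n] by (simp add: nat_pow_pow)
    then have h: "\<pi> ?z \<in> H" 
      using F.subgroup_int_pow_closed[OF H.subgroup_axioms zH, of "int n"] by (simp add: int_pow_int)
    have "word_length F T (\<pi> ?z) \<le> len ?z" using x0 by (intro length_pi_le) simp
    also have "\<dots> \<le> (q * n) * len (x 0)" by (rule len_pow[OF x0])
    also have "\<dots> \<le> (q * n) * 1" using len_x[OF m] by (intro mult_le_mono2)
    finally have "word_length F S (\<pi> ?z) \<le> ?d (q * n)"
      by (intro F.distortion_ge T_generates H.subset h) simp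
    moreover obtain ss where ss: "set ss \<subseteq> S'" "length ss = word_length F S (\<pi> ?z)" "\<pi> (pr ss) = \<pi> ?z"
      using S'(3)[OF h] by blast
    moreover have "coef (M (pr ss)) [0] = int (q * n)"
    proof -
      have "pr ss \<in> carrier G" using ss S'c by (intro foldr_mult_closed) auto
      then have "coef (M (pr ss)) [0] = coef (M ?z) [0]"
        by (intro coef_cong[of _ _ 1]) (use ss x0 c in auto)
      also have "\<dots> = int (q * n) * coef (M (x 0)) [0]" using x0 by (intro lead_pow[of _ 1]) auto
      finally show ?thesis using m by (simp add: M_x)
    qed
    ultimately have "int (q * n) \<le> E * int (?d (q * n) + 1)"
      using E(2)[OF ss(1)] order_trans[OF _ mult_left_mono[of "int (Suc (length ss))" "int (?d (q * n) + 1)" E]] E(1)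
      by simp
    moreover have "n \<le> q * n" using q by simp
    then have "int n \<le> int (q * n)" by (rule of_nat_mono)
    moreover have "E * int (?d (q * n) + 1) = int (nat E * (?d (q * n) + 1))"
      using E(1) by (simp add: distrib_left)
    ultimately have "int n \<le> int (nat E * (?d (q * n) + 1))" by linarith
    then show ?thesis by (simp only: of_nat_le_iff)
  qed
  define D where "D = Suc (nat E + q + q * nat E)"
  have "n \<le> D * ?d (D * n + D)" for n
  proof -
    \<comment> \<open>Using the bound at \<open>n + nat E\<close> cancels the additive
      constant.\<close>
    have "n + nat E \<le> nat E * ?d (q * (n + nat E)) + nat E" using bound[of "n + nat E"] by simp
    then have "n \<le> nat E * ?d (q * (n + nat E))" by simp
    also have "\<dots> \<le> D * ?d (D * n + D)"
      by (intro mult_le_mono monoD[OF mono]) (auto simp: D_def algebra_simps)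
    finally show ?thesis .
  qed
  then have "asymp_le (\<lambda>n. n) ?d" unfolding asymp_le_def by (intro exI[of _ D]) (auto simp: D_def)
  with 1 show ?thesis using T_generates S(1) unfolding undistorted_def asymp_equiv_def by blast
qed

end

section \<open>The free nilpotent group\<close>

text \<open>The second equation is the geometric series inverting
  \<open>1 + letter i\<close>.\<close>

fun letter_series :: "nat \<times> bool \<Rightarrow> ncseries"
  where
    "letter_series (i, True) = 1 + letter i"
  | "letter_series (i, False) =
      Series (\<lambda>w. if w = replicate (length w) i then (- 1) ^ length w else 0)"

text \<open>A letter is stripped from the side of \<open>1 + letter i\<close>, whose shift is 1 or
  0; hence left shifts for one product and right shifts for the other.\<close>

lemma letter_series_inverse:
  "letter_series (i, True) * letter_series (i, False) = 1" (is "?f * ?g = 1")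
  "letter_series (i, False) * letter_series (i, True) = 1"
proof -
  show "?f * ?g = 1"
  proof (rule ncseries_eqI)
    fix w show "coef (?f * ?g) w = coef 1 w"
    proof (cases w)
      case (Cons j v)
      have "left_shift j ?f = (if j = i then 1 else 0)" by (rule ncseries_eqI) auto
      then show ?thesis using Cons by (auto simp: coef_mult_Cons)
    qed simp
  qed
  show "?g * ?f = 1"
  proof (rule ncseries_eqI)
    fix w show "coef (?g * ?f) w = coef 1 w"
    proof (cases w rule: rev_cases)
      case (snoc v j)
      have "right_shift j ?f = (if j = i then 1 else 0)" by (rule ncseries_eqI) auto
      moreover have "v @ [j] = i # replicate (length v) i \<longleftrightarrow> j = i \<and> v = replicate (length v) i"
        unfolding replicate_append_same[symmetric] by auto
      ultimately show ?thesis using snoc by (auto simp: coef_mult_snoc)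
    qed simp
  qed
qed

definition word_series :: "(nat \<times> bool) list \<Rightarrow> ncseries"
  where "word_series u = prod_list (map letter_series u)"

lemma word_series_equiv: "(u, v) \<in> free_equiv Y \<Longrightarrow> word_series u = word_series v"
proof (induction rule: free_equiv.induct)
  case (cancel u v x b)
  have "letter_series (x, b) * (letter_series (x, \<not> b) * f) = f" for f
    by (cases b) (simp_all add: letter_series_inverse del: letter_series.simps flip: mult.assoc)
  then show ?case by (simp add: word_series_def)
qed auto

text \<open>Defined through a chosen representative; \<open>word_series_equiv\<close> shows that
  every representative gives the same series.\<close>

definition magnus :: "(nat \<times> bool) list set \<Rightarrow> ncseries"
  where "magnus A = word_series (SOME u. u \<in> A)"

lemma magnus_class:
  assumes "u \<in> words Y"
  shows "magnus (free_equiv Y `` {u}) = word_series u"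
proof -
  have "u \<in> free_equiv Y `` {u}" using assms by (auto intro: free_equiv.refl)
  then have "(SOME v. v \<in> free_equiv Y `` {u}) \<in> free_equiv Y `` {u}" by (rule someI)
  then have "(u, SOME v. v \<in> free_equiv Y `` {u}) \<in> free_equiv Y" by simp
  then show ?thesis unfolding magnus_def using word_series_equiv by metis
qed

abbreviation free_gen :: "nat \<Rightarrow> nat \<Rightarrow> (nat \<times> bool) list set"
  where "free_gen m i \<equiv> free_equiv {..<m} `` {[(i, True)]}"

lemma free_gen_inv:
  assumes "i < m"
  shows "inv\<^bsub>free_group {..<m}\<^esub> (free_gen m i) = free_equiv {..<m} `` {[(i, False)]}"
proof -
  interpret R: group "free_group {..<m}" by (rule group_free_group)
  have "([(i, False), (i, True)], []) \<in> free_equiv {..<m}"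
    using free_equiv.cancel[of "[]" "{..<m}" "[]" i False] assms by simp
  then have "free_equiv {..<m} `` {[(i, False)]} \<otimes>\<^bsub>free_group {..<m}\<^esub> free_gen m i = \<one>\<^bsub>free_group {..<m}\<^esub>"
    using assms by (simp add: free_group_mult_class free_group_one equiv_class_eq[OF equiv_free_equiv])
  then show ?thesis using assms by (intro R.inv_equality free_group_carrierI) auto
qed

lemma free_group_generate:
  "generate (free_group {..<m}) (free_gen m ` {..<m}) = carrier (free_group {..<m})"
proof -
  let ?R = "free_group {..<m}"
  interpret R: group ?R by (rule group_free_group)
  have "free_equiv {..<m} `` {u} \<in> generate ?R (free_gen m ` {..<m})" if "u \<in> words {..<m}" for u
    using that
  proof (induction u)
    case Nil
    then show ?case using generate.one[of ?R] by (simp add: free_group_one)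
  next
    case (Cons l u)
    obtain i b where l: "l = (i, b)" "i < m" using Cons.prems by (cases l) auto
    have "free_equiv {..<m} `` {[l]} \<in> generate ?R (free_gen m ` {..<m})"
    proof (cases b)
      case True
      then show ?thesis using l by (auto intro: generate.incl)
    next
      case False
      have "inv\<^bsub>?R\<^esub> (free_gen m i) \<in> generate ?R (free_gen m ` {..<m})"
        using l by (intro generate.inv) auto
      then show ?thesis using l False free_gen_inv[of i m] by simp
    qed
    then have "free_equiv {..<m} `` {[l]} \<otimes>\<^bsub>?R\<^esub> free_equiv {..<m} `` {u}
        \<in> generate ?R (free_gen m ` {..<m})"
      using Cons by (intro generate.eng) auto
    then show ?case using Cons.prems l by (simp add: free_group_mult_class)
  qed
  then have "carrier ?R \<subseteq> generate ?R (free_gen m ` {..<m})"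
    by (auto elim!: free_group_carrierE)
  moreover have "generate ?R (free_gen m ` {..<m}) \<subseteq> carrier ?R"
    by (intro R.generate_incl) (auto intro: free_group_carrierI)
  ultimately show ?thesis by (rule equalityI[rotated])
qed

lemma magnus_rep_free_group: "magnus_rep (free_group {..<m}) m (free_gen m) magnus"
proof -
  interpret R: group "free_group {..<m}" by (rule group_free_group)
  show ?thesis
  proof
    show "free_gen m i \<in> carrier (free_group {..<m})" if "i < m" for i
      using that by (intro free_group_carrierI) simp
    show "generate (free_group {..<m}) (free_gen m ` {..<m}) = carrier (free_group {..<m})"
      by (rule free_group_generate)
    show "magnus \<one>\<^bsub>free_group {..<m}\<^esub> = 1"
      by (simp add: free_group_one magnus_class word_series_def)
    show "magnus (a \<otimes>\<^bsub>free_group {..<m}\<^esub> b) = magnus a * magnus b"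
      if "a \<in> carrier (free_group {..<m})" "b \<in> carrier (free_group {..<m})" for a b
      using that
      by (auto elim!: free_group_carrierE simp: free_group_mult_class magnus_class word_series_def)
    show "magnus (free_gen m i) = 1 + letter i" if "i < m" for i
      using that by (simp add: magnus_class word_series_def)
  qed
qed

theorem corollary1p8:
  fixes m c :: nat and H :: "(nat \<times> bool) list set set set"
  assumes "m \<ge> 1" and "c \<ge> 2"
    and "H \<lhd> free_nilpotent_group m c"
    and "H \<noteq> {\<one>\<^bsub>free_nilpotent_group m c\<^esub>}"
  shows "undistorted (free_nilpotent_group m c) H \<longleftrightarrow>
    finite (rcosets\<^bsub>free_nilpotent_group m c\<^esub> H)"
proof -
  have eq: "free_nilpotent_group m c = free_group {..<m} Mod lower_central (free_group {..<m}) (Suc c)"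
    by (simp add: free_nilpotent_group_def)
  interpret magnus_quotient "free_group {..<m}" m "free_gen m" magnus c H
    using assms(2,3) unfolding eq
    by (intro magnus_quotient.intro magnus_rep_free_group magnus_quotient_axioms.intro)
  show ?thesis
    unfolding eq using finite_index_if_undistorted undistorted_if_finite_index assms(1) by auto
qed

end
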